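(* Let $\mathbf{k}$ be a commutative ring with $1$, let $n\ge0$, and let $R=\mathbf{k}M$ where either $M=\mathscr{F}_n$ with $G=\mathfrak{S}_n$, or $M=\mathscr{F}^{(q)}_n$ with $G=GL_n(\mathbb{F}_q)$; in the latter case assume further that $q\in\mathbf{k}^\times$. (i) The $\mathbf{k}$-algebra map $\gamma:\mathbf{k}[X]\to R$ sending $X\mapsto x$ (if $M=\mathscr{F}_n$) or $X\mapsto x^{(q)}$ (if $M=\mathscr{F}^{(q)}_n$) induces an algebra isomorphism $\mathbf{k}[X]/(f(X))\cong R^G$, where $f(X)=X(X-1)(X-2)\cdots(X-n)$ if $M=\mathscr{F}_n$ and $f(X)=X(X-[1]_q)(X-[2]_q)\cdots(X-[n]_q)$ if $M=\mathscr{F}^{(q)}_n$. In particular $R^G$ is commutative and generated by $x$, resp. $x^{(q)}$. (ii) If moreover $\mathbf{k}$ is a field in which $|G|$ is invertible, then $x$, resp. $x^{(q)}$, acts semisimply on every finite-dimensional $R^G$-module, with eigenvalues contained in $\{0,1,2,\ldots,n\}$ if $M=\mathscr{F}_n$, resp. in $\{[0]_q,[1]_q,\ldots,[n]_q\}$ if $M=\mathscr{F}^{(q)}_n$.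
   Context: The free left-regular band $\mathscr{F}_n$ is the monoid whose elements are words $(a_1,\ldots,a_\ell)$, $0\le\ell\le n$, with letters in $\{1,\ldots,n\}$ and no repeated letters, with product $\mathbf{a}\cdot\mathbf{b}=(a_1,\ldots,a_\ell,b_1,\ldots,b_m)^\wedge$ where $^\wedge$ deletes every entry already occurring earlier in the sequence. For a prime power $q$, $\mathscr{F}^{(q)}_n$ is the monoid of partial flags $\mathbf{A}=(A_1\subset\cdots\subset A_\ell)$ of subspaces of $\mathbb{F}_q^n$ with $\dim A_i=i$, $0\le\ell\le n$, with product $\mathbf{A}\cdot\mathbf{B}=(A_1,\ldots,A_\ell,A_\ell+B_1,\ldots,A_\ell+B_m)^\wedge$ (deleting subspaces equal to an earlier one); in both monoids the empty sequence is the identity. $\mathbf{k}M$ is the monoid algebra. $\mathfrak{S}_n$ acts on $\mathscr{F}_n$ by $w(a_1,\ldots,a_\ell)=(w(a_1),\ldots,w(a_\ell))$ and $GL_n(\mathbb{F}_q)$ acts on $\mathscr{F}^{(q)}_n$ by $g(A_1,\ldots,A_\ell)=(gA_1,\ldots,gA_\ell)$, extended to algebra automorphisms; $R^G$ is the invariant subalgebra. $x=(1)+(2)+\cdots+(n)\in\mathbf{k}\mathscr{F}_n$ and $x^{(q)}=\sum_{\text{lines }L\subset\mathbb{F}_q^n}(L)\in\mathbf{k}\mathscr{F}^{(q)}_n$. $[m]_q=1+q+\cdots+q^{m-1}$. *)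

theory Defs
  imports
    "HOL-Algebra.Sym_Groups"
    "HOL-Algebra.UnivPoly"
    "HOL-Algebra.QuotRing"
    "HOL-Algebra.Subrings"
    "Jordan_Normal_Form.VS_Connect"
begin

subsection \<open>The two monoids\<close>

text \<open>Keeps the first occurrence of every entry; the library function \<open>remdups\<close> keeps the last.\<close>

definition dedup :: "'a list \<Rightarrow> 'a list" where
  "dedup xs = rev (remdups (rev xs))"

definition free_lrb :: "nat \<Rightarrow> nat list monoid" where
  "free_lrb n =
    \<lparr>carrier = {a. distinct a \<and> set a \<subseteq> {1..n}}, mult = (\<lambda>a b. dedup (a @ b)), one = []\<rparr>"

definition vec_subspace :: "'f::field itself \<Rightarrow> nat \<Rightarrow> nat \<Rightarrow> 'f vec set \<Rightarrow> bool" where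
  "vec_subspace ty n d W \<longleftrightarrow>
     VectorSpace.subspace class_ring W (module_vec TYPE('f) n) \<and>
     vectorspace.dim (class_ring :: 'f ring) (module_vec TYPE('f) n\<lparr>carrier := W\<rparr>) = d"

text \<open>The flag $(A_1 \subset \cdots \subset A_\ell)$ is the list whose entry at index $i$ is $A_{i+1}$.
  In the product, $A_\ell$ is read as the zero subspace when $\ell = 0$.\<close>

definition flag_monoid :: "'f::field itself \<Rightarrow> nat \<Rightarrow> 'f vec set list monoid" where
  "flag_monoid ty n =
    \<lparr>carrier = {A. (\<forall>i<length A. vec_subspace TYPE('f) n (Suc i) (A ! i)) \<and>
                   (\<forall>i. Suc i < length A \<longrightarrow> A ! i \<subset> A ! Suc i)},
     mult = (\<lambda>A B. dedup (A @ map (\<lambda>U. last ({0\<^sub>v n} # A) <+>\<^bsub>module_vec TYPE('f) n\<^esub> U) B)),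
     one = []\<rparr>"

definition general_linear_group :: "'f::field itself \<Rightarrow> nat \<Rightarrow> 'f mat monoid" where
  "general_linear_group ty n = units_of (ring_mat TYPE('f) n ())"

definition word_action :: "(nat \<Rightarrow> nat) \<Rightarrow> nat list \<Rightarrow> nat list" where
  "word_action w a = map w a"

definition flag_action :: "'f::field mat \<Rightarrow> 'f vec set list \<Rightarrow> 'f vec set list" where
  "flag_action g A = map (\<lambda>U. (\<lambda>v. g *\<^sub>v v) ` U) A"


subsection \<open>Algebras over a commutative ring\<close>

text \<open>A (not necessarily commutative) algebra over \<open>K\<close> is a record of type \<open>module\<close>, which carries
  both the ring operations and the scalar multiplication.\<close>

definition alg_hom ::
  "('k, 'c) ring_scheme \<Rightarrow> ('k, 'a, 'd) module_scheme \<Rightarrow> ('k, 'b, 'e) module_scheme \<Rightarrow> ('a \<Rightarrow> 'b) set"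
where
  "alg_hom K A B = {h \<in> Ring.ring_hom A B.
     \<forall>c\<in>carrier K. \<forall>a\<in>carrier A. h (c \<odot>\<^bsub>A\<^esub> a) = c \<odot>\<^bsub>B\<^esub> h a}"

definition alg_iso ::
  "('k, 'c) ring_scheme \<Rightarrow> ('k, 'a, 'd) module_scheme \<Rightarrow> ('k, 'b, 'e) module_scheme \<Rightarrow> ('a \<Rightarrow> 'b) set"
where
  "alg_iso K A B = {h \<in> alg_hom K A B. bij_betw h (carrier A) (carrier B)}"

definition alg_quot :: "('k, 'a, 'd) module_scheme \<Rightarrow> 'a set \<Rightarrow> ('k, 'a set) module" where
  "alg_quot A I =
     ring.extend (A Quot I) (module.fields (\<lambda>c C. \<Union>a\<in>C. I +>\<^bsub>A\<^esub> (c \<odot>\<^bsub>A\<^esub> a)))"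

definition generated_subalgebra ::
  "('k, 'c) ring_scheme \<Rightarrow> ('k, 'a, 'd) module_scheme \<Rightarrow> 'a set \<Rightarrow> 'a set"
where
  "generated_subalgebra K A X =
     \<Inter>{B. subring B A \<and> (\<forall>c\<in>carrier K. \<forall>b\<in>B. c \<odot>\<^bsub>A\<^esub> b \<in> B) \<and> X \<subseteq> B}"

text \<open>The elements of the monoid algebra are the finitely supported functions \<open>M \<rightarrow> K\<close>, extended
  by zero to the whole type.\<close>

definition support :: "('k, 'c) ring_scheme \<Rightarrow> ('m \<Rightarrow> 'k) \<Rightarrow> 'm set" where
  "support K a = {m. a m \<noteq> \<zero>\<^bsub>K\<^esub>}"

definition basis_elt :: "('k, 'c) ring_scheme \<Rightarrow> 'm \<Rightarrow> 'm \<Rightarrow> 'k" where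
  "basis_elt K m = (\<lambda>m'. if m' = m then \<one>\<^bsub>K\<^esub> else \<zero>\<^bsub>K\<^esub>)"

definition monoid_algebra ::
  "('k, 'c) ring_scheme \<Rightarrow> ('m, 'd) monoid_scheme \<Rightarrow> ('k, 'm \<Rightarrow> 'k) module"
where
  "monoid_algebra K M =
    \<lparr>carrier = {a. range a \<subseteq> carrier K \<and> finite (support K a) \<and> support K a \<subseteq> carrier M},
     mult = (\<lambda>a b m. \<Oplus>\<^bsub>K\<^esub>p\<in>{p \<in> support K a \<times> support K b. fst p \<otimes>\<^bsub>M\<^esub> snd p = m}.
               a (fst p) \<otimes>\<^bsub>K\<^esub> b (snd p)),
     one = basis_elt K \<one>\<^bsub>M\<^esub>,
     zero = (\<lambda>m. \<zero>\<^bsub>K\<^esub>),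
     add = (\<lambda>a b m. a m \<oplus>\<^bsub>K\<^esub> b m),
     smult = (\<lambda>c a m. c \<otimes>\<^bsub>K\<^esub> a m)\<rparr>"

definition linear_extension ::
  "('k, 'c) ring_scheme \<Rightarrow> ('m, 'd) monoid_scheme \<Rightarrow> ('m \<Rightarrow> 'm) \<Rightarrow> ('m \<Rightarrow> 'k) \<Rightarrow> 'm \<Rightarrow> 'k"
where
  "linear_extension K M \<phi> a =
     (\<Oplus>\<^bsub>monoid_algebra K M\<^esub>m\<in>support K a. a m \<odot>\<^bsub>monoid_algebra K M\<^esub> basis_elt K (\<phi> m))"

definition invariant_subalgebra ::
  "('k, 'c) ring_scheme \<Rightarrow> ('m, 'd) monoid_scheme \<Rightarrow> ('g, 'e) monoid_scheme \<Rightarrow> ('g \<Rightarrow> 'm \<Rightarrow> 'm) \<Rightarrow>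
     ('k, 'm \<Rightarrow> 'k) module"
where
  "invariant_subalgebra K M G act = (monoid_algebra K M)
     \<lparr>carrier := {a \<in> carrier (monoid_algebra K M). \<forall>g\<in>carrier G. linear_extension K M (act g) a = a}\<rparr>"

definition letter_sum :: "('k, 'c) ring_scheme \<Rightarrow> nat \<Rightarrow> nat list \<Rightarrow> 'k" where
  "letter_sum K n = (\<Oplus>\<^bsub>monoid_algebra K (free_lrb n)\<^esub>i\<in>{1..n}. basis_elt K [i])"

definition line_sum ::
  "('k, 'c) ring_scheme \<Rightarrow> 'f::field itself \<Rightarrow> nat \<Rightarrow> 'f vec set list \<Rightarrow> 'k"
where
  "line_sum K ty n =
     (\<Oplus>\<^bsub>monoid_algebra K (flag_monoid TYPE('f) n)\<^esub>L\<in>{L. vec_subspace TYPE('f) n 1 L}. basis_elt K [L])"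


subsection \<open>The polynomials\<close>

definition q_int :: "nat \<Rightarrow> nat \<Rightarrow> nat" where
  "q_int q m = (\<Sum>i<m. q ^ i)"

definition nat_in :: "('k, 'c) ring_scheme \<Rightarrow> nat \<Rightarrow> 'k" where
  "nat_in K m = [m] \<cdot>\<^bsub>K\<^esub> \<one>\<^bsub>K\<^esub>"

definition poly_X :: "('k, 'c) ring_scheme \<Rightarrow> nat \<Rightarrow> 'k" where
  "poly_X K = up_ring.monom (UP K) \<one>\<^bsub>K\<^esub> 1"

definition root_poly :: "('k, 'c) ring_scheme \<Rightarrow> (nat \<Rightarrow> nat) \<Rightarrow> nat \<Rightarrow> nat \<Rightarrow> 'k" where
  "root_poly K r n = poly_X K \<otimes>\<^bsub>UP K\<^esub>
     (\<Otimes>\<^bsub>UP K\<^esub>i\<in>{1..n}. poly_X K \<ominus>\<^bsub>UP K\<^esub> up_ring.monom (UP K) (nat_in K (r i)) 0)"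

definition poly_map :: "('k, 'c) ring_scheme \<Rightarrow> ('k, 'a, 'd) module_scheme \<Rightarrow> 'a \<Rightarrow> (nat \<Rightarrow> 'k) \<Rightarrow> 'a" where
  "poly_map K A x = UnivPoly.eval K A (\<lambda>c. c \<odot>\<^bsub>A\<^esub> \<one>\<^bsub>A\<^esub>) x"


subsection \<open>Modules over an algebra and semisimple operators\<close>

definition restrict_scalars ::
  "('k, 'a, 'd) module_scheme \<Rightarrow> ('a, 'v, 'e) module_scheme \<Rightarrow> ('k, 'v) module"
where
  "restrict_scalars A V =
     ring.extend (ring.truncate V) (module.fields (\<lambda>c v. (c \<odot>\<^bsub>A\<^esub> \<one>\<^bsub>A\<^esub>) \<odot>\<^bsub>V\<^esub> v))"

definition semisimple_operator ::
  "('k, 'c) ring_scheme \<Rightarrow> ('k, 'v, 'd) module_scheme \<Rightarrow> ('v \<Rightarrow> 'v) \<Rightarrow> bool"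
where
  "semisimple_operator K V T \<longleftrightarrow>
     (\<forall>U. VectorSpace.subspace K U V \<and> T ` U \<subseteq> U \<longrightarrow>
       (\<exists>W. VectorSpace.subspace K W V \<and> T ` W \<subseteq> W \<and>
            U \<inter> W = {\<zero>\<^bsub>V\<^esub>} \<and> U <+>\<^bsub>V\<^esub> W = carrier V))"

definition eigenspace_of :: "('k, 'v, 'd) module_scheme \<Rightarrow> ('v \<Rightarrow> 'v) \<Rightarrow> 'k \<Rightarrow> 'v set" where
  "eigenspace_of V T c = {v \<in> carrier V. T v = c \<odot>\<^bsub>V\<^esub> v}"

definition eigenvalues_of ::
  "('k, 'c) ring_scheme \<Rightarrow> ('k, 'v, 'd) module_scheme \<Rightarrow> ('v \<Rightarrow> 'v) \<Rightarrow> 'k set"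
where
  "eigenvalues_of K V T = {c \<in> carrier K. \<exists>v\<in>eigenspace_of V T c. v \<noteq> \<zero>\<^bsub>V\<^esub>}"

text \<open>The last conjunct says that no eigenvalue lies outside the base field: a semisimple
  operator all of whose eigenvalues, over an algebraic closure, belong to \<open>E \<subseteq> K\<close> is diagonalisable
  over \<open>K\<close> with eigenvalues in \<open>E\<close>, whereas one without any eigenvalue in \<open>K\<close> can still be semisimple.\<close>

definition acts_semisimply_with_eigenvalues_in ::
  "('k, 'c) ring_scheme \<Rightarrow> ('k, 'v, 'd) module_scheme \<Rightarrow> ('v \<Rightarrow> 'v) \<Rightarrow> 'k set \<Rightarrow> bool"
where
  "acts_semisimply_with_eigenvalues_in K V T E \<longleftrightarrow>
     semisimple_operator K V T \<and> eigenvalues_of K V T \<subseteq> E \<and>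
     LinearCombinations.module.span K V (\<Union>c\<in>E. eigenspace_of V T c) = carrier V"

end

theory Submission
  imports Defs
begin

text \<open>
  Both monoids carry a length for which the group orbits are exactly the levels, so the invariants are
  the functions that are constant on levels. Multiplying such a function \<open>a\<close> on the right by \<open>x\<close> gives
  \<open>(a x)\<^sub>k = [k] a\<^sub>k + q\<^bsup>k-1\<^esup> a\<^bsub>k-1\<^esub>\<close> (with \<open>q = 1\<close> for words): a word or flag of length \<open>k\<close>
  absorbs \<open>[k]\<close> letters, and it arises in \<open>q\<^bsup>k-1\<^esup>\<close> ways by adding a letter to a shorter one.
  Hence \<open>x (x - [1]) \<dots> (x - [k-1])\<close> is a power of \<open>q\<close> times the indicator function of level \<open>k\<close>.
  As these powers are units, the Newton polynomials \<open>X (X - [1]) \<dots> (X - [k-1])\<close> for \<open>k \<le> n\<close>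
  are mapped to a basis of the invariants, and the one for \<open>k = n + 1\<close> generates the kernel.

  For semisimplicity, the top level is one orbit with \<open>[1] [2] \<dots> [n]\<close> elements, so every \<open>[k]\<close> with
  \<open>1 \<le> k \<le> n\<close> divides the group order. Then \<open>[j] - [i] = q\<^sup>i [j - i]\<close> shows that the roots of
  \<open>f\<close> are distinct.
\<close>

section \<open>Monoid algebras of finite monoids\<close>

text \<open>The algebra is noncommutative and enters only through right multiplication by
  \<open>x\<close>: as \<open>\<gamma> p\<close> is the right multiple of the identity by
  \<open>\<gamma> p\<close>, all values of \<open>\<gamma>\<close> come from applying that operator
  to the identity. Two counts determine the operator, and the locale \<open>level_monoid\<close>
  isolates them. A word absorbs the letters that occur in it and arises from a shorter word only by
  appending its last letter. A flag absorbs the lines in its top subspace, and the lines carrying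
  \<open>C\<close> to \<open>C @ [U]\<close> are those in \<open>U\<close> outside the top of
  \<open>C\<close>, in number \<open>[k + 1] - [k] = q ^ k\<close>. The obstacle is that
  \<open>K\<close> is an arbitrary commutative ring, where \<open>[0], ..., [n]\<close> may coincide
  or differ by zero divisors. Divisibility by the product of the \<open>X - [i]\<close> can
  therefore not be read off from the roots one at a time. Instead, the level functions vanishing
  below level \<open>k\<close> form a filtration that is stable under right multiplication by
  \<open>x\<close>. The Newton polynomials are triangular for it with unit leading values, the
  powers of \<open>q\<close> with exponent \<open>k (k - 1) / 2\<close>, so kernel and image of
  \<open>\<gamma>\<close> can be determined level by level.\<close>

locale finite_monoid_algebra = K: cring K + M: monoid M
  for K :: "('k, 'c) ring_scheme" (structure) and M :: "('m, 'd) monoid_scheme" (structure) +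
  assumes finite_carrier [simp, intro]: "finite (carrier M)"
begin

abbreviation R where "R \<equiv> monoid_algebra K M"

text \<open>Finite support is automatic over a finite monoid, so only the values of the function
  matter.\<close>

lemma mem_carrier_iff:
  "a \<in> carrier R \<longleftrightarrow> (\<forall>m. a m \<in> carrier K) \<and> (\<forall>m. m \<notin> carrier M \<longrightarrow> a m = \<zero>\<^bsub>K\<^esub>)"
  by (auto simp: monoid_algebra_def support_def intro: finite_subset[OF _ finite_carrier])

lemma coeff_in [simp, intro]: "a \<in> carrier R \<Longrightarrow> a m \<in> carrier K"
  by (simp add: mem_carrier_iff)

lemma coeff_out: "a \<in> carrier R \<Longrightarrow> m \<notin> carrier M \<Longrightarrow> a m = \<zero>\<^bsub>K\<^esub>"
  by (simp add: mem_carrier_iff)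

lemma apply_simps [simp]:
  "(a \<oplus>\<^bsub>R\<^esub> b) m = a m \<oplus>\<^bsub>K\<^esub> b m" "\<zero>\<^bsub>R\<^esub> m = \<zero>\<^bsub>K\<^esub>" "(c \<odot>\<^bsub>R\<^esub> a) m = c \<otimes>\<^bsub>K\<^esub> a m"
  "\<one>\<^bsub>R\<^esub> m = (if m = \<one>\<^bsub>M\<^esub> then \<one>\<^bsub>K\<^esub> else \<zero>\<^bsub>K\<^esub>)"
  by (auto simp: monoid_algebra_def basis_elt_def)

text \<open>Summing over all pairs makes the index sets independent of \<open>a\<close> and
  \<open>b\<close>; the added terms vanish. Linearity and exchange of sums then apply
  directly.\<close>

lemma mult_apply:
  assumes "a \<in> carrier R" "b \<in> carrier R"
  shows "(a \<otimes>\<^bsub>R\<^esub> b) m =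
    (\<Oplus>\<^bsub>K\<^esub>i\<in>carrier M. \<Oplus>\<^bsub>K\<^esub>j\<in>carrier M. if i \<otimes>\<^bsub>M\<^esub> j = m then a i \<otimes>\<^bsub>K\<^esub> b j else \<zero>\<^bsub>K\<^esub>)"
proof -
  let ?h = "\<lambda>(i, j). if i \<otimes>\<^bsub>M\<^esub> j = m then a i \<otimes>\<^bsub>K\<^esub> b j else \<zero>\<^bsub>K\<^esub>"
  have "(a \<otimes>\<^bsub>R\<^esub> b) m =
      (\<Oplus>\<^bsub>K\<^esub>p\<in>{p \<in> support K a \<times> support K b. fst p \<otimes>\<^bsub>M\<^esub> snd p = m}. a (fst p) \<otimes>\<^bsub>K\<^esub> b (snd p))"
    by (simp add: monoid_algebra_def)
  also have "\<dots> = (\<Oplus>\<^bsub>K\<^esub>p\<in>carrier M \<times> carrier M. ?h p)"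
    by (rule K.add.finprod_mono_neutral_cong_left)
      (use assms coeff_out in \<open>auto simp: support_def split: if_splits\<close>)
  also have "\<dots> = (\<Oplus>\<^bsub>K\<^esub>i\<in>carrier M. \<Oplus>\<^bsub>K\<^esub>j\<in>carrier M. if i \<otimes>\<^bsub>M\<^esub> j = m then a i \<otimes>\<^bsub>K\<^esub> b j else \<zero>\<^bsub>K\<^esub>)"
    by (rule K.add.finprod_finprod[symmetric]) (use assms in auto)
  finally show ?thesis .
qed

lemma mult_closed [simp]: "a \<in> carrier R \<Longrightarrow> b \<in> carrier R \<Longrightarrow> a \<otimes>\<^bsub>R\<^esub> b \<in> carrier R"
proof -
  assume ab: "a \<in> carrier R" "b \<in> carrier R"
  have "(a \<otimes>\<^bsub>R\<^esub> b) m = \<zero>\<^bsub>K\<^esub>" if "m \<notin> carrier M" for m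
    unfolding mult_apply[OF ab]
    by (intro K.add.finprod_one_eqI) (use that in auto)
  moreover have "(a \<otimes>\<^bsub>R\<^esub> b) m \<in> carrier K" for m
    unfolding mult_apply[OF ab] using ab by (auto intro!: K.finsum_closed)
  ultimately show ?thesis by (simp add: mem_carrier_iff)
qed

text \<open>Each pair \<open>(i, j)\<close> contributes to exactly one \<open>m\<close>, its
  product. In \<open>mult_assoc\<close> the weight \<open>f\<close> carries the third factor, once
  from the right and once from the left.\<close>

lemma finsum_mult_apply:
  assumes "a \<in> carrier R" "b \<in> carrier R" "f \<in> carrier M \<rightarrow> carrier K"
  shows "(\<Oplus>\<^bsub>K\<^esub>m\<in>carrier M. f m \<otimes>\<^bsub>K\<^esub> (a \<otimes>\<^bsub>R\<^esub> b) m) =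
    (\<Oplus>\<^bsub>K\<^esub>i\<in>carrier M. \<Oplus>\<^bsub>K\<^esub>j\<in>carrier M. f (i \<otimes>\<^bsub>M\<^esub> j) \<otimes>\<^bsub>K\<^esub> (a i \<otimes>\<^bsub>K\<^esub> b j))"
proof -
  let ?X = "carrier M"
  have f: "m \<in> ?X \<Longrightarrow> f m \<in> carrier K" for m using assms by auto
  have "(\<Oplus>\<^bsub>K\<^esub>m\<in>?X. f m \<otimes>\<^bsub>K\<^esub> (a \<otimes>\<^bsub>R\<^esub> b) m) =
    (\<Oplus>\<^bsub>K\<^esub>m\<in>?X. \<Oplus>\<^bsub>K\<^esub>i\<in>?X. \<Oplus>\<^bsub>K\<^esub>j\<in>?X. if i \<otimes>\<^bsub>M\<^esub> j = m then f m \<otimes>\<^bsub>K\<^esub> (a i \<otimes>\<^bsub>K\<^esub> b j) else \<zero>\<^bsub>K\<^esub>)"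
    using assms f
    by (intro K.finsum_cong')
      (auto simp: mult_apply K.finsum_rdistr Pi_def intro!: K.finsum_cong' K.finsum_closed)
  also have "\<dots> = (\<Oplus>\<^bsub>K\<^esub>i\<in>?X. \<Oplus>\<^bsub>K\<^esub>m\<in>?X. \<Oplus>\<^bsub>K\<^esub>j\<in>?X. if i \<otimes>\<^bsub>M\<^esub> j = m then f m \<otimes>\<^bsub>K\<^esub> (a i \<otimes>\<^bsub>K\<^esub> b j) else \<zero>\<^bsub>K\<^esub>)"
    using assms f by (intro K.finsum_finsum_swap) (auto intro!: K.finsum_closed)
  also have "\<dots> = (\<Oplus>\<^bsub>K\<^esub>i\<in>?X. \<Oplus>\<^bsub>K\<^esub>j\<in>?X. \<Oplus>\<^bsub>K\<^esub>m\<in>?X. if i \<otimes>\<^bsub>M\<^esub> j = m then f m \<otimes>\<^bsub>K\<^esub> (a i \<otimes>\<^bsub>K\<^esub> b j) else \<zero>\<^bsub>K\<^esub>)"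
    using assms f by (intro K.finsum_cong' K.finsum_finsum_swap) (auto intro!: K.finsum_closed)
  also have "\<dots> = (\<Oplus>\<^bsub>K\<^esub>i\<in>?X. \<Oplus>\<^bsub>K\<^esub>j\<in>?X. f (i \<otimes>\<^bsub>M\<^esub> j) \<otimes>\<^bsub>K\<^esub> (a i \<otimes>\<^bsub>K\<^esub> b j))"
    using assms f
    by (intro K.finsum_cong' K.finsum_singleton) (auto intro!: K.finsum_closed)
  finally show ?thesis .
qed

lemma mult_assoc:
  assumes a: "a \<in> carrier R" and b: "b \<in> carrier R" and c: "c \<in> carrier R"
  shows "(a \<otimes>\<^bsub>R\<^esub> b) \<otimes>\<^bsub>R\<^esub> c = a \<otimes>\<^bsub>R\<^esub> (b \<otimes>\<^bsub>R\<^esub> c)"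
proof
  fix m
  let ?X = "carrier M"
  let ?t = "\<lambda>i j k. if i \<otimes>\<^bsub>M\<^esub> j \<otimes>\<^bsub>M\<^esub> k = m then a i \<otimes>\<^bsub>K\<^esub> b j \<otimes>\<^bsub>K\<^esub> c k else \<zero>\<^bsub>K\<^esub>"
  have t: "?t i j k \<in> carrier K" for i j k using a b c by auto
  have "((a \<otimes>\<^bsub>R\<^esub> b) \<otimes>\<^bsub>R\<^esub> c) m =
    (\<Oplus>\<^bsub>K\<^esub>k\<in>?X. \<Oplus>\<^bsub>K\<^esub>p\<in>?X. if p \<otimes>\<^bsub>M\<^esub> k = m then (a \<otimes>\<^bsub>R\<^esub> b) p \<otimes>\<^bsub>K\<^esub> c k else \<zero>\<^bsub>K\<^esub>)"
    unfolding mult_apply[OF mult_closed[OF a b] c]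
    by (rule K.finsum_finsum_swap) (use a b c in auto)
  also have "\<dots> = (\<Oplus>\<^bsub>K\<^esub>k\<in>?X. \<Oplus>\<^bsub>K\<^esub>p\<in>?X. (if p \<otimes>\<^bsub>M\<^esub> k = m then c k else \<zero>\<^bsub>K\<^esub>) \<otimes>\<^bsub>K\<^esub> (a \<otimes>\<^bsub>R\<^esub> b) p)"
    using a b c by (intro K.finsum_cong') (auto simp: K.m_comm intro!: K.finsum_closed)
  also have "\<dots> = (\<Oplus>\<^bsub>K\<^esub>k\<in>?X. \<Oplus>\<^bsub>K\<^esub>i\<in>?X. \<Oplus>\<^bsub>K\<^esub>j\<in>?X. ?t i j k)"
    using a b c
    by (subst finsum_mult_apply)
      (auto simp: K.m_ac intro!: K.finsum_cong' K.finsum_closed)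
  also have "\<dots> = (\<Oplus>\<^bsub>K\<^esub>i\<in>?X. \<Oplus>\<^bsub>K\<^esub>k\<in>?X. \<Oplus>\<^bsub>K\<^esub>j\<in>?X. ?t i j k)"
    by (rule K.finsum_finsum_swap) (use t in \<open>auto intro!: K.finsum_closed\<close>)
  also have "\<dots> = (\<Oplus>\<^bsub>K\<^esub>i\<in>?X. \<Oplus>\<^bsub>K\<^esub>j\<in>?X. \<Oplus>\<^bsub>K\<^esub>k\<in>?X. ?t i j k)"
    by (intro K.finsum_cong'[OF refl] K.finsum_finsum_swap) (use t in \<open>auto intro!: K.finsum_closed\<close>)
  also have "\<dots> = (\<Oplus>\<^bsub>K\<^esub>i\<in>?X. \<Oplus>\<^bsub>K\<^esub>p\<in>?X. (if i \<otimes>\<^bsub>M\<^esub> p = m then a i else \<zero>\<^bsub>K\<^esub>) \<otimes>\<^bsub>K\<^esub> (b \<otimes>\<^bsub>R\<^esub> c) p)"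
    using a b c
    by (subst finsum_mult_apply)
      (auto simp: K.m_ac M.m_assoc intro!: K.finsum_cong' K.finsum_closed)
  also have "\<dots> = (a \<otimes>\<^bsub>R\<^esub> (b \<otimes>\<^bsub>R\<^esub> c)) m"
    unfolding mult_apply[OF a mult_closed[OF b c]]
    using a b c by (intro K.finsum_cong') (auto intro!: K.finsum_closed)
  finally show "((a \<otimes>\<^bsub>R\<^esub> b) \<otimes>\<^bsub>R\<^esub> c) m = (a \<otimes>\<^bsub>R\<^esub> (b \<otimes>\<^bsub>R\<^esub> c)) m" .
qed

lemma one_mult:
  assumes a: "a \<in> carrier R"
  shows "\<one>\<^bsub>R\<^esub> \<otimes>\<^bsub>R\<^esub> a = a" and "a \<otimes>\<^bsub>R\<^esub> \<one>\<^bsub>R\<^esub> = a"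
proof -
  have o: "\<one>\<^bsub>R\<^esub> \<in> carrier R" by (auto simp: mem_carrier_iff)
  have s: "(\<Oplus>\<^bsub>K\<^esub>j\<in>carrier M. if j = m then a j else \<zero>\<^bsub>K\<^esub>) = a m" for m
  proof (cases "m \<in> carrier M")
    case True
    then show ?thesis using K.finsum_singleton[of m "carrier M" a] a
      by (simp add: eq_commute[of _ m] Pi_def)
  next
    case False
    then show ?thesis using coeff_out[OF a False] by (auto intro!: K.add.finprod_one_eqI)
  qed
  have "(\<one>\<^bsub>R\<^esub> \<otimes>\<^bsub>R\<^esub> a) m = (\<Oplus>\<^bsub>K\<^esub>i\<in>carrier M. if \<one>\<^bsub>M\<^esub> = i then (\<Oplus>\<^bsub>K\<^esub>j\<in>carrier M. if j = m then a j else \<zero>\<^bsub>K\<^esub>) else \<zero>\<^bsub>K\<^esub>)" for m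
    unfolding mult_apply[OF o a] using a
    by (intro K.finsum_cong') (auto intro!: K.finsum_closed K.finsum_cong' K.add.finprod_one_eqI)
  also have "\<dots> m = a m" for m
    unfolding s using K.finsum_singleton[of "\<one>\<^bsub>M\<^esub>" "carrier M" "\<lambda>_. a m"] a by (simp add: Pi_def)
  finally show "\<one>\<^bsub>R\<^esub> \<otimes>\<^bsub>R\<^esub> a = a" by auto
  have "(a \<otimes>\<^bsub>R\<^esub> \<one>\<^bsub>R\<^esub>) m = (\<Oplus>\<^bsub>K\<^esub>i\<in>carrier M. if i = m then a i else \<zero>\<^bsub>K\<^esub>)" for m
    unfolding mult_apply[OF a o]
  proof (rule K.finsum_cong')
    fix i assume i: "i \<in> carrier M"
    have "(\<Oplus>\<^bsub>K\<^esub>j\<in>carrier M. if i \<otimes>\<^bsub>M\<^esub> j = m then a i \<otimes>\<^bsub>K\<^esub> \<one>\<^bsub>R\<^esub> j else \<zero>\<^bsub>K\<^esub>) =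
      (\<Oplus>\<^bsub>K\<^esub>j\<in>carrier M. if \<one>\<^bsub>M\<^esub> = j then (if i = m then a i else \<zero>\<^bsub>K\<^esub>) else \<zero>\<^bsub>K\<^esub>)"
      using a i by (intro K.finsum_cong') auto
    also have "\<dots> = (if i = m then a i else \<zero>\<^bsub>K\<^esub>)"
      using K.finsum_singleton[of "\<one>\<^bsub>M\<^esub>" "carrier M" "\<lambda>_. (if i = m then a i else \<zero>\<^bsub>K\<^esub>)"] a by (simp add: Pi_def)
    finally show "(\<Oplus>\<^bsub>K\<^esub>j\<in>carrier M. if i \<otimes>\<^bsub>M\<^esub> j = m then a i \<otimes>\<^bsub>K\<^esub> \<one>\<^bsub>R\<^esub> j else \<zero>\<^bsub>K\<^esub>) = (if i = m then a i else \<zero>\<^bsub>K\<^esub>)" .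
  qed (use a in auto)
  then show "a \<otimes>\<^bsub>R\<^esub> \<one>\<^bsub>R\<^esub> = a" using s by auto
qed

lemma mult_distrib:
  assumes a: "a \<in> carrier R" and b: "b \<in> carrier R" and c: "c \<in> carrier R"
  shows "(a \<oplus>\<^bsub>R\<^esub> b) \<otimes>\<^bsub>R\<^esub> c = a \<otimes>\<^bsub>R\<^esub> c \<oplus>\<^bsub>R\<^esub> b \<otimes>\<^bsub>R\<^esub> c"
    and "c \<otimes>\<^bsub>R\<^esub> (a \<oplus>\<^bsub>R\<^esub> b) = c \<otimes>\<^bsub>R\<^esub> a \<oplus>\<^bsub>R\<^esub> c \<otimes>\<^bsub>R\<^esub> b"
proof -
  have ab: "a \<oplus>\<^bsub>R\<^esub> b \<in> carrier R" using a b by (simp add: mem_carrier_iff)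
  have if_add: "(if P then u \<oplus>\<^bsub>K\<^esub> v else \<zero>\<^bsub>K\<^esub>) = (if P then u else \<zero>\<^bsub>K\<^esub>) \<oplus>\<^bsub>K\<^esub> (if P then v else \<zero>\<^bsub>K\<^esub>)" for P u v
    by simp
  show "(a \<oplus>\<^bsub>R\<^esub> b) \<otimes>\<^bsub>R\<^esub> c = a \<otimes>\<^bsub>R\<^esub> c \<oplus>\<^bsub>R\<^esub> b \<otimes>\<^bsub>R\<^esub> c"
    using a b c ab by (intro ext) (simp add: mult_apply K.l_distr if_add K.finsum_addf Pi_def cong: if_cong)
  show "c \<otimes>\<^bsub>R\<^esub> (a \<oplus>\<^bsub>R\<^esub> b) = c \<otimes>\<^bsub>R\<^esub> a \<oplus>\<^bsub>R\<^esub> c \<otimes>\<^bsub>R\<^esub> b"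
    using a b c ab by (intro ext) (simp add: mult_apply K.r_distr if_add K.finsum_addf Pi_def cong: if_cong)
qed

lemma mult_smult:
  assumes a: "a \<in> carrier R" and b: "b \<in> carrier R" and c: "c \<in> carrier K"
  shows "(c \<odot>\<^bsub>R\<^esub> a) \<otimes>\<^bsub>R\<^esub> b = c \<odot>\<^bsub>R\<^esub> (a \<otimes>\<^bsub>R\<^esub> b)" and "a \<otimes>\<^bsub>R\<^esub> (c \<odot>\<^bsub>R\<^esub> b) = c \<odot>\<^bsub>R\<^esub> (a \<otimes>\<^bsub>R\<^esub> b)"
proof -
  have ca: "c \<odot>\<^bsub>R\<^esub> a \<in> carrier R" "c \<odot>\<^bsub>R\<^esub> b \<in> carrier R" using a b c by (simp_all add: mem_carrier_iff)
  show "(c \<odot>\<^bsub>R\<^esub> a) \<otimes>\<^bsub>R\<^esub> b = c \<odot>\<^bsub>R\<^esub> (a \<otimes>\<^bsub>R\<^esub> b)"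
    using a b c ca
    by (intro ext)
      (auto simp: mult_apply K.finsum_rdistr Pi_def K.m_ac intro!: K.finsum_cong' K.finsum_closed)
  show "a \<otimes>\<^bsub>R\<^esub> (c \<odot>\<^bsub>R\<^esub> b) = c \<odot>\<^bsub>R\<^esub> (a \<otimes>\<^bsub>R\<^esub> b)"
    using a b c ca
    by (intro ext)
      (auto simp: mult_apply K.finsum_rdistr Pi_def K.m_ac intro!: K.finsum_cong' K.finsum_closed)
qed

lemma abelian_group_R: "abelian_group R"
proof (rule abelian_groupI)
  fix a assume a: "a \<in> carrier R"
  show "\<exists>b\<in>carrier R. b \<oplus>\<^bsub>R\<^esub> a = \<zero>\<^bsub>R\<^esub>"
    by (rule bexI[of _ "\<lambda>m. \<ominus>\<^bsub>K\<^esub> a m"]) (use a in \<open>auto simp: mem_carrier_iff K.l_neg fun_eq_iff\<close>)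
qed (auto simp: mem_carrier_iff fun_eq_iff K.a_ac)

lemma ring_R: "ring R"
proof (rule ringI)
  show "monoid R"
    by (rule monoidI) (auto simp: mult_assoc one_mult mem_carrier_iff[of "\<one>\<^bsub>R\<^esub>"])
qed (auto simp: abelian_group_R mult_distrib)

lemma module_R: "module K R"
  by (rule moduleI) (auto simp: abelian_group_R mem_carrier_iff fun_eq_iff
      K.l_distr K.r_distr K.m_assoc intro: K.cring_axioms)

end

section \<open>Evaluating polynomials in a noncommutative algebra\<close>

text \<open>Horner's scheme as an induction rule: monomials come from constants by repeated
  multiplication by \<open>X\<close>, and \<open>up_repr\<close> writes a polynomial as a sum of
  monomials. For statements about evaluations only constants, sums and a left factor
  \<open>X\<close> have to be examined.\<close>

lemma UP_induct [consumes 2, case_names const add X]: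
  assumes K: "cring K" and p: "p \<in> carrier (UP K)"
    and const: "\<And>c. c \<in> carrier K \<Longrightarrow> P (up_ring.monom (UP K) c 0)"
    and add: "\<And>p r. p \<in> carrier (UP K) \<Longrightarrow> r \<in> carrier (UP K) \<Longrightarrow> P p \<Longrightarrow> P r \<Longrightarrow> P (p \<oplus>\<^bsub>UP K\<^esub> r)"
    and X: "\<And>p. p \<in> carrier (UP K) \<Longrightarrow> P p \<Longrightarrow> P (poly_X K \<otimes>\<^bsub>UP K\<^esub> p)"
  shows "P p"
proof -
  interpret UP_cring K "UP K" using K by (simp add: UP_cring_def)
  have mon: "P (up_ring.monom (UP K) c i)" if "c \<in> carrier K" for c i
  proof (induction i)
    case 0
    then show ?case using const that by simp
  next
    case (Suc i)
    have "up_ring.monom (UP K) c (Suc i) = poly_X K \<otimes>\<^bsub>UP K\<^esub> up_ring.monom (UP K) c i"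
      using monom_mult[OF R.one_closed that, of 1 i] that by (simp add: poly_X_def)
    then show ?case using X[OF _ Suc] that by simp
  qed
  have "finite A \<Longrightarrow> P (\<Oplus>\<^bsub>UP K\<^esub>i\<in>A. up_ring.monom (UP K) (up_ring.coeff (UP K) p i) i)" for A
  proof (induction A rule: finite_induct)
    case empty
    then show ?case using mon[OF R.zero_closed, of 0] by simp
  next
    case (insert i A)
    then show ?case using p mon by (auto simp: Pi_def intro!: add)
  qed
  from this[of "{..deg K p}"] show ?thesis using up_repr[OF p] by simp
qed

text \<open>The two axioms make every \<open>c \<odot> \<one>\<close> central, which places the
  scalars in every bicommutant.\<close>

locale noncomm_algebra = module K A + ring A
  for K :: "('k, 'c) ring_scheme" and A :: "('k, 'a, 'd) module_scheme" (structure) +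
  assumes smult_mult: "\<lbrakk>c \<in> carrier K; a \<in> carrier A; b \<in> carrier A\<rbrakk> \<Longrightarrow> (c \<odot> a) \<otimes> b = c \<odot> (a \<otimes> b)"
    and mult_smult: "\<lbrakk>c \<in> carrier K; a \<in> carrier A; b \<in> carrier A\<rbrakk> \<Longrightarrow> a \<otimes> (c \<odot> b) = c \<odot> (a \<otimes> b)"
begin

lemma scalar_ring_hom: "(\<lambda>c. c \<odot> \<one>) \<in> Ring.ring_hom K A"
  by (rule ring_hom_memI) (simp_all add: smult_l_distr smult_assoc1 smult_mult)

text \<open>The library evaluates polynomials only in commutative rings; the double centralizer of \<open>x\<close> is
  a commutative subring containing \<open>x\<close> and all scalars.\<close>

definition centralizer :: "'a set \<Rightarrow> 'a set" where
  "centralizer X = {a \<in> carrier A. \<forall>b\<in>X. a \<otimes> b = b \<otimes> a}"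

lemma centralizer_subring: "X \<subseteq> carrier A \<Longrightarrow> subring (centralizer X) A"
  by (intro subringI)
    (auto simp: centralizer_def subset_iff l_minus r_minus l_distr r_distr, metis m_assoc)

lemma centralizer_mono: "X \<subseteq> Y \<Longrightarrow> centralizer Y \<subseteq> centralizer X"
  by (auto simp: centralizer_def)

context
  fixes x :: 'a
  assumes x: "x \<in> carrier A"
begin

definition bicommutant where "bicommutant = centralizer (centralizer {x})"

lemma bicommutant_subring: "subring bicommutant A"
  unfolding bicommutant_def by (rule centralizer_subring) (auto simp: centralizer_def)

lemma bicommutant_subset: "bicommutant \<subseteq> carrier A"
  by (auto simp: bicommutant_def centralizer_def)

lemma x_in_bicommutant: "x \<in> bicommutant"
  using x by (auto simp: bicommutant_def centralizer_def)

lemma scalar_in_bicommutant: "c \<in> carrier K \<Longrightarrow> c \<odot> \<one> \<in> bicommutant"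
  by (auto simp: bicommutant_def centralizer_def smult_mult mult_smult)

text \<open>Since \<open>x\<close> commutes with itself, \<open>{x}\<close> lies in its own
  centralizer, so the bicommutant lies in the centralizer of \<open>x\<close>. Its elements commute
  with all of that centralizer, hence with one another.\<close>

lemma bicommutant_cring: "cring (A\<lparr>carrier := bicommutant\<rparr>)"
proof (intro cring.intro comm_monoid.intro comm_monoid_axioms.intro ring.is_monoid)
  show "ring (A\<lparr>carrier := bicommutant\<rparr>)" "ring (A\<lparr>carrier := bicommutant\<rparr>)"
    by (rule subring_is_ring[OF bicommutant_subring])+
next
  have "bicommutant \<subseteq> centralizer {x}"
    unfolding bicommutant_def by (rule centralizer_mono) (use x in \<open>auto simp: centralizer_def\<close>)
  then show "a \<otimes>\<^bsub>A\<lparr>carrier := bicommutant\<rparr>\<^esub> b = b \<otimes>\<^bsub>A\<lparr>carrier := bicommutant\<rparr>\<^esub> a" 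
    if "a \<in> carrier (A\<lparr>carrier := bicommutant\<rparr>)" "b \<in> carrier (A\<lparr>carrier := bicommutant\<rparr>)" for a b
    using that by (auto simp: bicommutant_def centralizer_def)
qed

interpretation C: UP_pre_univ_prop K "A\<lparr>carrier := bicommutant\<rparr>" "\<lambda>c. c \<odot> \<one>" "UP K"
proof -
  have "(\<lambda>c. c \<odot> \<one>) \<in> Ring.ring_hom K (A\<lparr>carrier := bicommutant\<rparr>)"
    using scalar_ring_hom scalar_in_bicommutant by (auto simp: Ring.ring_hom_def)
  with bicommutant_cring R.is_cring
  show "UP_pre_univ_prop K (A\<lparr>carrier := bicommutant\<rparr>) (\<lambda>c. c \<odot> \<one>)"
    by (intro UP_pre_univ_prop.intro UP_cring.intro ring_hom_cringI) auto
qed simp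

text \<open>\<open>finsum\<close> refers to the carrier of the record, so passing to the subring is
  not a matter of unfolding; the induction works because all partial sums stay in
  \<open>bicommutant\<close>.\<close>

lemma finsum_bicommutant:
  assumes "f \<in> I \<rightarrow> bicommutant"
  shows "finsum (A\<lparr>carrier := bicommutant\<rparr>) f I = finsum A f I"
  using assms
proof (induction I rule: infinite_finite_induct)
  case (insert i I)
  have "finsum (A\<lparr>carrier := bicommutant\<rparr>) f (insert i I)
      = f i \<oplus>\<^bsub>A\<lparr>carrier := bicommutant\<rparr>\<^esub> finsum (A\<lparr>carrier := bicommutant\<rparr>) f I"
    by (rule C.S.finsum_insert) (use insert in auto)
  then show ?case using insert bicommutant_subset by (simp add: Pi_def subset_iff)
qed (use C.S.finsum_empty C.S.finsum_infinite in auto)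

text \<open>Scalars and powers of \<open>x\<close> stay in the commutative subring, so both
  evaluations are the same sum. This transfers the universal property of polynomials from the
  subring to \<open>poly_map\<close>.\<close>

lemma poly_map_eq: "poly_map K A x = UnivPoly.eval K (A\<lparr>carrier := bicommutant\<rparr>) (\<lambda>c. c \<odot> \<one>) x"
proof -
  have pow: "x [^]\<^bsub>A\<lparr>carrier := bicommutant\<rparr>\<^esub> i = x [^] i" for i :: nat
    by (simp add: nat_pow_def)
  have "(\<Oplus>i\<in>{..deg K p}. (p' i \<odot> \<one>) \<otimes> x [^] i) = (\<Oplus>\<^bsub>A\<lparr>carrier := bicommutant\<rparr>\<^esub>i\<in>{..deg K p}.
      (p' i \<odot> \<one>) \<otimes>\<^bsub>A\<lparr>carrier := bicommutant\<rparr>\<^esub> x [^]\<^bsub>A\<lparr>carrier := bicommutant\<rparr>\<^esub> i)"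
    if "\<And>i. p' i \<in> carrier K" for p p'
  proof -
    have "x [^] i \<in> bicommutant" for i :: nat
      using C.S.nat_pow_closed[of x i] x_in_bicommutant by (simp add: pow)
    then have "(\<lambda>i. (p' i \<odot> \<one>) \<otimes> x [^] i) \<in> {..deg K p} \<rightarrow> bicommutant"
      using that by (auto intro!: subringE(6)[OF bicommutant_subring] scalar_in_bicommutant)
    from finsum_bicommutant[OF this] show ?thesis by (simp add: pow)
  qed
  then show ?thesis
    unfolding poly_map_def UnivPoly.eval_def by (intro restrict_ext) simp
qed

lemma poly_map_alg_hom: "poly_map K A x \<in> alg_hom K (UP K) A"
proof -
  have h: "poly_map K A x \<in> Ring.ring_hom (UP K) (A\<lparr>carrier := bicommutant\<rparr>)"
    unfolding poly_map_eq by (rule C.eval_ring_hom) (simp add: x_in_bicommutant)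
  then have h': "poly_map K A x \<in> Ring.ring_hom (UP K) A"
    using bicommutant_subset by (auto simp: Ring.ring_hom_def)
  have c: "poly_map K A x (up_ring.monom (UP K) c 0) = c \<odot> \<one>" if "c \<in> carrier K" for c
    unfolding poly_map_eq using that x_in_bicommutant by (intro C.eval_const) auto
  have "poly_map K A x (c \<odot>\<^bsub>UP K\<^esub> p) = c \<odot> poly_map K A x p" if "c \<in> carrier K" "p \<in> carrier (UP K)" for c p
  proof -
    \<comment> \<open>Scaling a polynomial is multiplying it by a constant polynomial, so
      compatibility with products suffices.\<close>
    have "poly_map K A x (c \<odot>\<^bsub>UP K\<^esub> p) = poly_map K A x (up_ring.monom (UP K) c 0 \<otimes>\<^bsub>UP K\<^esub> p)"
      using that by (simp add: C.monom_mult_is_smult)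
    also have "\<dots> = c \<odot> poly_map K A x p"
      using that ring_hom_mult[OF h'] ring_hom_closed[OF h'] by (simp add: c smult_mult)
    finally show ?thesis .
  qed
  with h' show ?thesis by (simp add: alg_hom_def)
qed

lemma poly_map_ring_hom: "poly_map K A x \<in> Ring.ring_hom (UP K) A"
  using poly_map_alg_hom by (simp add: alg_hom_def)

lemma poly_map_X: "poly_map K A x (poly_X K) = x"
  unfolding poly_map_eq poly_X_def by (rule C.eval_monom1) (simp add: x_in_bicommutant)

lemma poly_map_const: "c \<in> carrier K \<Longrightarrow> poly_map K A x (up_ring.monom (UP K) c 0) = c \<odot> \<one>"
  unfolding poly_map_eq using x_in_bicommutant by (intro C.eval_const) auto

lemma poly_map_image_subalgebra:
  assumes "B = poly_map K A x ` carrier (UP K)"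
  shows "subring B A" and "\<And>c b. c \<in> carrier K \<Longrightarrow> b \<in> B \<Longrightarrow> c \<odot> b \<in> B" and "cring (A\<lparr>carrier := B\<rparr>)"
proof -
  interpret h: ring_hom_ring "UP K" A "poly_map K A x"
    by (rule ring_hom_ringI2[OF C.P.ring_axioms ring_axioms poly_map_ring_hom])
  show sub: "subring B A"
    unfolding assms by (rule h.img_is_subring[OF C.P.carrier_is_subring])
  show "c \<odot> b \<in> B" if c: "c \<in> carrier K" and "b \<in> B" for c b
  proof -
    obtain p where p: "p \<in> carrier (UP K)" "b = poly_map K A x p" using \<open>b \<in> B\<close> assms by auto
    have "c \<odot> b = poly_map K A x (c \<odot>\<^bsub>UP K\<^esub> p)"
      using poly_map_alg_hom p c by (simp add: alg_hom_def)
    then show ?thesis using assms p c by auto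
  qed
  show "cring (A\<lparr>carrier := B\<rparr>)"
  proof (intro cring.intro comm_monoid.intro comm_monoid_axioms.intro ring.is_monoid)
    show "ring (A\<lparr>carrier := B\<rparr>)" "ring (A\<lparr>carrier := B\<rparr>)"
      by (rule subring_is_ring[OF sub])+
  next
    fix a b assume ab: "a \<in> carrier (A\<lparr>carrier := B\<rparr>)" "b \<in> carrier (A\<lparr>carrier := B\<rparr>)"
    then obtain p r where "p \<in> carrier (UP K)" "a = poly_map K A x p" "r \<in> carrier (UP K)" "b = poly_map K A x r"
      using assms by auto
    then show "a \<otimes>\<^bsub>A\<lparr>carrier := B\<rparr>\<^esub> b = b \<otimes>\<^bsub>A\<lparr>carrier := B\<rparr>\<^esub> a"
      by (simp flip: h.hom_mult add: C.P.m_comm)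
  qed
qed

lemma generated_subalgebra_eq:
  "generated_subalgebra K A {x} = poly_map K A x ` carrier (UP K)"
proof
  let ?B = "poly_map K A x ` carrier (UP K)"
  have "x \<in> ?B"
    by (rule image_eqI[where x = "poly_X K"]) (simp_all add: poly_map_X, simp add: poly_X_def)
  then show "generated_subalgebra K A {x} \<subseteq> ?B"
    unfolding generated_subalgebra_def
    using poly_map_image_subalgebra(1,2)[OF refl] by (intro Inter_lower) simp
  have "poly_map K A x p \<in> B"
    if B: "subring B A" "\<And>c b. c \<in> carrier K \<Longrightarrow> b \<in> B \<Longrightarrow> c \<odot> b \<in> B" "x \<in> B" and p: "p \<in> carrier (UP K)" for B p
    using R.is_cring p
  proof (induction p rule: UP_induct)
    case (const c)
    then show ?case using B subringE(3)[OF B(1)] by (simp add: poly_map_const)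
  next
    case (add p r)
    then show ?case using subringE(7)[OF B(1)] ring_hom_add[OF poly_map_ring_hom] by simp
  next
    case (X p)
    have "poly_X K \<in> carrier (UP K)" by (simp add: poly_X_def)
    with X show ?case using subringE(6)[OF B(1)] ring_hom_mult[OF poly_map_ring_hom] B by (simp add: poly_map_X)
  qed
  then show "?B \<subseteq> generated_subalgebra K A {x}"
    unfolding generated_subalgebra_def by auto
qed

text \<open>The first isomorphism theorem for rings, supplemented by scalars. A scalar multiple of a
  coset in \<open>alg_quot\<close> is a union over representatives \<open>a\<close>; all its
  elements have the image \<open>c \<odot> ?\<gamma> p\<close>, so \<open>the_elem\<close> returns
  this value.\<close>

lemma poly_map_quotient_iso:
  assumes B: "B = poly_map K A x ` carrier (UP K)"
    and I: "I = {p \<in> carrier (UP K). poly_map K A x p = \<zero>}"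
  shows "\<exists>\<Gamma>\<in>alg_iso K (alg_quot (UP K) I) (A\<lparr>carrier := B\<rparr>).
    \<forall>p\<in>carrier (UP K). \<Gamma> (I +>\<^bsub>UP K\<^esub> p) = poly_map K A x p"
proof -
  let ?\<gamma> = "poly_map K A x"
  interpret h: ring_hom_ring "UP K" A ?\<gamma>
    by (rule ring_hom_ringI2[OF C.P.ring_axioms ring_axioms poly_map_ring_hom])
  have ker: "a_kernel (UP K) A ?\<gamma> = I" unfolding I a_kernel_def' ..
  let ?\<Gamma> = "\<lambda>X. the_elem (?\<gamma> ` X)"
  let ?Q = "alg_quot (UP K) I"
  have iso: "?\<Gamma> \<in> ring_iso (UP K Quot I) (A\<lparr>carrier := B\<rparr>)"
    using h.FactRing_iso_set_aux by (simp add: ker B)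
  have \<Gamma>: "?\<Gamma> (I +>\<^bsub>UP K\<^esub> p) = ?\<gamma> p" if "p \<in> carrier (UP K)" for p
    using h.the_elem_simp[OF that] by (simp add: ker)
  have coset: "?\<gamma> u = ?\<gamma> p" if "u \<in> I +>\<^bsub>UP K\<^esub> p" "p \<in> carrier (UP K)" for u p
    using that by (auto simp: a_r_coset_def' I)
  have mem: "p \<in> I +>\<^bsub>UP K\<^esub> p" if "p \<in> carrier (UP K)" for p
    using that h.homeq_imp_rcos[OF that that] by (simp add: ker)
  have sub: "I +>\<^bsub>UP K\<^esub> p \<subseteq> carrier (UP K)" if "p \<in> carrier (UP K)" for p
    using that by (auto simp: a_r_coset_def' I)
  have sm: "?\<gamma> (c \<odot>\<^bsub>UP K\<^esub> p) = c \<odot> ?\<gamma> p" if "c \<in> carrier K" "p \<in> carrier (UP K)" for c p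
    using poly_map_alg_hom that by (simp add: alg_hom_def)
  have Q: "carrier ?Q = carrier (UP K Quot I)" "mult ?Q = mult (UP K Quot I)" "one ?Q = one (UP K Quot I)"
    "add ?Q = add (UP K Quot I)" "smult ?Q = (\<lambda>c C. \<Union>a\<in>C. I +>\<^bsub>UP K\<^esub> (c \<odot>\<^bsub>UP K\<^esub> a))"
    by (simp_all add: alg_quot_def ring.defs module.defs)
  have "?\<Gamma> (c \<odot>\<^bsub>?Q\<^esub> X) = c \<odot> ?\<Gamma> X" if c: "c \<in> carrier K" and X: "X \<in> carrier ?Q" for c X
  proof -
    obtain p where p: "p \<in> carrier (UP K)" "X = I +>\<^bsub>UP K\<^esub> p"
      using X unfolding Q FactRing_def A_RCOSETS_def' by auto
    have "?\<gamma> u = c \<odot> ?\<gamma> p" if u: "u \<in> c \<odot>\<^bsub>?Q\<^esub> X" for u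
    proof -
      obtain a where a: "a \<in> X" "u \<in> I +>\<^bsub>UP K\<^esub> (c \<odot>\<^bsub>UP K\<^esub> a)" using u Q by auto
      have ac: "a \<in> carrier (UP K)" using a p sub by auto
      then show ?thesis using coset[OF a(2)] coset[of a p] a p c sm[OF c ac] by simp
    qed
    moreover have "c \<odot>\<^bsub>UP K\<^esub> p \<in> c \<odot>\<^bsub>?Q\<^esub> X"
      using p c mem[of p] mem[of "c \<odot>\<^bsub>UP K\<^esub> p"] Q by auto
    ultimately have "?\<gamma> ` (c \<odot>\<^bsub>?Q\<^esub> X) = {c \<odot> ?\<gamma> p}"
      by (metis empty_iff image_constant_conv image_cong)
    then show ?thesis using \<Gamma> p by simp
  qed
  then have "?\<Gamma> \<in> alg_iso K ?Q (A\<lparr>carrier := B\<rparr>)"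
    using iso unfolding alg_iso_def alg_hom_def ring_iso_def Ring.ring_hom_def Q by simp
  then show ?thesis by (rule bexI[rotated]) (simp add: \<Gamma>)
qed

end

end

section \<open>Functions that are constant on levels\<close>

declare (in finite_monoid_algebra) apply_simps [simp del]

sublocale finite_monoid_algebra \<subseteq> A: noncomm_algebra K R
  by (intro noncomm_algebra.intro noncomm_algebra_axioms.intro module_R ring_R mult_smult)

text \<open>Words are the case \<open>q = 1\<close>, where \<open>q_int q k = k\<close>. By
  \<open>len_eq_0_iff\<close> level 0 is a single point, so the identity of the algebra is constant
  on levels; \<open>ex_level\<close> supplies representatives at which coefficients can be
  compared.\<close>

locale level_monoid = M: monoid M for M :: "('m, 'd) monoid_scheme" (structure) +
  fixes len :: "'m \<Rightarrow> nat" and n q :: nat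
  assumes finite_carrier: "finite (carrier M)"
    and q_pos: "0 < q"
    and len_le: "m \<in> carrier M \<Longrightarrow> len m \<le> n"
    and ex_level: "k \<le> n \<Longrightarrow> \<exists>m\<in>carrier M. len m = k"
    and len_eq_0_iff: "m \<in> carrier M \<Longrightarrow> len m = 0 \<longleftrightarrow> m = \<one>"
    and len_mult_letter:
      "\<lbrakk>a \<in> carrier M; l \<in> carrier M; len l = 1; a \<otimes> l \<noteq> a\<rbrakk> \<Longrightarrow> len (a \<otimes> l) = Suc (len a)"
    and card_absorbed:
      "a \<in> carrier M \<Longrightarrow> card {l \<in> carrier M. len l = 1 \<and> a \<otimes> l = a} = q_int q (len a)"
    and card_factorizations:
      "b \<in> carrier M \<Longrightarrow> len b = Suc k \<Longrightarrow>
        card {(a, l) \<in> carrier M \<times> carrier M. len a = k \<and> len l = 1 \<and> a \<otimes> l = b} = q ^ k"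

locale level_algebra = level_monoid M len n q + K: cring K
  for K :: "('k, 'c) ring_scheme" and M :: "('m, 'd) monoid_scheme" and len n q +
  assumes q_unit: "nat_in K q \<in> Units K"
begin

sublocale finite_monoid_algebra K M
  by unfold_locales (rule finite_carrier)

lemma nat_in_closed [simp]: "nat_in K i \<in> carrier K"
  by (simp add: nat_in_def)

lemma nat_in_mult: "nat_in K (i * j) = nat_in K i \<otimes>\<^bsub>K\<^esub> nat_in K j"
  by (simp add: nat_in_def K.add_pow_ldistr K.add.nat_pow_pow mult.commute)

lemma nat_in_smult: "c \<in> carrier K \<Longrightarrow> nat_in K i \<otimes>\<^bsub>K\<^esub> c = [i] \<cdot>\<^bsub>K\<^esub> c"
  by (simp add: nat_in_def K.add_pow_ldistr)

lemma nat_in_0 [simp]: "nat_in K 0 = \<zero>\<^bsub>K\<^esub>"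
  by (simp add: nat_in_def)

lemma q_power_unit: "nat_in K (q ^ k) \<in> Units K"
  by (induction k) (auto simp: nat_in_mult q_unit, simp add: nat_in_def)

definition x :: "'m \<Rightarrow> 'k" where
  "x = (\<lambda>m. if m \<in> carrier M \<and> len m = 1 then \<one>\<^bsub>K\<^esub> else \<zero>\<^bsub>K\<^esub>)"

definition level_functions :: "('m \<Rightarrow> 'k) set" where
  "level_functions = {a \<in> carrier R. \<forall>m\<in>carrier M. \<forall>m'\<in>carrier M. len m = len m' \<longrightarrow> a m = a m'}"

lemma x_closed [simp]: "x \<in> carrier R"
  by (auto simp: x_def mem_carrier_iff)

lemma level_functions_closed: "a \<in> level_functions \<Longrightarrow> a \<in> carrier R"
  unfolding level_functions_def by blast

lemma level_functionsD: "a \<in> level_functions \<Longrightarrow> m \<in> carrier M \<Longrightarrow> m' \<in> carrier M \<Longrightarrow> len m = len m' \<Longrightarrow> a m = a m'"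
  unfolding level_functions_def by blast

lemma level_functionsI:
  "a \<in> carrier R \<Longrightarrow> (\<And>m m'. m \<in> carrier M \<Longrightarrow> m' \<in> carrier M \<Longrightarrow> len m = len m' \<Longrightarrow> a m = a m') \<Longrightarrow>
    a \<in> level_functions"
  unfolding level_functions_def by blast

section \<open>Right multiplication by the sum of the letters\<close>

lemma mult_x_apply:
  assumes "a \<in> carrier R"
  shows "(a \<otimes>\<^bsub>R\<^esub> x) b = (\<Oplus>\<^bsub>K\<^esub>p\<in>{(i, l) \<in> carrier M \<times> carrier M. len l = 1 \<and> i \<otimes>\<^bsub>M\<^esub> l = b}. a (fst p))"
proof -
  have "(a \<otimes>\<^bsub>R\<^esub> x) b =
    (\<Oplus>\<^bsub>K\<^esub>p\<in>carrier M \<times> carrier M. case p of (i, j) \<Rightarrow> if i \<otimes>\<^bsub>M\<^esub> j = b then a i \<otimes>\<^bsub>K\<^esub> x j else \<zero>\<^bsub>K\<^esub>)"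
    unfolding mult_apply[OF assms x_closed]
    by (rule K.add.finprod_finprod) (use assms in auto)
  also have "\<dots> = (\<Oplus>\<^bsub>K\<^esub>p\<in>{(i, l) \<in> carrier M \<times> carrier M. len l = 1 \<and> i \<otimes>\<^bsub>M\<^esub> l = b}. a (fst p))"
    by (rule K.add.finprod_mono_neutral_cong_right) (use assms in \<open>auto simp: x_def split: if_splits\<close>)
  finally show ?thesis .
qed

text \<open>The coefficient at \<open>b\<close> sums \<open>a i\<close> over the factorizations of
  \<open>b\<close> into \<open>i\<close> and a letter. Either the letter is absorbed and
  \<open>i = b\<close>, or \<open>i\<close> lies exactly one level lower, where \<open>a\<close> has
  the constant value \<open>a m\<close>; \<open>card_absorbed\<close> and
  \<open>card_factorizations\<close> count the two kinds. On level 0 only absorption is possible,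
  and its weight \<open>[0]\<close> is zero.\<close>

lemma mult_x_level:
  assumes a: "a \<in> level_functions" and b: "b \<in> carrier M"
  shows "len b = 0 \<Longrightarrow> (a \<otimes>\<^bsub>R\<^esub> x) b = \<zero>\<^bsub>K\<^esub>"
    and "m \<in> carrier M \<Longrightarrow> len b = Suc (len m) \<Longrightarrow>
      (a \<otimes>\<^bsub>R\<^esub> x) b = nat_in K (q_int q (len b)) \<otimes>\<^bsub>K\<^esub> a b \<oplus>\<^bsub>K\<^esub> nat_in K (q ^ len m) \<otimes>\<^bsub>K\<^esub> a m"
proof -
  note aR = level_functions_closed[OF a]
  let ?P = "\<lambda>k. {(i, l) \<in> carrier M \<times> carrier M. len i = k \<and> len l = 1 \<and> i \<otimes>\<^bsub>M\<^esub> l = b}"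
  let ?A = "{b} \<times> {l \<in> carrier M. len l = 1 \<and> b \<otimes>\<^bsub>M\<^esub> l = b}"
  have fin: "finite (?P k)" for k
    by (rule finite_subset[of _ "carrier M \<times> carrier M"]) (use finite_carrier in auto)
  have finA: "finite ?A" using finite_carrier by auto
  have cases: "i = b \<or> len b = Suc (len i)" if "i \<in> carrier M" "l \<in> carrier M" "len l = 1" "i \<otimes>\<^bsub>M\<^esub> l = b" for i l
    using len_mult_letter[OF that(1-3)] that(4) by metis
  have A: "(\<Oplus>\<^bsub>K\<^esub>p\<in>?A. a (fst p)) = nat_in K (q_int q (len b)) \<otimes>\<^bsub>K\<^esub> a b"
  proof -
    have "(\<Oplus>\<^bsub>K\<^esub>p\<in>?A. a (fst p)) = (\<Oplus>\<^bsub>K\<^esub>p\<in>?A. a b)"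
      using aR by (intro K.finsum_cong') auto
    also have "\<dots> = [card ?A] \<cdot>\<^bsub>K\<^esub> a b" using aR by (simp add: K.add.finprod_const)
    also have "card ?A = q_int q (len b)" using card_absorbed[OF b] by (simp add: card_cartesian_product)
    finally show ?thesis using aR by (simp add: nat_in_smult)
  qed
  show "(a \<otimes>\<^bsub>R\<^esub> x) b = \<zero>\<^bsub>K\<^esub>" if "len b = 0"
  proof -
    have "{(i, l) \<in> carrier M \<times> carrier M. len l = 1 \<and> i \<otimes>\<^bsub>M\<^esub> l = b} = ?A"
    proof (intro equalityI subsetI)
      fix p assume "p \<in> {(i, l) \<in> carrier M \<times> carrier M. len l = 1 \<and> i \<otimes>\<^bsub>M\<^esub> l = b}"
      then obtain i l where "p = (i, l)" "i \<in> carrier M" "l \<in> carrier M" "len l = 1" "i \<otimes>\<^bsub>M\<^esub> l = b" by blast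
      then show "p \<in> ?A" using cases[of i l] that by simp
    qed (use b in auto)
    then show ?thesis
      unfolding mult_x_apply[OF aR] using A aR that by (simp add: q_int_def)
  qed
  show "(a \<otimes>\<^bsub>R\<^esub> x) b = nat_in K (q_int q (len b)) \<otimes>\<^bsub>K\<^esub> a b \<oplus>\<^bsub>K\<^esub> nat_in K (q ^ len m) \<otimes>\<^bsub>K\<^esub> a m"
    if m: "m \<in> carrier M" "len b = Suc (len m)"
  proof -
    have U: "{(i, l) \<in> carrier M \<times> carrier M. len l = 1 \<and> i \<otimes>\<^bsub>M\<^esub> l = b} = ?A \<union> ?P (len m)"
    proof (intro equalityI subsetI)
      fix p assume "p \<in> {(i, l) \<in> carrier M \<times> carrier M. len l = 1 \<and> i \<otimes>\<^bsub>M\<^esub> l = b}"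
      then obtain i l where "p = (i, l)" "i \<in> carrier M" "l \<in> carrier M" "len l = 1" "i \<otimes>\<^bsub>M\<^esub> l = b" by blast
      then show "p \<in> ?A \<union> ?P (len m)" using cases[of i l] m by auto
    qed (use b in auto)
    have disj: "?A \<inter> ?P (len m) = {}" using m by auto
    have "(a \<otimes>\<^bsub>R\<^esub> x) b = (\<Oplus>\<^bsub>K\<^esub>p\<in>?A. a (fst p)) \<oplus>\<^bsub>K\<^esub> (\<Oplus>\<^bsub>K\<^esub>p\<in>?P (len m). a (fst p))"
      unfolding mult_x_apply[OF aR] U
      by (rule K.finsum_Un_disjoint[OF finA fin disj]) (use aR in \<open>auto intro: coeff_in\<close>)
    also have "(\<Oplus>\<^bsub>K\<^esub>p\<in>?P (len m). a (fst p)) = (\<Oplus>\<^bsub>K\<^esub>p\<in>?P (len m). a m)"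
    proof (rule K.finsum_cong'[OF refl])
      fix p assume "p \<in> ?P (len m)"
      then show "a (fst p) = a m" using level_functionsD[OF a, of "fst p" m] m by auto
    qed (use aR in auto)
    also have "\<dots> = [card (?P (len m))] \<cdot>\<^bsub>K\<^esub> a m" using aR by (simp add: K.add.finprod_const)
    also have "card (?P (len m)) = q ^ len m" by (rule card_factorizations[OF b m(2)])
    finally show ?thesis using aR A by (simp add: nat_in_smult)
  qed
qed

lemma ex_lower_level:
  assumes "b \<in> carrier M" "0 < len b"
  obtains m where "m \<in> carrier M" "len b = Suc (len m)"
proof -
  have "len b - 1 \<le> n" using len_le[OF assms(1)] by simp
  from ex_level[OF this] obtain m where "m \<in> carrier M" "len m = len b - 1" by auto
  then show ?thesis using that assms by auto
qed

text \<open>A decreasing filtration from all level functions at \<open>k = 0\<close> down to the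
  zero function at \<open>k = n + 1\<close>.\<close>

definition level_filtration :: "nat \<Rightarrow> ('m \<Rightarrow> 'k) set" where
  "level_filtration k = {a \<in> level_functions. \<forall>m\<in>carrier M. len m < k \<longrightarrow> a m = \<zero>\<^bsub>K\<^esub>}"

lemma level_filtration_closed: "a \<in> level_filtration k \<Longrightarrow> a \<in> carrier R"
  by (simp add: level_filtration_def level_functions_closed)

lemma level_filtration_add:
  assumes "a \<in> level_filtration k" "b \<in> level_filtration k"
  shows "a \<oplus>\<^bsub>R\<^esub> b \<in> level_filtration k"
proof -
  have "a \<in> level_functions" "b \<in> level_functions" using assms by (simp_all add: level_filtration_def)
  then have "a \<oplus>\<^bsub>R\<^esub> b \<in> level_functions"
    by (intro level_functionsI) (simp add: level_functions_closed, simp add: apply_simps, metis level_functionsD)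
  then show ?thesis using assms by (simp add: level_filtration_def apply_simps)
qed

lemma level_filtration_smult:
  assumes "a \<in> level_filtration k" "c \<in> carrier K"
  shows "c \<odot>\<^bsub>R\<^esub> a \<in> level_filtration k"
proof -
  have "a \<in> level_functions" using assms by (simp add: level_filtration_def)
  then have "c \<odot>\<^bsub>R\<^esub> a \<in> level_functions"
    by (intro level_functionsI) (simp add: level_functions_closed assms, simp add: apply_simps, metis level_functionsD)
  then show ?thesis using assms by (simp add: level_filtration_def apply_simps)
qed

text \<open>The values of the product on a level involve only the values of \<open>a\<close> there
  and one level lower. Constancy on levels and vanishing below level \<open>k\<close> are therefore
  both inherited.\<close>

lemma level_filtration_mult_x:
  assumes a: "a \<in> level_filtration k"
  shows "a \<otimes>\<^bsub>R\<^esub> x \<in> level_filtration k"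
proof -
  have al: "a \<in> level_functions" and az: "\<And>m. m \<in> carrier M \<Longrightarrow> len m < k \<Longrightarrow> a m = \<zero>\<^bsub>K\<^esub>"
    using a by (auto simp: level_filtration_def)
  note aR = level_functions_closed[OF al]
  have "(a \<otimes>\<^bsub>R\<^esub> x) b = (a \<otimes>\<^bsub>R\<^esub> x) b'" if b: "b \<in> carrier M" "b' \<in> carrier M" "len b = len b'" for b b'
  proof (cases "len b = 0")
    case True
    then show ?thesis using b mult_x_level(1)[OF al] by simp
  next
    case False
    then obtain m where m: "m \<in> carrier M" "len b = Suc (len m)" using ex_lower_level[of b] b by auto
    then show ?thesis
      using mult_x_level(2)[OF al b(1) m] mult_x_level(2)[OF al b(2) m(1)] b level_functionsD[OF al b] by simp
  qed
  moreover have "(a \<otimes>\<^bsub>R\<^esub> x) b = \<zero>\<^bsub>K\<^esub>" if b: "b \<in> carrier M" "len b < k" for b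
  proof (cases "len b = 0")
    case True
    then show ?thesis using b mult_x_level(1)[OF al] by simp
  next
    case False
    then obtain m where m: "m \<in> carrier M" "len b = Suc (len m)" using ex_lower_level[of b] b by auto
    then show ?thesis
      using mult_x_level(2)[OF al b(1) m] b az by simp
  qed
  moreover have "a \<otimes>\<^bsub>R\<^esub> x \<in> carrier R" using aR by simp
  ultimately show ?thesis unfolding level_filtration_def level_functions_def by blast
qed

section \<open>Polynomials evaluated at the sum of the letters\<close>

abbreviation \<gamma> where "\<gamma> \<equiv> poly_map K R x"
abbreviation P where "P \<equiv> UP K"

sublocale P: UP_cring K P
  by (simp add: UP_cring_def K.cring_axioms)

lemma poly_X_closed [simp]: "poly_X K \<in> carrier P"
  by (simp add: poly_X_def)

lemma gamma_closed [simp]: "p \<in> carrier P \<Longrightarrow> \<gamma> p \<in> carrier R"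
  using ring_hom_closed[OF A.poly_map_ring_hom[OF x_closed]] .

lemma gamma_add [simp]: "p \<in> carrier P \<Longrightarrow> r \<in> carrier P \<Longrightarrow> \<gamma> (p \<oplus>\<^bsub>P\<^esub> r) = \<gamma> p \<oplus>\<^bsub>R\<^esub> \<gamma> r"
  using ring_hom_add[OF A.poly_map_ring_hom[OF x_closed]] .

lemma gamma_mult [simp]: "p \<in> carrier P \<Longrightarrow> r \<in> carrier P \<Longrightarrow> \<gamma> (p \<otimes>\<^bsub>P\<^esub> r) = \<gamma> p \<otimes>\<^bsub>R\<^esub> \<gamma> r"
  using ring_hom_mult[OF A.poly_map_ring_hom[OF x_closed]] .

lemma gamma_one [simp]: "\<gamma> \<one>\<^bsub>P\<^esub> = \<one>\<^bsub>R\<^esub>"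
  using ring_hom_one[OF A.poly_map_ring_hom[OF x_closed]] .

lemma level_filtration_mult_poly:
  assumes p: "p \<in> carrier P" and a: "a \<in> level_filtration k"
  shows "a \<otimes>\<^bsub>R\<^esub> \<gamma> p \<in> level_filtration k"
  using K.cring_axioms p a
proof (induction p arbitrary: a rule: UP_induct)
  case (const c)
  then show ?case
    using level_filtration_closed[OF const(2)]
    by (simp add: A.poly_map_const A.mult_smult level_filtration_smult)
next
  case (add p r)
  then show ?case using level_filtration_closed[OF add(5)] by (simp add: A.r_distr level_filtration_add)
next
  \<comment> \<open>Associativity moves the factor \<open>x\<close> to \<open>a\<close>, so the
    induction hypothesis is used for \<open>a \<otimes> x\<close> in place of \<open>a\<close>;
    hence \<open>a\<close> is arbitrary in the induction.\<close>
  case (X p)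
  then show ?case
    using level_filtration_closed[OF X(3)]
    by (simp add: A.poly_map_X level_filtration_mult_x flip: A.m_assoc)
qed

lemma one_in_level_filtration: "\<one>\<^bsub>R\<^esub> \<in> level_filtration 0"
proof -
  have "\<one>\<^bsub>R\<^esub> m = \<one>\<^bsub>R\<^esub> m'" if "m \<in> carrier M" "m' \<in> carrier M" "len m = len m'" for m m'
    using that len_eq_0_iff[of m] len_eq_0_iff[of m'] by (auto simp: apply_simps)
  then have "\<one>\<^bsub>R\<^esub> \<in> level_functions" using level_functionsI[OF A.one_closed] by blast
  then show ?thesis by (simp add: level_filtration_def)
qed

lemma gamma_level_functions: "p \<in> carrier P \<Longrightarrow> \<gamma> p \<in> level_functions"
  using level_filtration_mult_poly[OF _ one_in_level_filtration, of p]
  by (simp add: level_filtration_def)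

section \<open>Newton polynomials at the nodes [0], [1], [2], ..\<close>

primrec newton_poly :: "nat \<Rightarrow> nat \<Rightarrow> 'k" where
  "newton_poly 0 = \<one>\<^bsub>P\<^esub>"
| "newton_poly (Suc k) = newton_poly k \<otimes>\<^bsub>P\<^esub> (poly_X K \<ominus>\<^bsub>P\<^esub> up_ring.monom P (nat_in K (q_int q k)) 0)"

lemma newton_poly_closed [simp]: "newton_poly k \<in> carrier P"
  by (induction k) auto

lemma root_poly_eq: "root_poly K (q_int q) k = newton_poly (Suc k)"
proof -
  let ?f = "\<lambda>i. poly_X K \<ominus>\<^bsub>P\<^esub> up_ring.monom P (nat_in K (q_int q i)) 0"
  have f: "?f i \<in> carrier P" for i by simp
  have "newton_poly (Suc k) = poly_X K \<otimes>\<^bsub>P\<^esub> (\<Otimes>\<^bsub>P\<^esub>i\<in>{1..k}. ?f i)"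
  proof (induction k)
    case 0
    \<comment> \<open>As \<open>[0] = 0\<close>, the first factor of the Newton product is
      \<open>X\<close> itself; this accounts for the index shift between the two
      polynomials.\<close>
    have "q_int q 0 = 0" by (simp add: q_int_def)
    then show ?case by (simp add: a_minus_def)
  next
    case (Suc k)
    have "{1..Suc k} = insert (Suc k) {1..k}" by auto
    then show ?case
      using Suc f P.P.finprod_insert[of "{1..k}" "Suc k" ?f] P.P.finprod_closed[of ?f "{1..k}"]
      by (simp add: Pi_def P.P.m_ac del: P.P.finprod_closed)
  qed
  then show ?thesis by (simp add: root_poly_def)
qed

text \<open>The image in \<open>K\<close> of \<open>q ^ (k * (k - 1) div 2)\<close>: climbing from
  level \<open>i\<close> to level \<open>i + 1\<close> costs a factor \<open>q ^ i\<close>.\<close>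

primrec q_binomial_power :: "nat \<Rightarrow> 'k" where
  "q_binomial_power 0 = \<one>\<^bsub>K\<^esub>"
| "q_binomial_power (Suc k) = nat_in K (q ^ k) \<otimes>\<^bsub>K\<^esub> q_binomial_power k"

lemma q_binomial_power_unit: "q_binomial_power k \<in> Units K"
  by (induction k) (auto intro!: K.Units_m_closed q_power_unit)

lemma q_binomial_power_closed [simp]: "q_binomial_power k \<in> carrier K"
  using q_binomial_power_unit by (simp add: K.Units_closed)

text \<open>If \<open>a\<close> equals \<open>u\<close> on level \<open>k\<close> and vanishes
  elsewhere, multiplication by \<open>x\<close> gives \<open>[k] u\<close> on level
  \<open>k\<close>, \<open>q ^ k u\<close> on level \<open>k + 1\<close> and zero elsewhere.
  Subtracting \<open>[k] a\<close> clears level \<open>k\<close>.\<close>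

lemma gamma_newton_poly:
  "m \<in> carrier M \<Longrightarrow> \<gamma> (newton_poly k) m = (if len m = k then q_binomial_power k else \<zero>\<^bsub>K\<^esub>)"
proof (induction k arbitrary: m)
  case 0
  then show ?case using len_eq_0_iff by (simp add: apply_simps)
next
  case (Suc k)
  let ?a = "\<gamma> (newton_poly k)" and ?r = "nat_in K (q_int q k)"
  have al: "?a \<in> level_functions" by (simp add: gamma_level_functions)
  note aR = level_functions_closed[OF al]
  have "\<gamma> (newton_poly (Suc k)) = ?a \<otimes>\<^bsub>R\<^esub> (x \<oplus>\<^bsub>R\<^esub> (\<ominus>\<^bsub>K\<^esub> ?r) \<odot>\<^bsub>R\<^esub> \<one>\<^bsub>R\<^esub>)"
    by (simp add: a_minus_def A.poly_map_X A.poly_map_const flip: P.monom_a_inv)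
  also have "\<dots> = ?a \<otimes>\<^bsub>R\<^esub> x \<oplus>\<^bsub>R\<^esub> (\<ominus>\<^bsub>K\<^esub> ?r) \<odot>\<^bsub>R\<^esub> ?a"
    using aR by (simp add: A.r_distr A.mult_smult)
  finally have eq: "\<gamma> (newton_poly (Suc k)) m = (?a \<otimes>\<^bsub>R\<^esub> x) m \<oplus>\<^bsub>K\<^esub> (\<ominus>\<^bsub>K\<^esub> ?r) \<otimes>\<^bsub>K\<^esub> ?a m" by (simp add: apply_simps)
  show ?case
  proof (cases "len m = 0")
    case True
    then show ?thesis using eq mult_x_level(1)[OF al Suc.prems] Suc.IH[OF Suc.prems]
      by (auto simp: q_int_def)
  next
    case False
    then obtain m' where m': "m' \<in> carrier M" "len m = Suc (len m')" using ex_lower_level[of m] Suc.prems by auto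
    show ?thesis
      using eq mult_x_level(2)[OF al Suc.prems m'] Suc.IH[OF Suc.prems] Suc.IH[OF m'(1)] m'(2)
      by (auto simp: K.l_minus K.r_neg)
  qed
qed

declare newton_poly.simps(2) [simp del]

text \<open>The image could only be nonzero on level \<open>n + 1\<close>, which is empty by
  \<open>len_le\<close>.\<close>

lemma gamma_root_poly: "\<gamma> (newton_poly (Suc n)) = \<zero>\<^bsub>R\<^esub>"
proof
  fix m
  show "\<gamma> (newton_poly (Suc n)) m = \<zero>\<^bsub>R\<^esub> m"
    using gamma_newton_poly[of m "Suc n"] len_le[of m] coeff_out[OF gamma_closed[OF newton_poly_closed], of m]
    by (cases "m \<in> carrier M") (auto simp: apply_simps)
qed

text \<open>Division by the monic \<open>X - r\<close> over any commutative ring. In the step,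
  \<open>X = r + (X - r)\<close> turns \<open>X (c + (X - r) t)\<close> into
  \<open>r c + (X - r) (c + X t)\<close>, the recursion of synthetic division.\<close>

lemma remainder_decomposition:
  assumes "s \<in> carrier P" "r \<in> carrier K"
  shows "\<exists>c\<in>carrier K. \<exists>t\<in>carrier P. s = up_ring.monom P c 0 \<oplus>\<^bsub>P\<^esub> (poly_X K \<ominus>\<^bsub>P\<^esub> up_ring.monom P r 0) \<otimes>\<^bsub>P\<^esub> t"
  using K.cring_axioms assms(1)
proof (induction s rule: UP_induct)
  let ?d = "poly_X K \<ominus>\<^bsub>P\<^esub> up_ring.monom P r 0"
  have d: "?d \<in> carrier P" using assms by simp
  {
    case (const c)
    then show ?case using d by (intro bexI[of _ c] bexI[of _ "\<zero>\<^bsub>P\<^esub>"]) auto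
  next
    case (add s s')
    then obtain c t c' t' where ct: "c \<in> carrier K" "t \<in> carrier P" "s = up_ring.monom P c 0 \<oplus>\<^bsub>P\<^esub> ?d \<otimes>\<^bsub>P\<^esub> t"
      "c' \<in> carrier K" "t' \<in> carrier P" "s' = up_ring.monom P c' 0 \<oplus>\<^bsub>P\<^esub> ?d \<otimes>\<^bsub>P\<^esub> t'" by auto
    then have "s \<oplus>\<^bsub>P\<^esub> s' = up_ring.monom P (c \<oplus>\<^bsub>K\<^esub> c') 0 \<oplus>\<^bsub>P\<^esub> ?d \<otimes>\<^bsub>P\<^esub> (t \<oplus>\<^bsub>P\<^esub> t')"
      using d by (simp add: P.P.r_distr P.P.a_ac)
    then show ?case using ct by (intro bexI[of _ "c \<oplus>\<^bsub>K\<^esub> c'"] bexI[of _ "t \<oplus>\<^bsub>P\<^esub> t'"]) auto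
  next
    case (X s)
    then obtain c t where ct: "c \<in> carrier K" "t \<in> carrier P" "s = up_ring.monom P c 0 \<oplus>\<^bsub>P\<^esub> ?d \<otimes>\<^bsub>P\<^esub> t" by auto
    let ?C = "up_ring.monom P c 0" and ?R = "up_ring.monom P r 0"
    have Xd: "poly_X K = ?R \<oplus>\<^bsub>P\<^esub> ?d" using assms by (simp add: a_minus_def P.P.a_ac P.P.r_neg)
    have "poly_X K \<otimes>\<^bsub>P\<^esub> s = poly_X K \<otimes>\<^bsub>P\<^esub> ?C \<oplus>\<^bsub>P\<^esub> poly_X K \<otimes>\<^bsub>P\<^esub> (?d \<otimes>\<^bsub>P\<^esub> t)"
      using ct d by (simp add: P.P.r_distr)
    also have "poly_X K \<otimes>\<^bsub>P\<^esub> ?C = ?R \<otimes>\<^bsub>P\<^esub> ?C \<oplus>\<^bsub>P\<^esub> ?d \<otimes>\<^bsub>P\<^esub> ?C"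
      using ct d assms by (subst Xd) (simp add: P.P.l_distr)
    also have "?R \<otimes>\<^bsub>P\<^esub> ?C = up_ring.monom P (r \<otimes>\<^bsub>K\<^esub> c) 0" using ct assms P.monom_mult[of r c 0 0] by simp
    also have "poly_X K \<otimes>\<^bsub>P\<^esub> (?d \<otimes>\<^bsub>P\<^esub> t) = ?d \<otimes>\<^bsub>P\<^esub> (poly_X K \<otimes>\<^bsub>P\<^esub> t)"
      using ct d by (simp add: P.P.m_lcomm)
    finally have "poly_X K \<otimes>\<^bsub>P\<^esub> s =
        up_ring.monom P (r \<otimes>\<^bsub>K\<^esub> c) 0 \<oplus>\<^bsub>P\<^esub> ?d \<otimes>\<^bsub>P\<^esub> (?C \<oplus>\<^bsub>P\<^esub> poly_X K \<otimes>\<^bsub>P\<^esub> t)"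
      using ct d assms by (simp add: P.P.r_distr P.P.a_assoc)
    then show ?case using ct assms
      by (intro bexI[of _ "r \<otimes>\<^bsub>K\<^esub> c"] bexI[of _ "?C \<oplus>\<^bsub>P\<^esub> poly_X K \<otimes>\<^bsub>P\<^esub> t"]) auto
  }
qed

lemma newton_poly_in_filtration: "\<gamma> (newton_poly k) \<in> level_filtration k"
  using gamma_level_functions[of "newton_poly k"] gamma_newton_poly[of _ k]
  by (simp add: level_filtration_def)

text \<open>Divide the cofactor \<open>s\<close> of \<open>newton_poly k\<close> by
  \<open>X - [k]\<close> and compare values on level \<open>k\<close>. The multiple of
  \<open>newton_poly (Suc k)\<close> is mapped into \<open>level_filtration (Suc k)\<close> and
  vanishes there, so the remainder \<open>c\<close> times a unit is zero. The bound on
  \<open>k\<close> ensures that each level used is nonempty.\<close>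

lemma kernel_dvd:
  assumes p: "p \<in> carrier P" "\<gamma> p = \<zero>\<^bsub>R\<^esub>"
  shows "k \<le> Suc n \<Longrightarrow> \<exists>s\<in>carrier P. p = newton_poly k \<otimes>\<^bsub>P\<^esub> s"
proof (induction k)
  case 0
  then show ?case using p by (intro bexI[of _ p]) auto
next
  case (Suc k)
  then obtain s where s: "s \<in> carrier P" "p = newton_poly k \<otimes>\<^bsub>P\<^esub> s" by auto
  let ?d = "poly_X K \<ominus>\<^bsub>P\<^esub> up_ring.monom P (nat_in K (q_int q k)) 0"
  have d: "?d \<in> carrier P" by simp
  obtain c t where ct: "c \<in> carrier K" "t \<in> carrier P" "s = up_ring.monom P c 0 \<oplus>\<^bsub>P\<^esub> ?d \<otimes>\<^bsub>P\<^esub> t"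
    using remainder_decomposition[OF s(1) nat_in_closed] by blast
  have p_eq: "p = newton_poly k \<otimes>\<^bsub>P\<^esub> up_ring.monom P c 0 \<oplus>\<^bsub>P\<^esub> newton_poly (Suc k) \<otimes>\<^bsub>P\<^esub> t"
    unfolding s(2) ct(3) newton_poly.simps using ct d newton_poly_closed[of k]
    by (simp add: P.P.r_distr P.P.m_assoc)
  obtain m where m: "m \<in> carrier M" "len m = k" using ex_level[of k] Suc.prems by auto
  have "\<gamma> (newton_poly (Suc k)) \<otimes>\<^bsub>R\<^esub> \<gamma> t \<in> level_filtration (Suc k)"
    using level_filtration_mult_poly[OF ct(2) newton_poly_in_filtration] .
  then have "(\<gamma> (newton_poly (Suc k)) \<otimes>\<^bsub>R\<^esub> \<gamma> t) m = \<zero>\<^bsub>K\<^esub>"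
    using m by (simp add: level_filtration_def)
  moreover have "\<gamma> p = c \<odot>\<^bsub>R\<^esub> \<gamma> (newton_poly k) \<oplus>\<^bsub>R\<^esub> \<gamma> (newton_poly (Suc k)) \<otimes>\<^bsub>R\<^esub> \<gamma> t"
    unfolding p_eq using ct newton_poly_closed[of "Suc k"]
    by (simp add: A.poly_map_const A.mult_smult)
  ultimately have "c \<otimes>\<^bsub>K\<^esub> q_binomial_power k = \<zero>\<^bsub>K\<^esub>"
    using p(2) ct m gamma_newton_poly[OF m(1), of k] by (metis K.m_closed K.r_zero apply_simps(1-3) q_binomial_power_closed)
  then have "c = \<zero>\<^bsub>K\<^esub>"
    using K.Units_r_inv[OF q_binomial_power_unit[of k]] ct K.m_assoc[of c "q_binomial_power k" "inv\<^bsub>K\<^esub> q_binomial_power k"]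
      K.Units_inv_closed[OF q_binomial_power_unit[of k]] by simp
  then have "p = newton_poly (Suc k) \<otimes>\<^bsub>P\<^esub> t"
    using p_eq ct by simp
  then show ?case using ct by blast
qed

lemma kernel_eq: "PIdl\<^bsub>P\<^esub> (root_poly K (q_int q) n) = {p \<in> carrier P. \<gamma> p = \<zero>\<^bsub>R\<^esub>}"
proof (intro equalityI subsetI)
  fix p assume "p \<in> PIdl\<^bsub>P\<^esub> (root_poly K (q_int q) n)"
  then obtain s where s: "s \<in> carrier P" "p = s \<otimes>\<^bsub>P\<^esub> newton_poly (Suc n)"
    unfolding root_poly_eq cgenideal_def by blast
  then show "p \<in> {p \<in> carrier P. \<gamma> p = \<zero>\<^bsub>R\<^esub>}"
    using newton_poly_closed[of "Suc n"] gamma_root_poly by simp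
next
  fix p assume "p \<in> {p \<in> carrier P. \<gamma> p = \<zero>\<^bsub>R\<^esub>}"
  then obtain s where s: "s \<in> carrier P" "p = newton_poly (Suc n) \<otimes>\<^bsub>P\<^esub> s"
    using kernel_dvd[of p "Suc n"] by blast
  then have "p = s \<otimes>\<^bsub>P\<^esub> newton_poly (Suc n)"
    using P.P.m_comm[OF newton_poly_closed s(1)] by simp
  then show "p \<in> PIdl\<^bsub>P\<^esub> (root_poly K (q_int q) n)"
    using s(1) unfolding root_poly_eq cgenideal_def by blast
qed

text \<open>Interpolation level by level: a multiple of \<open>newton_poly k\<close> alters only
  level \<open>k\<close>, so the agreement already reached below stays intact, and
  \<open>n + 1\<close> corrections cover the whole monoid.\<close>

lemma gamma_image: "\<gamma> ` carrier P = level_functions"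
proof (intro equalityI subsetI)
  fix a assume "a \<in> \<gamma> ` carrier P"
  then show "a \<in> level_functions" using gamma_level_functions by auto
next
  fix a assume a: "a \<in> level_functions"
  have "\<exists>p\<in>carrier P. \<forall>m\<in>carrier M. len m < k \<longrightarrow> a m = \<gamma> p m" if "k \<le> Suc n" for k
    using that
  proof (induction k)
    case 0
    \<comment> \<open>No value is prescribed at \<open>k = 0\<close>; the unit polynomial is an
      arbitrary choice.\<close>
    then show ?case by (intro bexI[of _ "\<one>\<^bsub>P\<^esub>"]) auto
  next
    case (Suc k)
    then obtain p where p: "p \<in> carrier P" "\<And>m. m \<in> carrier M \<Longrightarrow> len m < k \<Longrightarrow> a m = \<gamma> p m" by auto
    obtain m0 where m0: "m0 \<in> carrier M" "len m0 = k" using ex_level[of k] Suc.prems by auto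
    let ?u = "q_binomial_power k"
    have aK: "a m \<in> carrier K" "\<gamma> p m \<in> carrier K" for m
      using level_functions_closed[OF a] p by auto
    \<comment> \<open>The defect at the representative \<open>m0\<close>, divided by the unit value
      that \<open>newton_poly k\<close> takes on this level.\<close>
    define c where "c = (a m0 \<ominus>\<^bsub>K\<^esub> \<gamma> p m0) \<otimes>\<^bsub>K\<^esub> inv\<^bsub>K\<^esub> ?u"
    have uinv: "inv\<^bsub>K\<^esub> ?u \<in> carrier K" by (rule K.Units_inv_closed[OF q_binomial_power_unit])
    have c: "c \<in> carrier K" unfolding c_def using aK uinv by simp
    have cu: "c \<otimes>\<^bsub>K\<^esub> ?u = a m0 \<ominus>\<^bsub>K\<^esub> \<gamma> p m0"
      unfolding c_def using aK uinv K.Units_l_inv[OF q_binomial_power_unit[of k]] by (simp add: K.m_assoc)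
    define p' where "p' = p \<oplus>\<^bsub>P\<^esub> c \<odot>\<^bsub>P\<^esub> newton_poly k"
    have p': "p' \<in> carrier P" using p c by (simp add: p'_def)
    have g: "\<gamma> p' m = \<gamma> p m \<oplus>\<^bsub>K\<^esub> c \<otimes>\<^bsub>K\<^esub> \<gamma> (newton_poly k) m" for m
      using A.poly_map_alg_hom[OF x_closed] p c by (simp add: p'_def alg_hom_def apply_simps)
    have "a m = \<gamma> p' m" if m: "m \<in> carrier M" "len m < Suc k" for m
    proof (cases "len m = k")
      case True
      then have "a m = a m0" "\<gamma> p m = \<gamma> p m0"
        using m m0 level_functionsD[OF a, of m m0] level_functionsD[OF gamma_level_functions[OF p(1)], of m m0] by auto
      then show ?thesis
        using g[of m] gamma_newton_poly[OF m(1), of k] True cu aK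
        by (simp add: a_minus_def K.a_lcomm K.r_neg)
    next
      case False
      then show ?thesis using g[of m] gamma_newton_poly[OF m(1), of k] p m c aK by simp
    qed
    then show ?case using p' by auto
  qed
  from this[of "Suc n"] obtain p where p: "p \<in> carrier P" "\<And>m. m \<in> carrier M \<Longrightarrow> a m = \<gamma> p m"
    using len_le by (auto simp: less_Suc_eq_le)
  have "a = \<gamma> p"
  proof
    fix m show "a m = \<gamma> p m"
      using p coeff_out[OF level_functions_closed[OF a], of m] coeff_out[OF gamma_closed[OF p(1)], of m]
      by (cases "m \<in> carrier M") auto
  qed
  then show "a \<in> \<gamma> ` carrier P" using p by auto
qed

end

section \<open>Operators annihilated by a product of distinct linear factors\<close>

text \<open>The vector \<open>(T - r (k - 1)) ... (T - r 0) v\<close>, formed on vectors so that no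
  algebra of operators has to be set up.\<close>

primrec shifted_product ::
  "('k, 'c) ring_scheme \<Rightarrow> ('k, 'v, 'd) module_scheme \<Rightarrow> ('v \<Rightarrow> 'v) \<Rightarrow> (nat \<Rightarrow> 'k) \<Rightarrow> nat \<Rightarrow> 'v \<Rightarrow> 'v"
where
  "shifted_product K V T r 0 v = v"
| "shifted_product K V T r (Suc k) v =
    T (shifted_product K V T r k v) \<oplus>\<^bsub>V\<^esub> (\<ominus>\<^bsub>K\<^esub> r k) \<odot>\<^bsub>V\<^esub> shifted_product K V T r k v"

context vectorspace
begin

lemma subspaceI:
  assumes "W \<subseteq> carrier V" "\<zero>\<^bsub>V\<^esub> \<in> W" "\<And>v w. v \<in> W \<Longrightarrow> w \<in> W \<Longrightarrow> v \<oplus>\<^bsub>V\<^esub> w \<in> W"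
    "\<And>c v. c \<in> carrier K \<Longrightarrow> v \<in> W \<Longrightarrow> c \<odot>\<^bsub>V\<^esub> v \<in> W"
  shows "VectorSpace.subspace K W V"
  using assms by (intro subspace.intro submodule.intro vectorspace_axioms module_axioms)

lemma subspaceD:
  assumes "VectorSpace.subspace K W V"
  shows "W \<subseteq> carrier V" "\<zero>\<^bsub>V\<^esub> \<in> W" "\<And>v w. v \<in> W \<Longrightarrow> w \<in> W \<Longrightarrow> v \<oplus>\<^bsub>V\<^esub> w \<in> W"
    "\<And>c v. c \<in> carrier K \<Longrightarrow> v \<in> W \<Longrightarrow> c \<odot>\<^bsub>V\<^esub> v \<in> W"
  using assms by (auto simp: subspace_def submodule_def)

context
  fixes T :: "'c \<Rightarrow> 'c"
  assumes T_closed: "\<And>v. v \<in> carrier V \<Longrightarrow> T v \<in> carrier V"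
    and T_add: "\<And>v w. v \<in> carrier V \<Longrightarrow> w \<in> carrier V \<Longrightarrow> T (v \<oplus>\<^bsub>V\<^esub> w) = T v \<oplus>\<^bsub>V\<^esub> T w"
    and T_smult: "\<And>c v. c \<in> carrier K \<Longrightarrow> v \<in> carrier V \<Longrightarrow> T (c \<odot>\<^bsub>V\<^esub> v) = c \<odot>\<^bsub>V\<^esub> T v"
begin

text \<open>A maximal \<open>T\<close>-stable subspace meeting \<open>U\<close> trivially is a complement: an eigenvector outside
  \<open>U + W\<close> could be added to \<open>W\<close>.\<close>

lemma semisimple_if_eigenvectors_span:
  assumes E: "E \<subseteq> carrier K" and span: "span (\<Union>c\<in>E. eigenspace_of V T c) = carrier V"
  shows "semisimple_operator K V T"
  unfolding semisimple_operator_def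
proof (intro allI impI)
  fix U assume "VectorSpace.subspace K U V \<and> T ` U \<subseteq> U"
  then have U: "VectorSpace.subspace K U V" "T ` U \<subseteq> U" by auto
  let ?F = "{W. VectorSpace.subspace K W V \<and> T ` W \<subseteq> W \<and> U \<inter> W = {\<zero>\<^bsub>V\<^esub>}}"
  have T0: "T \<zero>\<^bsub>V\<^esub> = \<zero>\<^bsub>V\<^esub>"
    using T_smult[of "\<zero>\<^bsub>K\<^esub>" "\<zero>\<^bsub>V\<^esub>"] T_closed[of "\<zero>\<^bsub>V\<^esub>"] by simp
  have "{\<zero>\<^bsub>V\<^esub>} \<in> ?F" using subspaceD(2)[OF U(1)] T0 by (auto intro!: subspaceI)
  then have ne: "?F \<noteq> {}" by blast
  \<comment> \<open>Any two members of a chain are comparable, so two vectors of the union lie in a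
    common member; this gives closure under sums.\<close>
  have chain: "\<Union>C \<in> ?F" if "C \<noteq> {}" "subset.chain ?F C" for C
  proof -
    have C: "W \<in> ?F" if "W \<in> C" for W using that \<open>subset.chain ?F C\<close> by (auto simp: subset.chain_def)
    have lin: "W \<subseteq> W' \<or> W' \<subseteq> W" if "W \<in> C" "W' \<in> C" for W W'
      using that \<open>subset.chain ?F C\<close> by (auto simp: subset.chain_def)
    have "VectorSpace.subspace K W V" if "W \<in> C" for W using C[OF that] by simp
    note CD = subspaceD[OF this]
    have "VectorSpace.subspace K (\<Union>C) V"
    proof (rule subspaceI)
      show "\<Union>C \<subseteq> carrier V" using CD(1) by blast
      show "\<zero>\<^bsub>V\<^esub> \<in> \<Union>C" using CD(2) \<open>C \<noteq> {}\<close> by blast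
      show "v \<oplus>\<^bsub>V\<^esub> w \<in> \<Union>C" if vw: "v \<in> \<Union>C" "w \<in> \<Union>C" for v w
      proof -
        obtain W W' where "W \<in> C" "v \<in> W" "W' \<in> C" "w \<in> W'" using vw by blast
        then show ?thesis using lin[of W W'] CD(3)[of W v w] CD(3)[of W' v w] by blast
      qed
      show "c \<odot>\<^bsub>V\<^esub> v \<in> \<Union>C" if "c \<in> carrier K" "v \<in> \<Union>C" for c v
        using CD(4) that by blast
    qed
    moreover have "T ` \<Union>C \<subseteq> \<Union>C" "U \<inter> \<Union>C = {\<zero>\<^bsub>V\<^esub>}" using C \<open>C \<noteq> {}\<close> by fast+
    ultimately show ?thesis by blast
  qed
  from subset_Zorn_nonempty[OF ne chain] obtain W
    where W: "W \<in> ?F" and max: "\<forall>X\<in>?F. W \<subseteq> X \<longrightarrow> X = W" ..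
  have Ws: "VectorSpace.subspace K W V" "T ` W \<subseteq> W" "U \<inter> W = {\<zero>\<^bsub>V\<^esub>}" using W by auto
  note UD = subspaceD[OF U(1)] and WD = subspaceD[OF Ws(1)]
  have sum: "U <+>\<^bsub>V\<^esub> W = submodule_sum U W"
    by (auto simp: set_add_def' submodule_sum_def)
  have sub: "submodule K (U <+>\<^bsub>V\<^esub> W) V"
    unfolding sum by (rule sum_is_submodule) (use U Ws in \<open>auto simp: subspace_def\<close>)
  have W_le: "w \<in> U <+>\<^bsub>V\<^esub> W" if "w \<in> W" for w
    using that UD(2) WD(1) by (force simp: set_add_def')
  have "eigenspace_of V T s \<subseteq> U <+>\<^bsub>V\<^esub> W" if s: "s \<in> E" for s
  proof (rule subsetI, rule ccontr)
    fix v assume "v \<in> eigenspace_of V T s" and nv: "v \<notin> U <+>\<^bsub>V\<^esub> W"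
    then have v: "v \<in> carrier V" "T v = s \<odot>\<^bsub>V\<^esub> v" by (auto simp: eigenspace_of_def)
    have sK: "s \<in> carrier K" using s E by blast
    \<comment> \<open>\<open>W\<close> enlarged by the multiples of \<open>v\<close>; it is stable
      under \<open>T\<close> because \<open>v\<close> is an eigenvector.\<close>
    let ?W = "{w \<oplus>\<^bsub>V\<^esub> c \<odot>\<^bsub>V\<^esub> v | w c. w \<in> W \<and> c \<in> carrier K}"
    have Wc: "w \<in> carrier V" if "w \<in> W" for w using that WD(1) by blast
    have "VectorSpace.subspace K ?W V"
    proof (rule subspaceI)
      show "?W \<subseteq> carrier V" using v Wc by auto
      show "\<zero>\<^bsub>V\<^esub> \<in> ?W" using v WD(2) by (intro CollectI exI[of _ "\<zero>\<^bsub>V\<^esub>"] exI[of _ "\<zero>\<^bsub>K\<^esub>"]) simp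
      show "a \<oplus>\<^bsub>V\<^esub> b \<in> ?W" if ab: "a \<in> ?W" "b \<in> ?W" for a b
      proof -
        obtain w c w' c' where w: "w \<in> W" "c \<in> carrier K" "a = w \<oplus>\<^bsub>V\<^esub> c \<odot>\<^bsub>V\<^esub> v" "w' \<in> W" "c' \<in> carrier K" "b = w' \<oplus>\<^bsub>V\<^esub> c' \<odot>\<^bsub>V\<^esub> v"
          using ab by blast
        then have "a \<oplus>\<^bsub>V\<^esub> b = (w \<oplus>\<^bsub>V\<^esub> w') \<oplus>\<^bsub>V\<^esub> (c \<oplus>\<^bsub>K\<^esub> c') \<odot>\<^bsub>V\<^esub> v"
          using v Wc by (simp add: smult_l_distr M.a_ac)
        then show ?thesis using w WD(3) by blast
      qed
      show "d \<odot>\<^bsub>V\<^esub> a \<in> ?W" if d: "d \<in> carrier K" and a: "a \<in> ?W" for d a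
      proof -
        obtain w c where w: "w \<in> W" "c \<in> carrier K" "a = w \<oplus>\<^bsub>V\<^esub> c \<odot>\<^bsub>V\<^esub> v" using a by blast
        then have "d \<odot>\<^bsub>V\<^esub> a = d \<odot>\<^bsub>V\<^esub> w \<oplus>\<^bsub>V\<^esub> (d \<otimes>\<^bsub>K\<^esub> c) \<odot>\<^bsub>V\<^esub> v"
          using v Wc d by (simp add: smult_r_distr smult_assoc1)
        then show ?thesis using w WD(4) d by blast
      qed
    qed
    moreover have "T ` ?W \<subseteq> ?W"
    proof
      fix y assume "y \<in> T ` ?W"
      then obtain w c where w: "w \<in> W" "c \<in> carrier K" "y = T (w \<oplus>\<^bsub>V\<^esub> c \<odot>\<^bsub>V\<^esub> v)" by blast
      then have "y = T w \<oplus>\<^bsub>V\<^esub> (c \<otimes>\<^bsub>K\<^esub> s) \<odot>\<^bsub>V\<^esub> v"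
        using v Wc sK by (simp add: T_add T_smult smult_assoc1)
      then show "y \<in> ?W" using w Ws(2) sK by blast
    qed
    moreover have "U \<inter> ?W = {\<zero>\<^bsub>V\<^esub>}"
    proof (intro equalityI subsetI)
      fix u assume "u \<in> U \<inter> ?W"
      then obtain w c where w: "u \<in> U" "w \<in> W" "c \<in> carrier K" "u = w \<oplus>\<^bsub>V\<^esub> c \<odot>\<^bsub>V\<^esub> v" by blast
      show "u \<in> {\<zero>\<^bsub>V\<^esub>}"
      proof (cases "c = \<zero>\<^bsub>K\<^esub>")
        case True
        then show ?thesis using w v Wc Ws(3) by auto
      next
        case False
        \<comment> \<open>With \<open>c\<close> invertible, the equation for \<open>u\<close> can be
          solved for \<open>v\<close>, which would then lie in \<open>U + W\<close>.\<close>
        let ?i = "inv\<^bsub>K\<^esub> c"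
        have i: "?i \<in> carrier K" "?i \<otimes>\<^bsub>K\<^esub> c = \<one>\<^bsub>K\<^esub>"
          using False w(3) field_Units Units_l_inv by auto
        have uc: "u \<in> carrier V" "w \<in> carrier V" using w UD(1) WD(1) by blast+
        have nw: "(\<ominus>\<^bsub>K\<^esub> \<one>\<^bsub>K\<^esub>) \<odot>\<^bsub>V\<^esub> w = \<ominus>\<^bsub>V\<^esub> w" using smult_minus_1 uc by blast
        have "c \<odot>\<^bsub>V\<^esub> v = u \<oplus>\<^bsub>V\<^esub> (\<ominus>\<^bsub>K\<^esub> \<one>\<^bsub>K\<^esub>) \<odot>\<^bsub>V\<^esub> w"
          unfolding nw w(4) using uc w(3) v by (simp add: M.a_ac M.r_neg1 M.r_neg2)
        then have "?i \<odot>\<^bsub>V\<^esub> (c \<odot>\<^bsub>V\<^esub> v) = ?i \<odot>\<^bsub>V\<^esub> u \<oplus>\<^bsub>V\<^esub> ?i \<odot>\<^bsub>V\<^esub> ((\<ominus>\<^bsub>K\<^esub> \<one>\<^bsub>K\<^esub>) \<odot>\<^bsub>V\<^esub> w)"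
          using i uc by (simp add: smult_r_distr)
        then have "v = ?i \<odot>\<^bsub>V\<^esub> u \<oplus>\<^bsub>V\<^esub> ?i \<odot>\<^bsub>V\<^esub> ((\<ominus>\<^bsub>K\<^esub> \<one>\<^bsub>K\<^esub>) \<odot>\<^bsub>V\<^esub> w)"
          using i v w(3) by (simp flip: smult_assoc1)
        moreover have "?i \<odot>\<^bsub>V\<^esub> u \<in> U" "?i \<odot>\<^bsub>V\<^esub> ((\<ominus>\<^bsub>K\<^esub> \<one>\<^bsub>K\<^esub>) \<odot>\<^bsub>V\<^esub> w) \<in> W"
          using UD(4) WD(4) i w by auto
        ultimately have "v \<in> U <+>\<^bsub>V\<^esub> W" unfolding set_add_def' by blast
        with nv show ?thesis by blast
      qed
    next
      fix u assume "u \<in> {\<zero>\<^bsub>V\<^esub>}"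
      then show "u \<in> U \<inter> ?W" using UD(2) subspaceD(2)[OF calculation(1)] by blast
    qed
    ultimately have "?W \<in> ?F" by blast
    moreover have "W \<subseteq> ?W"
    proof
      fix w assume "w \<in> W"
      moreover from this have "w = w \<oplus>\<^bsub>V\<^esub> \<zero>\<^bsub>K\<^esub> \<odot>\<^bsub>V\<^esub> v" using v Wc by simp
      ultimately show "w \<in> ?W" by blast
    qed
    ultimately have "?W = W" using max by blast
    moreover have "v = \<zero>\<^bsub>V\<^esub> \<oplus>\<^bsub>V\<^esub> \<one>\<^bsub>K\<^esub> \<odot>\<^bsub>V\<^esub> v" using v by simp
    then have "v \<in> ?W" using WD(2) by blast
    ultimately show False using W_le[of v] nv by blast
  qed
  then have "span (\<Union>c\<in>E. eigenspace_of V T c) \<subseteq> U <+>\<^bsub>V\<^esub> W"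
    by (intro span_is_subset sub) blast
  then have "U <+>\<^bsub>V\<^esub> W = carrier V"
    using span sub by (auto simp: submodule_def)
  then show "\<exists>W. VectorSpace.subspace K W V \<and> T ` W \<subseteq> W \<and> U \<inter> W = {\<zero>\<^bsub>V\<^esub>} \<and> U <+>\<^bsub>V\<^esub> W = carrier V"
    using Ws by blast
qed

context
  fixes r :: "nat \<Rightarrow> 'a"
  assumes r_closed: "\<And>i. r i \<in> carrier K"
begin

abbreviation tp where "tp \<equiv> shifted_product K V T r"

lemma tp_closed: "v \<in> carrier V \<Longrightarrow> tp k v \<in> carrier V"
  by (induction k) (simp_all add: T_closed r_closed)

lemma tp_add: "v \<in> carrier V \<Longrightarrow> w \<in> carrier V \<Longrightarrow> tp k (v \<oplus>\<^bsub>V\<^esub> w) = tp k v \<oplus>\<^bsub>V\<^esub> tp k w"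
  by (induction k) (simp_all add: T_closed r_closed tp_closed T_add smult_r_distr M.a_ac)

lemma tp_smult: "c \<in> carrier K \<Longrightarrow> v \<in> carrier V \<Longrightarrow> tp k (c \<odot>\<^bsub>V\<^esub> v) = c \<odot>\<^bsub>V\<^esub> tp k v"
proof (induction k)
  case (Suc k)
  have "(\<ominus>\<^bsub>K\<^esub> r k) \<odot>\<^bsub>V\<^esub> (c \<odot>\<^bsub>V\<^esub> tp k v) = c \<odot>\<^bsub>V\<^esub> ((\<ominus>\<^bsub>K\<^esub> r k) \<odot>\<^bsub>V\<^esub> tp k v)"
    using Suc.prems tp_closed r_closed by (simp add: m_comm flip: smult_assoc1)
  then show ?case using Suc by (simp add: T_closed r_closed tp_closed T_smult smult_r_distr)
qed simp

text \<open>On an eigenvector for \<open>s\<close>, the product \<open>(T - r 0) \<dots> (T - r (k - 1))\<close> is multiplication by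
  \<open>(s - r 0) \<dots> (s - r (k - 1))\<close>, and a field has no zero divisors.\<close>

lemma tp_eigenvector:
  assumes "s \<in> carrier K" "w \<in> carrier V" "T w = s \<odot>\<^bsub>V\<^esub> w"
  shows "\<exists>c\<in>carrier K. tp k w = c \<odot>\<^bsub>V\<^esub> w \<and> (c = \<zero>\<^bsub>K\<^esub> \<longrightarrow> (\<exists>i<k. s = r i))"
proof (induction k)
  case 0
  then show ?case using assms by (intro bexI[of _ "\<one>\<^bsub>K\<^esub>"]) auto
next
  case (Suc k)
  then obtain c where c: "c \<in> carrier K" "tp k w = c \<odot>\<^bsub>V\<^esub> w" "c = \<zero>\<^bsub>K\<^esub> \<longrightarrow> (\<exists>i<k. s = r i)" by blast
  have "tp (Suc k) w = (c \<otimes>\<^bsub>K\<^esub> s) \<odot>\<^bsub>V\<^esub> w \<oplus>\<^bsub>V\<^esub> ((\<ominus>\<^bsub>K\<^esub> r k) \<otimes>\<^bsub>K\<^esub> c) \<odot>\<^bsub>V\<^esub> w"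
    using c assms r_closed by (simp add: T_smult smult_assoc1)
  also have "\<dots> = (c \<otimes>\<^bsub>K\<^esub> (s \<ominus>\<^bsub>K\<^esub> r k)) \<odot>\<^bsub>V\<^esub> w"
    using c assms r_closed[of k] by (simp add: a_minus_def r_distr m_comm smult_l_distr)
  finally have "tp (Suc k) w = (c \<otimes>\<^bsub>K\<^esub> (s \<ominus>\<^bsub>K\<^esub> r k)) \<odot>\<^bsub>V\<^esub> w" .
  moreover have "\<exists>i<Suc k. s = r i" if "c \<otimes>\<^bsub>K\<^esub> (s \<ominus>\<^bsub>K\<^esub> r k) = \<zero>\<^bsub>K\<^esub>"
    using integral[OF that] c assms(1) r_closed[of k] by (auto simp: less_Suc_eq)
  ultimately show ?case using c assms r_closed by (intro bexI[of _ "c \<otimes>\<^bsub>K\<^esub> (s \<ominus>\<^bsub>K\<^esub> r k)"]) auto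
qed

text \<open>Put \<open>w = tp k v\<close>. The hypothesis says that \<open>T - r k\<close> kills
  \<open>w\<close>, and as \<open>r k\<close> differs from the earlier roots, \<open>tp k\<close>
  multiplies \<open>w\<close> by a nonzero scalar \<open>c\<close>. Subtracting \<open>inv c\<close>
  times \<open>w\<close> from \<open>v\<close> gives a vector killed by \<open>tp k\<close>, to
  which the induction hypothesis applies, while \<open>w\<close> itself lies in the last
  eigenspace.\<close>

lemma tp_zero_in_span:
  assumes distinct: "\<And>i j. i < j \<Longrightarrow> j \<le> n \<Longrightarrow> r i \<noteq> r j"
  shows "k \<le> Suc n \<Longrightarrow> v \<in> carrier V \<Longrightarrow> tp k v = \<zero>\<^bsub>V\<^esub> \<Longrightarrow> v \<in> span (\<Union>i\<in>{..<k}. eigenspace_of V T (r i))"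
proof (induction k arbitrary: v)
  case 0
  then show ?case using span_zero by simp
next
  case (Suc k)
  let ?S = "\<lambda>k. \<Union>i\<in>{..<k}. eigenspace_of V T (r i)"
  have S: "?S k \<subseteq> carrier V" for k by (auto simp: eigenspace_of_def)
  define w where "w = tp k v"
  have w: "w \<in> carrier V" unfolding w_def using tp_closed Suc.prems by blast
  have "T w \<oplus>\<^bsub>V\<^esub> (\<ominus>\<^bsub>K\<^esub> r k) \<odot>\<^bsub>V\<^esub> w = \<zero>\<^bsub>V\<^esub>" using Suc.prems by (simp add: w_def)
  moreover have "(r k) \<odot>\<^bsub>V\<^esub> w \<oplus>\<^bsub>V\<^esub> (\<ominus>\<^bsub>K\<^esub> r k) \<odot>\<^bsub>V\<^esub> w = \<zero>\<^bsub>V\<^esub>"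
    using w r_closed[of k] by (simp flip: smult_l_distr add: R.r_neg)
  ultimately have Tw: "T w = r k \<odot>\<^bsub>V\<^esub> w"
    using w r_closed[of k] T_closed[OF w] by (metis M.add.right_cancel R.a_inv_closed smult_closed)
  from tp_eigenvector[OF r_closed w Tw, of k] obtain c where
    c: "c \<in> carrier K" "tp k w = c \<odot>\<^bsub>V\<^esub> w" "c = \<zero>\<^bsub>K\<^esub> \<longrightarrow> (\<exists>i<k. r k = r i)" by blast
  then have "c \<noteq> \<zero>\<^bsub>K\<^esub>" using distinct[of _ k] Suc.prems(1) by fastforce
  then have i: "inv\<^bsub>K\<^esub> c \<in> carrier K" "inv\<^bsub>K\<^esub> c \<otimes>\<^bsub>K\<^esub> c = \<one>\<^bsub>K\<^esub>"
    using c(1) field_Units Units_l_inv by auto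
  let ?u = "v \<oplus>\<^bsub>V\<^esub> (\<ominus>\<^bsub>K\<^esub> (inv\<^bsub>K\<^esub> c)) \<odot>\<^bsub>V\<^esub> w"
  have u: "?u \<in> carrier V" using Suc.prems w i by simp
  have "tp k ?u = w \<oplus>\<^bsub>V\<^esub> (\<ominus>\<^bsub>K\<^esub> (inv\<^bsub>K\<^esub> c) \<otimes>\<^bsub>K\<^esub> c) \<odot>\<^bsub>V\<^esub> w"
    using Suc.prems w i c by (simp add: tp_add tp_smult smult_assoc1 flip: w_def)
  also have "\<dots> = \<zero>\<^bsub>V\<^esub>"
    using w i c by (simp add: R.l_minus smult_minus_1 M.r_neg)
  finally have "?u \<in> span (?S k)" using Suc.IH[of ?u] Suc.prems(1) u by simp
  moreover have "span (?S k) \<subseteq> span (?S (Suc k))" by (intro span_is_monotone UN_mono) auto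
  ultimately have u_span: "?u \<in> span (?S (Suc k))" by blast
  have "w \<in> ?S (Suc k)" using w Tw by (intro UN_I[of k]) (auto simp: eigenspace_of_def)
  then have "w \<in> span (?S (Suc k))" using in_own_span[OF S] by blast
  then have w_span: "inv\<^bsub>K\<^esub> c \<odot>\<^bsub>V\<^esub> w \<in> span (?S (Suc k))"
    using span_is_submodule[OF S, of "Suc k"] i by (auto simp: submodule_def)
  have "?u \<oplus>\<^bsub>V\<^esub> inv\<^bsub>K\<^esub> c \<odot>\<^bsub>V\<^esub> w = v \<oplus>\<^bsub>V\<^esub> (\<ominus>\<^bsub>K\<^esub> (inv\<^bsub>K\<^esub> c) \<oplus>\<^bsub>K\<^esub> inv\<^bsub>K\<^esub> c) \<odot>\<^bsub>V\<^esub> w"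
    using Suc.prems w i by (simp add: smult_l_distr M.a_assoc)
  also have "\<dots> = v" using Suc.prems w i by (simp add: R.l_neg)
  finally have "?u \<oplus>\<^bsub>V\<^esub> inv\<^bsub>K\<^esub> c \<odot>\<^bsub>V\<^esub> w = v" .
  then show ?case using u_span w_span span_is_submodule[OF S, of "Suc k"] by (metis submodule.m_closed)
qed

text \<open>Annihilation puts every vector into the span of the eigenspaces. An eigenvalue other
  than the \<open>r i\<close> would make \<open>tp (Suc n)\<close> multiply a nonzero vector by a
  nonzero scalar, although it kills everything.\<close>

lemma split_operator_semisimple:
  assumes distinct: "\<And>i j. i < j \<Longrightarrow> j \<le> n \<Longrightarrow> r i \<noteq> r j"
    and zero: "\<And>v. v \<in> carrier V \<Longrightarrow> tp (Suc n) v = \<zero>\<^bsub>V\<^esub>"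
  shows "acts_semisimply_with_eigenvalues_in K V T {r i | i. i \<in> {0..n}}"
proof -
  let ?E = "{r i | i. i \<in> {0..n}}"
  have eq: "(\<Union>i\<in>{..<Suc n}. eigenspace_of V T (r i)) = (\<Union>c\<in>?E. eigenspace_of V T c)"
    by (force simp: less_Suc_eq_le)
  have "span (\<Union>c\<in>?E. eigenspace_of V T c) \<subseteq> carrier V"
    by (rule span_is_subset2) (auto simp: eigenspace_of_def)
  then have span: "span (\<Union>c\<in>?E. eigenspace_of V T c) = carrier V"
    using tp_zero_in_span[OF distinct _ _ zero] eq by auto
  have "semisimple_operator K V T"
    by (rule semisimple_if_eigenvectors_span[OF _ span]) (use r_closed in auto)
  moreover have "eigenvalues_of K V T \<subseteq> ?E"
  proof
    fix s assume "s \<in> eigenvalues_of K V T"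
    then obtain w where w: "s \<in> carrier K" "w \<in> carrier V" "T w = s \<odot>\<^bsub>V\<^esub> w" "w \<noteq> \<zero>\<^bsub>V\<^esub>"
      by (auto simp: eigenvalues_of_def eigenspace_of_def)
    from tp_eigenvector[OF w(1-3), of "Suc n"] obtain c where
      c: "c \<in> carrier K" "tp (Suc n) w = c \<odot>\<^bsub>V\<^esub> w" "c = \<zero>\<^bsub>K\<^esub> \<longrightarrow> (\<exists>i<Suc n. s = r i)" by blast
    have "c = \<zero>\<^bsub>K\<^esub>"
    proof (rule ccontr)
      assume "c \<noteq> \<zero>\<^bsub>K\<^esub>"
      then have i: "inv\<^bsub>K\<^esub> c \<in> carrier K" "inv\<^bsub>K\<^esub> c \<otimes>\<^bsub>K\<^esub> c = \<one>\<^bsub>K\<^esub>"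
        using c(1) field_Units Units_l_inv by auto
      have z: "c \<odot>\<^bsub>V\<^esub> w = \<zero>\<^bsub>V\<^esub>" using zero[OF w(2)] c(2) by (rule trans[OF sym, rotated])
      have "w = inv\<^bsub>K\<^esub> c \<odot>\<^bsub>V\<^esub> (c \<odot>\<^bsub>V\<^esub> w)" using i c w by (simp flip: smult_assoc1)
      then show False unfolding z using w(4) i by simp
    qed
    then show "s \<in> ?E" using c(3) by (auto simp: less_Suc_eq_le)
  qed
  ultimately show ?thesis using span by (simp add: acts_semisimply_with_eigenvalues_in_def)
qed

end

end

end

section \<open>Groups acting transitively on levels\<close>

lemma q_int_Suc: "q_int q (Suc k) = q_int q k + q ^ k"
  by (simp add: q_int_def)

lemma q_int_add: "q_int q (i + j) = q_int q i + q ^ i * q_int q j"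
  by (induction j) (simp_all add: q_int_Suc q_int_def[of q 0] power_add algebra_simps)

section \<open>Cardinalities of the levels\<close>

context level_monoid
begin

definition level :: "nat \<Rightarrow> 'm set" where "level k = {m \<in> carrier M. len m = k}"

lemma finite_level [simp]: "finite (level k)"
  using finite_carrier by (simp add: level_def)

text \<open>An element of maximal length \<open>n\<close> absorbs every letter, because its length
  cannot grow; \<open>card_absorbed\<close> then counts all letters.\<close>

lemma card_letters: "card (level 1) = q_int q n"
proof -
  obtain m where m: "m \<in> carrier M" "len m = n" using ex_level by blast
  have "m \<otimes> l = m" if "l \<in> level 1" for l
    using len_mult_letter[of m l] len_le[of "m \<otimes> l"] that m by (auto simp: level_def)
  then have "{l \<in> carrier M. len l = 1 \<and> m \<otimes> l = m} = level 1" by (auto simp: level_def)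
  then show ?thesis using card_absorbed[OF m(1)] m by simp
qed

text \<open>Count the pairs of an element of level \<open>k\<close> and a letter in two ways. Each
  element has \<open>[n]\<close> letters, of which \<open>[k]\<close> are absorbed; the remaining
  pairs hit every element of level \<open>k + 1\<close> exactly \<open>q ^ k\<close> times. Since
  \<open>[n] - [k] = q ^ k [n - k]\<close>, the factor \<open>q ^ k\<close> cancels.\<close>

lemma card_level_Suc:
  assumes "k < n"
  shows "card (level (Suc k)) = card (level k) * q_int q (n - k)"
proof -
  let ?P = "SIGMA a:level k. level 1"
  let ?A = "SIGMA a:level k. {l \<in> carrier M. len l = 1 \<and> a \<otimes> l = a}"
  let ?B = "\<lambda>b. {(a, l) \<in> carrier M \<times> carrier M. len a = k \<and> len l = 1 \<and> a \<otimes> l = b}"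
  have fin: "finite (?B b)" for b
    by (rule finite_subset[of _ "carrier M \<times> carrier M"]) (use finite_carrier in auto)
  have P: "?P = ?A \<union> (\<Union>b\<in>level (Suc k). ?B b)"
  proof (intro equalityI subsetI)
    fix p assume "p \<in> ?P"
    then obtain a l where p: "p = (a, l)" "a \<in> carrier M" "len a = k" "l \<in> carrier M" "len l = 1"
      by (auto simp: level_def)
    then show "p \<in> ?A \<union> (\<Union>b\<in>level (Suc k). ?B b)"
      using len_mult_letter[of a l] by (cases "a \<otimes> l = a") (auto simp: level_def)
  qed (auto simp: level_def)
  have "card ?P = card ?A + card (\<Union>b\<in>level (Suc k). ?B b)"
    unfolding P by (rule card_Un_disjoint) (use finite_carrier fin in \<open>auto simp: level_def\<close>)
  also have "card ?A = (\<Sum>a\<in>level k. q_int q k)"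
    using card_absorbed finite_carrier by (subst card_SigmaI) (auto simp: level_def)
  also have "card (\<Union>b\<in>level (Suc k). ?B b) = (\<Sum>b\<in>level (Suc k). card (?B b))"
    by (rule card_UN_disjoint) (use fin in auto)
  also have "\<dots> = (\<Sum>b\<in>level (Suc k). q ^ k)"
    by (rule sum.cong[OF refl], rule card_factorizations) (auto simp: level_def)
  finally have "card (level k) * q_int q n = card (level k) * q_int q k + card (level (Suc k)) * q ^ k"
    by (simp add: card_letters[unfolded One_nat_def])
  moreover have "q_int q n = q_int q k + q ^ k * q_int q (n - k)"
    using q_int_add[of q k "n - k"] assms by simp
  ultimately have "q ^ k * (card (level k) * q_int q (n - k)) = q ^ k * card (level (Suc k))"
    by (simp add: algebra_simps)
  then show ?thesis using q_pos by simp
qed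

text \<open>The factor \<open>[i]\<close> enters in the step from level \<open>n - i\<close> to the
  next one and divides the size of every later level.\<close>

lemma q_int_dvd_card_level:
  assumes "0 < i" "i \<le> n"
  shows "q_int q i dvd card (level n)"
proof -
  have "q_int q i dvd card (level k)" if "n - i < k" "k \<le> n" for k
    using that
  proof (induction k)
    case (Suc k)
    then have eq: "card (level (Suc k)) = card (level k) * q_int q (n - k)" by (intro card_level_Suc) simp
    show ?case
    proof (cases "k = n - i")
      case True
      then show ?thesis using eq assms by simp
    next
      case False
      then show ?thesis using Suc eq by simp
    qed
  qed simp
  then show ?thesis using assms by simp
qed

end

locale level_action = level_algebra K M len n q + G: group G
  for K :: "('k, 'c) ring_scheme" and M :: "('m, 'd) monoid_scheme" and len n q
    and G :: "('g, 'e) monoid_scheme" +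
  fixes act :: "'g \<Rightarrow> 'm \<Rightarrow> 'm"
  assumes finite_group: "finite (carrier G)"
    and act_closed: "g \<in> carrier G \<Longrightarrow> m \<in> carrier M \<Longrightarrow> act g m \<in> carrier M"
    and act_one: "m \<in> carrier M \<Longrightarrow> act \<one>\<^bsub>G\<^esub> m = m"
    and act_mult: "g \<in> carrier G \<Longrightarrow> h \<in> carrier G \<Longrightarrow> m \<in> carrier M \<Longrightarrow> act (g \<otimes>\<^bsub>G\<^esub> h) m = act g (act h m)"
    and len_act: "g \<in> carrier G \<Longrightarrow> m \<in> carrier M \<Longrightarrow> len (act g m) = len m"
    and transitive: "m \<in> carrier M \<Longrightarrow> m' \<in> carrier M \<Longrightarrow> len m = len m' \<Longrightarrow> \<exists>g\<in>carrier G. act g m = m'"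
begin

abbreviation S where "S \<equiv> invariant_subalgebra K M G act"

lemma act_inv: "g \<in> carrier G \<Longrightarrow> m \<in> carrier M \<Longrightarrow> act (inv\<^bsub>G\<^esub> g) (act g m) = m"
  by (simp flip: act_mult add: act_one)

lemma act_inv': "g \<in> carrier G \<Longrightarrow> m \<in> carrier M \<Longrightarrow> act g (act (inv\<^bsub>G\<^esub> g) m) = m"
  by (simp flip: act_mult add: act_one)

text \<open>Orbit counting: an element carrying \<open>m0\<close> to \<open>m\<close> translates the
  stabilizer of \<open>m0\<close> onto the set of all such elements. So the group splits into fibres
  of equal size, one for each point of the level.\<close>

lemma card_level_dvd_order:
  assumes "k \<le> n"
  shows "card (level k) dvd Coset.order G"
proof -
  obtain m0 where m0: "m0 \<in> carrier M" "len m0 = k" using ex_level[OF assms] by blast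
  let ?F = "\<lambda>m. {g \<in> carrier G. act g m0 = m}"
  have fib: "card (?F m) = card (?F m0)" if m: "m \<in> level k" for m
  proof -
    obtain h where h: "h \<in> carrier G" "act h m0 = m" using transitive[OF m0(1), of m] m m0 by (auto simp: level_def)
    have "bij_betw (\<lambda>g. h \<otimes>\<^bsub>G\<^esub> g) (?F m0) (?F m)"
      by (rule bij_betw_byWitness[where f' = "\<lambda>g. inv\<^bsub>G\<^esub> h \<otimes>\<^bsub>G\<^esub> g"])
        (use h m0 in \<open>auto simp: act_mult act_inv G.inv_solve_left' simp flip: G.m_assoc\<close>)
    then show ?thesis by (simp add: bij_betw_same_card)
  qed
  have "card (carrier G) = (\<Sum>m\<in>level k. \<Sum>g | g \<in> carrier G \<and> act g m0 = m. 1)"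
    using sum.group[of "carrier G" "level k" "\<lambda>g. act g m0" "\<lambda>_. 1 :: nat"] finite_group m0
    by (auto simp: level_def act_closed len_act image_subset_iff)
  also have "\<dots> = (\<Sum>m\<in>level k. card (?F m0))"
    using fib by (intro sum.cong) auto
  finally show ?thesis by (simp add: Coset.order_def)
qed

lemma finsum_apply:
  "f \<in> A \<rightarrow> carrier R \<Longrightarrow> (\<Oplus>\<^bsub>R\<^esub>i\<in>A. f i) m = (\<Oplus>\<^bsub>K\<^esub>i\<in>A. f i m)"
proof (induction A rule: infinite_finite_induct)
  case (insert i A)
  then have "(\<Oplus>\<^bsub>R\<^esub>i\<in>insert i A. f i) = f i \<oplus>\<^bsub>R\<^esub> (\<Oplus>\<^bsub>R\<^esub>i\<in>A. f i)" by simp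
  then show ?case using insert by (auto simp: apply_simps Pi_def)
qed (simp_all add: apply_simps)

text \<open>Identifies \<open>letter_sum\<close> and \<open>line_sum\<close> with the indicator
  function \<open>x\<close>. The indexing \<open>f\<close> is left open since the letters are
  \<open>[i]\<close> for numbers in one case and \<open>[L]\<close> for lines in the other.\<close>

lemma finsum_letters_eq_x:
  assumes "inj_on f I" "f ` I = level 1"
  shows "(\<Oplus>\<^bsub>R\<^esub>i\<in>I. basis_elt K (f i)) = x"
proof
  fix m
  have fin: "finite I" using assms finite_level finite_image_iff by metis
  have "f i \<in> carrier M" if "i \<in> I" for i using that assms(2) by (auto simp: level_def)
  then have be: "(\<lambda>i. basis_elt K (f i)) \<in> I \<rightarrow> carrier R"
    by (auto simp: mem_carrier_iff basis_elt_def)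
  have "(\<Oplus>\<^bsub>R\<^esub>i\<in>I. basis_elt K (f i)) m = (\<Oplus>\<^bsub>K\<^esub>i\<in>I. if m = f i then \<one>\<^bsub>K\<^esub> else \<zero>\<^bsub>K\<^esub>)"
    unfolding finsum_apply[OF be] by (simp add: basis_elt_def)
  also have "\<dots> = x m"
  proof (cases "m \<in> level 1")
    case True
    then obtain j where j: "j \<in> I" "m = f j" using assms(2) by blast
    have "(\<Oplus>\<^bsub>K\<^esub>i\<in>I. if m = f i then \<one>\<^bsub>K\<^esub> else \<zero>\<^bsub>K\<^esub>) = (\<Oplus>\<^bsub>K\<^esub>i\<in>I. if j = i then \<one>\<^bsub>K\<^esub> else \<zero>\<^bsub>K\<^esub>)"
      using j inj_on_eq_iff[OF assms(1)] by (intro K.finsum_cong') auto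
    also have "\<dots> = \<one>\<^bsub>K\<^esub>" using K.finsum_singleton[OF j(1) fin, of "\<lambda>_. \<one>\<^bsub>K\<^esub>"] by simp
    finally show ?thesis using True by (simp add: x_def level_def)
  next
    case False
    then have "(\<Oplus>\<^bsub>K\<^esub>i\<in>I. if m = f i then \<one>\<^bsub>K\<^esub> else \<zero>\<^bsub>K\<^esub>) = \<zero>\<^bsub>K\<^esub>"
      using assms(2) by (intro K.add.finprod_one_eqI) auto
    then show ?thesis using False by (auto simp: x_def level_def)
  qed
  finally show "(\<Oplus>\<^bsub>R\<^esub>i\<in>I. basis_elt K (f i)) m = x m" .
qed

lemma linear_extension_closed:
  assumes "a \<in> carrier R" "g \<in> carrier G"
  shows "linear_extension K M (act g) a \<in> carrier R"
  unfolding linear_extension_def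
proof (rule A.finsum_closed, rule Pi_I)
  fix m assume "m \<in> support K a"
  then have "m \<in> carrier M" using coeff_out[OF assms(1)] by (auto simp: support_def)
  then show "a m \<odot>\<^bsub>R\<^esub> basis_elt K (act g m) \<in> carrier R"
    using assms act_closed by (intro A.smult_closed) (auto simp: mem_carrier_iff basis_elt_def)
qed

text \<open>\<open>act g\<close> is injective on the monoid, so only \<open>m\<close> contributes to
  the coefficient at \<open>act g m\<close>. Invariance thus means equal values along
  orbits.\<close>

lemma linear_extension_apply:
  assumes a: "a \<in> carrier R" and g: "g \<in> carrier G" and m: "m \<in> carrier M"
  shows "linear_extension K M (act g) a (act g m) = a m"
proof -
  have supp: "support K a \<subseteq> carrier M" using coeff_out[OF a] by (auto simp: support_def)
  have inj: "act g m = act g m' \<longleftrightarrow> m = m'" if "m' \<in> carrier M" for m'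
    using act_inv[OF g m] act_inv[OF g that] by metis
  have be: "basis_elt K (act g m') \<in> carrier R" if "m' \<in> carrier M" for m'
    using that act_closed[OF g that] by (auto simp: mem_carrier_iff basis_elt_def)
  have "linear_extension K M (act g) a (act g m) =
      (\<Oplus>\<^bsub>K\<^esub>m'\<in>support K a. a m' \<otimes>\<^bsub>K\<^esub> basis_elt K (act g m') (act g m))"
    unfolding linear_extension_def using supp a be
    by (subst finsum_apply) (auto simp: apply_simps)
  also have "\<dots> = (\<Oplus>\<^bsub>K\<^esub>m'\<in>carrier M. if m = m' then a m' else \<zero>\<^bsub>K\<^esub>)"
    by (rule K.add.finprod_mono_neutral_cong_left)
      (use supp a in \<open>auto simp: basis_elt_def inj support_def\<close>)
  also have "\<dots> = a m"
    by (rule K.finsum_singleton) (use m a in auto)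
  finally show ?thesis .
qed

lemma carrier_invariant_subalgebra: "carrier S = level_functions"
proof (intro equalityI subsetI)
  fix a assume "a \<in> carrier S"
  then have a: "a \<in> carrier R" and inv: "\<And>g. g \<in> carrier G \<Longrightarrow> linear_extension K M (act g) a = a"
    by (auto simp: invariant_subalgebra_def)
  show "a \<in> level_functions"
  proof (rule level_functionsI[OF a])
    fix m m' assume m: "m \<in> carrier M" "m' \<in> carrier M" "len m = len m'"
    then obtain g where "g \<in> carrier G" "act g m = m'" using transitive by blast
    then show "a m = a m'" using linear_extension_apply[OF a _ m(1), of g] inv[of g] by simp
  qed
next
  fix a assume a: "a \<in> level_functions"
  note aR = level_functions_closed[OF a]
  have "linear_extension K M (act g) a = a" if g: "g \<in> carrier G" for g
  proof
    fix m
    show "linear_extension K M (act g) a m = a m"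
    proof (cases "m \<in> carrier M")
      case True
      \<comment> \<open>Every point is the image of some point under \<open>g\<close>, so the
        coefficient formula reaches all of \<open>carrier M\<close>.\<close>
      let ?m = "act (inv\<^bsub>G\<^esub> g) m"
      have m': "?m \<in> carrier M" "act g ?m = m" "len ?m = len m"
        using g True by (auto simp: act_closed act_inv' len_act)
      then show ?thesis
        using linear_extension_apply[OF aR g m'(1)] level_functionsD[OF a m'(1) True m'(3)] by simp
    next
      case False
      then show ?thesis using coeff_out[OF aR] coeff_out[OF linear_extension_closed[OF aR g]] by simp
    qed
  qed
  then show "a \<in> carrier S" using aR by (simp add: invariant_subalgebra_def)
qed

lemma S_eq: "S = R\<lparr>carrier := level_functions\<rparr>"
  using carrier_invariant_subalgebra by (simp add: invariant_subalgebra_def)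

theorem invariants_presentation:
  shows "\<gamma> \<in> alg_hom K P R" and "\<gamma> (poly_X K) = x"
    and "\<exists>\<Gamma>\<in>alg_iso K (alg_quot P (PIdl\<^bsub>P\<^esub> (root_poly K (q_int q) n))) S.
      \<forall>p\<in>carrier P. \<Gamma> (PIdl\<^bsub>P\<^esub> (root_poly K (q_int q) n) +>\<^bsub>P\<^esub> p) = \<gamma> p"
    and "cring S" and "generated_subalgebra K R {x} = carrier S"
  using A.poly_map_alg_hom[OF x_closed] A.poly_map_X[OF x_closed]
    A.poly_map_quotient_iso[OF x_closed gamma_image[symmetric] kernel_eq]
    A.poly_map_image_subalgebra(3)[OF x_closed gamma_image[symmetric]]
    A.generated_subalgebra_eq[OF x_closed] gamma_image
  by (simp_all add: S_eq)

lemma nat_in_dvd_unit: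
  assumes "i dvd j" "nat_in K j \<in> Units K"
  shows "nat_in K i \<in> Units K"
proof -
  obtain d where "j = i * d" using assms(1) by blast
  then have "nat_in K i \<otimes>\<^bsub>K\<^esub> nat_in K d \<in> Units K" using assms(2) nat_in_mult by simp
  then obtain u where "u \<in> carrier K" "nat_in K i \<otimes>\<^bsub>K\<^esub> nat_in K d \<otimes>\<^bsub>K\<^esub> u = \<one>\<^bsub>K\<^esub>"
    by (auto simp: Units_def)
  then show ?thesis
    unfolding Units_def
    by (intro CollectI conjI bexI[of _ "nat_in K d \<otimes>\<^bsub>K\<^esub> u"]) (auto simp: K.m_ac)
qed

lemma eigenvalues_distinct:
  assumes "field K" "nat_in K (Coset.order G) \<in> Units K" "i < j" "j \<le> n"
  shows "nat_in K (q_int q i) \<noteq> nat_in K (q_int q j)"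
proof
  interpret field K by fact
  assume eq: "nat_in K (q_int q i) = nat_in K (q_int q j)"
  have "q_int q j = q_int q i + q ^ i * q_int q (j - i)"
    using q_int_add[of q i "j - i"] assms by simp
  then have "nat_in K (q_int q j) = nat_in K (q_int q i) \<oplus>\<^bsub>K\<^esub> nat_in K (q ^ i) \<otimes>\<^bsub>K\<^esub> nat_in K (q_int q (j - i))"
    by (simp add: nat_in_mult[symmetric]) (simp add: nat_in_def K.add.nat_pow_mult)
  with eq have "nat_in K (q ^ i) \<otimes>\<^bsub>K\<^esub> nat_in K (q_int q (j - i)) = \<zero>\<^bsub>K\<^esub>"
    using K.add.r_cancel_one'[of "nat_in K (q ^ i) \<otimes>\<^bsub>K\<^esub> nat_in K (q_int q (j - i))" "nat_in K (q_int q i)"] by simp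
  moreover have "q_int q (j - i) dvd Coset.order G"
    using q_int_dvd_card_level[of "j - i"] card_level_dvd_order[of n] assms by (auto intro: dvd_trans)
  then have "nat_in K (q_int q (j - i)) \<in> Units K" using nat_in_dvd_unit assms(2) by blast
  then have "nat_in K (q ^ i) \<otimes>\<^bsub>K\<^esub> nat_in K (q_int q (j - i)) \<in> Units K"
    using q_power_unit by blast
  ultimately show False using field_Units by auto
qed

section \<open>Modules over the invariant subalgebra\<close>

lemma restrict_scalars_simps:
  fixes V :: "('m \<Rightarrow> 'k, 'v) module"
  shows "carrier (restrict_scalars S V) = carrier V" "add (restrict_scalars S V) = add V"
    "zero (restrict_scalars S V) = zero V"
    "c \<odot>\<^bsub>restrict_scalars S V\<^esub> v = (c \<odot>\<^bsub>R\<^esub> \<one>\<^bsub>R\<^esub>) \<odot>\<^bsub>V\<^esub> v"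
  by (simp_all add: restrict_scalars_def ring.defs module.defs S_eq)

text \<open>\<open>V\<close> is a vector space over \<open>K\<close> through the scalars
  \<open>c \<odot> \<one>\<close>, which belong to \<open>S\<close>. Commutativity of
  \<open>S\<close> makes the action of \<open>x\<close> linear over \<open>K\<close>; the shifted
  products are the actions of the Newton polynomials, and \<open>newton_poly (Suc n)\<close> acts as
  zero because it lies in the kernel of \<open>\<gamma>\<close>.\<close>

theorem invariants_act_semisimply:
  fixes V :: "('m \<Rightarrow> 'k, 'v) module"
  assumes "field K" "nat_in K (Coset.order G) \<in> Units K" "Module.module S V"
  shows "acts_semisimply_with_eigenvalues_in K (restrict_scalars S V) (\<lambda>v. x \<odot>\<^bsub>V\<^esub> v)
    {nat_in K (q_int q i) | i. i \<in> {0..n}}"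
proof -
  interpret F: field K by fact
  interpret V: Module.module S V by fact
  let ?V = "restrict_scalars S V"
  have S_simps: "add S = add R" "mult S = mult R" "one S = one R" "zero S = zero R" "carrier S = level_functions"
    by (simp_all add: S_eq)
  note rs = restrict_scalars_simps
  have gS: "\<gamma> p \<in> carrier S" if "p \<in> carrier P" for p
    using gamma_level_functions[OF that] S_simps by simp
  have scal: "c \<odot>\<^bsub>R\<^esub> \<one>\<^bsub>R\<^esub> \<in> carrier S" if "c \<in> carrier K" for c
    using gS[of "up_ring.monom P c 0"] that by (simp add: A.poly_map_const)
  have "abelian_group ?V"
  proof (rule abelian_groupI)
    fix v assume "v \<in> carrier ?V"
    then show "\<exists>w\<in>carrier ?V. w \<oplus>\<^bsub>?V\<^esub> v = \<zero>\<^bsub>?V\<^esub>"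
      by (intro bexI[of _ "\<ominus>\<^bsub>V\<^esub> v"]) (auto simp: rs V.M.l_neg)
  qed (auto simp: rs V.M.a_ac)
  moreover have "(c \<oplus>\<^bsub>K\<^esub> d) \<odot>\<^bsub>R\<^esub> \<one>\<^bsub>R\<^esub> = c \<odot>\<^bsub>R\<^esub> \<one>\<^bsub>R\<^esub> \<oplus>\<^bsub>S\<^esub> d \<odot>\<^bsub>R\<^esub> \<one>\<^bsub>R\<^esub>"
    "(c \<otimes>\<^bsub>K\<^esub> d) \<odot>\<^bsub>R\<^esub> \<one>\<^bsub>R\<^esub> = (c \<odot>\<^bsub>R\<^esub> \<one>\<^bsub>R\<^esub>) \<otimes>\<^bsub>S\<^esub> (d \<odot>\<^bsub>R\<^esub> \<one>\<^bsub>R\<^esub>)" if "c \<in> carrier K" "d \<in> carrier K" for c d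
    using that by (simp_all add: S_simps A.smult_l_distr A.smult_assoc1 A.smult_mult)
  moreover have "(\<one>\<^bsub>K\<^esub> \<odot>\<^bsub>R\<^esub> \<one>\<^bsub>R\<^esub>) \<odot>\<^bsub>V\<^esub> v = v" if "v \<in> carrier V" for v
    using V.smult_one[OF that] by (simp add: S_simps)
  ultimately have "Module.module K ?V"
    using scal
    by (intro moduleI K.cring_axioms)
      (simp_all del: A.smult_one add: rs V.smult_l_distr V.smult_r_distr V.smult_assoc1)
  then interpret VS: vectorspace K ?V
    by (simp add: vectorspace_def F.field_axioms)
  have xS: "x \<in> carrier S" using gS[of "poly_X K"] by (simp add: A.poly_map_X)
  have tp: "shifted_product K ?V (\<lambda>v. x \<odot>\<^bsub>V\<^esub> v) (\<lambda>i. nat_in K (q_int q i)) k v = \<gamma> (newton_poly k) \<odot>\<^bsub>V\<^esub> v"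
    if v: "v \<in> carrier V" for k v
  proof (induction k)
    case 0
    then show ?case using v V.smult_one[OF v] by (simp add: S_simps)
  next
    case (Suc k)
    let ?r = "nat_in K (q_int q k)"
    \<comment> \<open>The factors are swapped because \<open>shifted_product\<close> applies its
      newest factor last, that is, on the left.\<close>
    have "\<gamma> (newton_poly (Suc k)) = \<gamma> ((poly_X K \<oplus>\<^bsub>P\<^esub> up_ring.monom P (\<ominus>\<^bsub>K\<^esub> ?r) 0) \<otimes>\<^bsub>P\<^esub> newton_poly k)"
      by (simp add: newton_poly.simps a_minus_def P.P.m_comm del: gamma_mult)
    also have "\<dots> = (x \<oplus>\<^bsub>S\<^esub> (\<ominus>\<^bsub>K\<^esub> ?r) \<odot>\<^bsub>R\<^esub> \<one>\<^bsub>R\<^esub>) \<otimes>\<^bsub>S\<^esub> \<gamma> (newton_poly k)"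
      by (simp add: A.poly_map_X A.poly_map_const S_simps del: P.monom_a_inv)
    finally show ?case
      using Suc v xS scal gS[OF newton_poly_closed]
      by (simp add: rs V.smult_assoc1 V.smult_l_distr)
  qed
  show ?thesis
  proof (rule VS.split_operator_semisimple)
    show "shifted_product K ?V (\<lambda>v. x \<odot>\<^bsub>V\<^esub> v) (\<lambda>i. nat_in K (q_int q i)) (Suc n) v = \<zero>\<^bsub>?V\<^esub>"
      if "v \<in> carrier ?V" for v
      using that V.lmult_0[of v] by (simp only: rs tp gamma_root_poly S_simps)
    show "x \<odot>\<^bsub>V\<^esub> (c \<odot>\<^bsub>?V\<^esub> v) = c \<odot>\<^bsub>?V\<^esub> (x \<odot>\<^bsub>V\<^esub> v)" if "c \<in> carrier K" "v \<in> carrier ?V" for c v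
      using that xS scal[OF that(1)] V.R.m_comm[OF xS scal[OF that(1)]]
      by (simp add: rs flip: V.smult_assoc1)
  qed (use xS eigenvalues_distinct[OF assms(1,2)] in \<open>auto simp: rs V.smult_r_distr\<close>)
qed

end

section \<open>Subspaces over a finite field\<close>

text \<open>Coordinates with respect to a basis identify the space with the functions from the basis
  to the field. A finite carrier is its own finite generating set, which yields the basis.\<close>

lemma (in vectorspace) card_eq_power_dim:
  assumes "finite (carrier V)"
  shows "card (carrier V) = card (carrier K) ^ dim"
proof -
  have "gen_set (carrier V)"
    using in_own_span[of "carrier V"] span_is_subset2[of "carrier V"] by auto
  then have "fin_dim" using assms unfolding fin_dim_def by blast
  then obtain \<beta> where \<beta>: "finite \<beta>" "basis \<beta>" using finite_basis_exists by blast
  then have sub: "\<beta> \<subseteq> carrier V" by (simp add: basis_def)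
  have uniq: "\<exists>!a. a \<in> \<beta> \<rightarrow>\<^sub>E carrier K \<and> lincomb a \<beta> = v" if "v \<in> carrier V" for v
    using basis_criterion[OF \<beta>(1) sub] \<beta>(2) that by blast
  have closed: "lincomb a \<beta> \<in> carrier V" if "a \<in> \<beta> \<rightarrow>\<^sub>E carrier K" for a
    using that sub by (intro lincomb_closed) auto
  have "bij_betw (\<lambda>a. lincomb a \<beta>) (\<beta> \<rightarrow>\<^sub>E carrier K) (carrier V)"
    unfolding bij_betw_def inj_on_def
  proof (intro conjI ballI impI equalityI subsetI)
    fix a b assume "a \<in> \<beta> \<rightarrow>\<^sub>E carrier K" "b \<in> \<beta> \<rightarrow>\<^sub>E carrier K" "lincomb a \<beta> = lincomb b \<beta>"
    then show "a = b" using uniq[OF closed[of a]] by metis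
  next
    fix v assume "v \<in> carrier V"
    then show "v \<in> (\<lambda>a. lincomb a \<beta>) ` (\<beta> \<rightarrow>\<^sub>E carrier K)" using uniq by blast
  qed (use closed in auto)
  then have "card (carrier V) = card (\<beta> \<rightarrow>\<^sub>E carrier K)" by (simp add: bij_betw_same_card)
  then show ?thesis using \<beta> dim_basis by (simp add: card_PiE)
qed

section \<open>Deletion of repeated entries\<close>

lemma dedup_snoc: "dedup (xs @ [y]) = (if y \<in> set xs then dedup xs else dedup xs @ [y])"
  by (simp add: dedup_def)

lemma set_dedup [simp]: "set (dedup xs) = set xs"
  by (simp add: dedup_def)

lemma dedup_distinct: "distinct xs \<Longrightarrow> dedup xs = xs"
  by (simp add: dedup_def distinct_remdups_id)

lemma distinct_dedup: "distinct (dedup xs)"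
  by (simp add: dedup_def)

lemma dedup_append_left: "dedup (dedup xs @ ys) = dedup (xs @ ys)"
  by (simp add: dedup_def remdups_append2)

lemma remdups_map_append: "remdups (map f (remdups zs) @ xs) = remdups (map f zs @ xs)"
  by (induction zs) auto

text \<open>An entry deleted by the inner \<open>dedup\<close> repeats an earlier one, so its image
  repeats an earlier image and is deleted by the outer \<open>dedup\<close> as well. Associativity
  of both monoids rests on this.\<close>

lemma dedup_append_map: "dedup (xs @ map f (dedup ys)) = dedup (xs @ map f ys)"
  by (simp add: dedup_def rev_map remdups_map_append)

section \<open>Counting vectors and lines over a finite field\<close>

locale finite_field_flags =
  fixes n q :: nat and ty :: "'f::{field, finite} itself"
  assumes q_eq: "q = card (UNIV :: 'f set)"
begin

lemma q_ge_2: "2 \<le> q"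
proof -
  have "card {0, 1 :: 'f} \<le> q" unfolding q_eq by (rule card_mono) auto
  then show ?thesis by simp
qed

lemma finite_carrier_vec [simp]: "finite (carrier_vec n :: 'f vec set)"
proof (rule finite_subset)
  show "(carrier_vec n :: 'f vec set) \<subseteq> vec n ` ({..<n} \<rightarrow>\<^sub>E UNIV)"
  proof
    fix v :: "'f vec" assume "v \<in> carrier_vec n"
    then have "v = vec n (restrict (\<lambda>i. v $ i) {..<n})" by auto
    moreover have "restrict (\<lambda>i. v $ i) {..<n} \<in> {..<n} \<rightarrow>\<^sub>E UNIV" by simp
    ultimately show "v \<in> vec n ` ({..<n} \<rightarrow>\<^sub>E UNIV)" by (rule image_eqI)
  qed
qed (intro finite_imageI finite_PiE, auto)

definition vsub :: "'f vec set \<Rightarrow> bool" where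
  "vsub W \<longleftrightarrow> W \<subseteq> carrier_vec n \<and> 0\<^sub>v n \<in> W \<and> (\<forall>v\<in>W. \<forall>w\<in>W. v + w \<in> W) \<and> (\<forall>c. \<forall>v\<in>W. c \<cdot>\<^sub>v v \<in> W)"

lemma vsub_iff: "VectorSpace.subspace class_ring W (module_vec TYPE('f) n) \<longleftrightarrow> vsub W"
  using vec_vs[of n, where ?'a = 'f] vec_module[of n, where ?'a = 'f]
  by (auto simp: subspace_def submodule_def vsub_def module_vec_simps)

lemma vsubD:
  assumes "vsub W"
  shows "W \<subseteq> carrier_vec n" "0\<^sub>v n \<in> W" "\<And>v w. v \<in> W \<Longrightarrow> w \<in> W \<Longrightarrow> v + w \<in> W" "\<And>c v. v \<in> W \<Longrightarrow> c \<cdot>\<^sub>v v \<in> W"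
    "finite W"
  using assms finite_subset[OF _ finite_carrier_vec] by (simp_all add: vsub_def)

lemma vsub_diff: "vsub W \<Longrightarrow> v \<in> W \<Longrightarrow> w \<in> W \<Longrightarrow> v - w \<in> W"
proof -
  assume W: "vsub W" "v \<in> W" "w \<in> W"
  then have "v \<in> carrier_vec n" "w \<in> carrier_vec n" using vsubD(1) by blast+
  then have "v - w = v + (- 1) \<cdot>\<^sub>v w" by auto
  then show ?thesis using W vsubD(3,4)[OF W(1)] by simp
qed

lemma card_vsub: "vsub W \<Longrightarrow> card W = q ^ vectorspace.dim (class_ring :: 'f ring) (module_vec TYPE('f) n\<lparr>carrier := W\<rparr>)"
proof -
  assume W: "vsub W"
  interpret V: vectorspace "class_ring :: 'f ring" "module_vec TYPE('f) n" by (rule vec_vs)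
  interpret W: vectorspace "class_ring :: 'f ring" "module_vec TYPE('f) n\<lparr>carrier := W\<rparr>"
    by (rule V.subspace_is_vs) (simp add: vsub_iff W)
  show ?thesis using W.card_eq_power_dim vsubD(5)[OF W] by (simp add: q_eq)
qed

text \<open>As \<open>q \<ge> 2\<close>, the number \<open>q ^ d\<close> determines
  \<open>d\<close>, so cardinality can stand in for dimension in the arguments about flags.\<close>

lemma vec_subspace_iff: "vec_subspace TYPE('f) n d W \<longleftrightarrow> vsub W \<and> card W = q ^ d"
  using card_vsub q_ge_2 by (auto simp: vec_subspace_def vsub_iff)

lemma vsub_carrier: "vsub (carrier_vec n)"
  by (auto simp: vsub_def)

lemma card_carrier_vec: "card (carrier_vec n :: 'f vec set) = q ^ n"
proof -
  have "module_vec TYPE('f) n\<lparr>carrier := carrier_vec n\<rparr> = module_vec TYPE('f) n"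
    by (simp add: module_vec_def)
  then show ?thesis using card_vsub[OF vsub_carrier] vec_space.dim_is_n[where ?'a = 'f] by simp
qed

lemma vsub_zero: "vsub {0\<^sub>v n}"
  by (auto simp: vsub_def)

definition adjoin :: "'f vec set \<Rightarrow> 'f vec \<Rightarrow> 'f vec set" where
  "adjoin A v = {a + c \<cdot>\<^sub>v v | a c. a \<in> A}"

lemma adjoin_vsub:
  assumes A: "vsub A" and v: "v \<in> carrier_vec n"
  shows "vsub (adjoin A v)"
  unfolding vsub_def
proof (intro conjI ballI allI)
  have Ac: "a \<in> carrier_vec n" if "a \<in> A" for a using that vsubD(1)[OF A] by blast
  show "adjoin A v \<subseteq> carrier_vec n" using Ac v by (auto simp: adjoin_def)
  have "0\<^sub>v n = 0\<^sub>v n + 0 \<cdot>\<^sub>v v" using v by auto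
  then show "0\<^sub>v n \<in> adjoin A v" using vsubD(2)[OF A] unfolding adjoin_def by blast
  fix x assume "x \<in> adjoin A v"
  then obtain a c where x: "a \<in> A" "x = a + c \<cdot>\<^sub>v v" by (auto simp: adjoin_def)
  show "d \<cdot>\<^sub>v x \<in> adjoin A v" for d
  proof -
    have "d \<cdot>\<^sub>v x = d \<cdot>\<^sub>v a + (d * c) \<cdot>\<^sub>v v"
      using Ac[OF x(1)] v x(2) by (simp add: smult_add_distrib_vec[of _ n] smult_smult_assoc)
    then show ?thesis using vsubD(4)[OF A x(1)] unfolding adjoin_def by blast
  qed
  fix y assume "y \<in> adjoin A v"
  then obtain b d where y: "b \<in> A" "y = b + d \<cdot>\<^sub>v v" by (auto simp: adjoin_def)
  have "x + y = (a + b) + (c + d) \<cdot>\<^sub>v v"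
    using Ac[OF x(1)] Ac[OF y(1)] v x(2) y(2)
    by (intro eq_vecI) (auto simp: algebra_simps)
  then show "x + y \<in> adjoin A v" using vsubD(3)[OF A x(1) y(1)] unfolding adjoin_def by blast
qed

lemma adjoin_mem:
  assumes A: "vsub A" and v: "v \<in> carrier_vec n"
  shows "v \<in> adjoin A v" "A \<subseteq> adjoin A v"
proof -
  have "v = 0\<^sub>v n + 1 \<cdot>\<^sub>v v" using v by auto
  then show "v \<in> adjoin A v" using vsubD(2)[OF A] unfolding adjoin_def by blast
  show "A \<subseteq> adjoin A v"
  proof
    fix a assume a: "a \<in> A"
    then have "a \<in> carrier_vec n" using vsubD(1)[OF A] by blast
    then have "a = a + 0 \<cdot>\<^sub>v v" using v by auto
    then show "a \<in> adjoin A v" using a unfolding adjoin_def by blast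
  qed
qed

lemma adjoin_least: "vsub W \<Longrightarrow> A \<subseteq> W \<Longrightarrow> v \<in> W \<Longrightarrow> adjoin A v \<subseteq> W"
  using vsubD(3,4) by (fastforce simp: adjoin_def)

lemma adjoin_absorb: "vsub A \<Longrightarrow> v \<in> A \<Longrightarrow> adjoin A v = A"
  using adjoin_least[of A A v] adjoin_mem(2)[of A v] vsubD(1) by blast

text \<open>The vector of \<open>A\<close> and the scalar can be recovered from their combination:
  two representations with different scalars would express \<open>v\<close> through elements of
  \<open>A\<close>.\<close>

lemma card_adjoin:
  assumes A: "vsub A" and v: "v \<in> carrier_vec n" "v \<notin> A"
  shows "card (adjoin A v) = card A * q"
proof -
  have Ac: "a \<in> carrier_vec n" if "a \<in> A" for a using that vsubD(1)[OF A] by blast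
  have "inj_on (\<lambda>(a, c). a + c \<cdot>\<^sub>v v) (A \<times> UNIV)"
  proof (rule inj_onI, clarify)
    fix a c b d assume ab: "a \<in> A" "b \<in> A" and eq: "a + c \<cdot>\<^sub>v v = b + d \<cdot>\<^sub>v v"
    note abc = Ac[OF ab(1)] Ac[OF ab(2)]
    have eqi: "a $ i + c * v $ i = b $ i + d * v $ i" if "i < n" for i
      using arg_cong[OF eq, of "\<lambda>u. u $ i"] abc v that by simp
    have cd: "c = d"
    proof (rule ccontr)
      assume "c \<noteq> d"
      have "v = (1 / (c - d)) \<cdot>\<^sub>v (b - a)"
      proof (rule eq_vecI)
        fix i assume "i < dim_vec ((1 / (c - d)) \<cdot>\<^sub>v (b - a))"
        then have i: "i < n" using abc by simp
        have "(c - d) * v $ i = b $ i - a $ i" using eqi[OF i] by (simp add: algebra_simps)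
        then show "v $ i = ((1 / (c - d)) \<cdot>\<^sub>v (b - a)) $ i"
          using \<open>c \<noteq> d\<close> i abc by (simp add: field_simps)
      qed (use v abc in simp)
      then show False using vsubD(4)[OF A vsub_diff[OF A ab(2,1)]] v(2) by metis
    qed
    moreover have "a = b"
    proof (rule eq_vecI)
      fix i assume "i < dim_vec b"
      then show "a $ i = b $ i" using eqi[of i] cd abc by simp
    qed (use abc in simp)
    ultimately show "a = b \<and> c = d" by simp
  qed
  moreover have "adjoin A v = (\<lambda>(a, c). a + c \<cdot>\<^sub>v v) ` (A \<times> UNIV)"
    by (auto simp: adjoin_def)
  ultimately show ?thesis by (simp add: card_image card_cartesian_product q_eq)
qed

text \<open>The adjoined subspace lies in \<open>W\<close> and has equally many elements, so any
  vector of \<open>W\<close> outside \<open>A\<close> serves as generator over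
  \<open>A\<close>.\<close>

lemma eq_adjoin:
  assumes "vsub A" "vsub W" "A \<subseteq> W" "v \<in> W" "v \<notin> A" "card W = card A * q"
  shows "W = adjoin A v"
proof -
  have "v \<in> carrier_vec n" using assms vsubD(1) by blast
  then show ?thesis
    using card_subset_eq[OF vsubD(5)[OF assms(2)] adjoin_least[OF assms(2-4)]] card_adjoin[OF assms(1) _ assms(5)] assms(6)
    by simp
qed

abbreviation ssum :: "'f vec set \<Rightarrow> 'f vec set \<Rightarrow> 'f vec set" where
  "ssum A B \<equiv> A <+>\<^bsub>module_vec TYPE('f) n\<^esub> B"

lemma ssum_eq: "ssum A B = {a + b | a b. a \<in> A \<and> b \<in> B}"
  by (auto simp: set_add_def' module_vec_simps)

lemma ssum_assoc:
  assumes "A \<subseteq> carrier_vec n" "B \<subseteq> carrier_vec n" "C \<subseteq> carrier_vec n"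
  shows "ssum (ssum A B) C = ssum A (ssum B C)"
proof -
  have as: "(a + b) + c = a + (b + c)" if "a \<in> A" "b \<in> B" "c \<in> C" for a b c
    using that assms assoc_add_vec[of a n b c] by blast
  show ?thesis
  proof (intro equalityI subsetI)
    fix x assume "x \<in> ssum (ssum A B) C"
    then obtain a b c where "a \<in> A" "b \<in> B" "c \<in> C" "x = (a + b) + c" unfolding ssum_eq by blast
    then show "x \<in> ssum A (ssum B C)" using as unfolding ssum_eq by blast
  next
    fix x assume "x \<in> ssum A (ssum B C)"
    then obtain a b c where "a \<in> A" "b \<in> B" "c \<in> C" "x = a + (b + c)" unfolding ssum_eq by blast
    then show "x \<in> ssum (ssum A B) C" using as[symmetric] unfolding ssum_eq by blast
  qed
qed

lemma ssum_zero: "A \<subseteq> carrier_vec n \<Longrightarrow> ssum A {0\<^sub>v n} = A" "A \<subseteq> carrier_vec n \<Longrightarrow> ssum {0\<^sub>v n} A = A"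
  unfolding ssum_eq by force+

lemma ssum_adjoin:
  assumes "vsub A" "vsub B" "v \<in> carrier_vec n"
  shows "ssum A (adjoin B v) = adjoin (ssum A B) v"
proof -
  let ?L = "{c \<cdot>\<^sub>v v | c. True}"
  have eq: "adjoin C v = ssum C ?L" for C by (auto simp: ssum_eq adjoin_def)
  have "?L \<subseteq> carrier_vec n" using assms(3) by auto
  from ssum_assoc[OF vsubD(1)[OF assms(1)] vsubD(1)[OF assms(2)] this]
  show ?thesis unfolding eq by (rule sym)
qed

text \<open>The nonzero vectors of \<open>W\<close> are partitioned by the lines they span, with
  \<open>q - 1\<close> vectors on each line; there are \<open>q ^ d - 1\<close> of them in
  all.\<close>

lemma card_lines:
  assumes W: "vsub W" "card W = q ^ d"
  shows "card {L. vec_subspace TYPE('f) n 1 L \<and> L \<subseteq> W} = q_int q d"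
proof -
  let ?L = "{L. vec_subspace TYPE('f) n 1 L \<and> L \<subseteq> W}"
  have L: "vsub L" "card L = q" "L \<subseteq> W" if "L \<in> ?L" for L using that by (auto simp: vec_subspace_iff)
  have line: "L = adjoin {0\<^sub>v n} v" if "L \<in> ?L" "v \<in> L" "v \<noteq> 0\<^sub>v n" for L v
    using eq_adjoin[OF vsub_zero L(1)[OF that(1)], of v] that L[OF that(1)] vsubD(2)[OF L(1)[OF that(1)]] by auto
  have fin: "finite ?L"
    by (rule finite_subset[of _ "Pow W"]) (use vsubD(5)[OF W(1)] in auto)
  have "W - {0\<^sub>v n} = (\<Union>L\<in>?L. L - {0\<^sub>v n})"
  proof (intro equalityI subsetI)
    fix v assume v: "v \<in> W - {0\<^sub>v n}"
    then have vc: "v \<in> carrier_vec n" using vsubD(1)[OF W(1)] by blast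
    have "adjoin {0\<^sub>v n} v \<in> ?L"
      using adjoin_vsub[OF vsub_zero vc] card_adjoin[OF vsub_zero vc] v adjoin_least[OF W(1), of "{0\<^sub>v n}" v] vsubD(2)[OF W(1)]
      by (simp add: vec_subspace_iff)
    then show "v \<in> (\<Union>L\<in>?L. L - {0\<^sub>v n})" using adjoin_mem(1)[OF vsub_zero vc] v by blast
  next
    fix v assume "v \<in> (\<Union>L\<in>?L. L - {0\<^sub>v n})"
    then show "v \<in> W - {0\<^sub>v n}" by blast
  qed
  then have "card (W - {0\<^sub>v n}) = (\<Sum>L\<in>?L. card (L - {0\<^sub>v n}))"
  proof (simp only:, intro card_UN_disjoint ballI impI fin)
    fix L assume "L \<in> ?L"
    then show "finite (L - {0\<^sub>v n})" using L vsubD(5) by blast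
    fix L' assume "L' \<in> ?L" "L \<noteq> L'"
    then show "(L - {0\<^sub>v n}) \<inter> (L' - {0\<^sub>v n}) = {}" using line[OF \<open>L \<in> ?L\<close>] line[of L'] by blast
  qed
  also have "\<dots> = (\<Sum>L\<in>?L. q - 1)"
  proof (rule sum.cong[OF refl])
    fix L assume "L \<in> ?L"
    then show "card (L - {0\<^sub>v n}) = q - 1" using L[of L] vsubD(2,5)[of L] by (simp add: card_Diff_singleton)
  qed
  finally have "card ?L * (q - 1) = q ^ d - 1"
    using W vsubD(2,5)[OF W(1)] by (simp add: card_Diff_singleton)
  also have "q ^ d - 1 = q_int q d * (q - 1)"
  proof -
    \<comment> \<open>Writing \<open>p = q - 1\<close> turns the geometric sum into an identity
      without subtraction of natural numbers.\<close>
    have "q_int (Suc p) d * p + 1 = Suc p ^ d" for p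
      by (induction d) (auto simp: q_int_def algebra_simps)
    from this[of "q - 1"] show ?thesis using q_ge_2 by simp
  qed
  finally show ?thesis using q_ge_2 by simp
qed

end

section \<open>Flags\<close>

context finite_field_flags
begin

definition flag :: "'f vec set list \<Rightarrow> bool" where
  "flag A \<longleftrightarrow> (\<forall>i<length A. vsub (A ! i) \<and> card (A ! i) = q ^ Suc i) \<and>
    (\<forall>i. Suc i < length A \<longrightarrow> A ! i \<subset> A ! Suc i)"

definition top :: "'f vec set list \<Rightarrow> 'f vec set" where
  "top A = last ({0\<^sub>v n} # A)"

definition flag_mult :: "'f vec set list \<Rightarrow> 'f vec set list \<Rightarrow> 'f vec set list" where
  "flag_mult A B = dedup (A @ map (ssum (top A)) B)"

lemma flag_monoid_simps:
  "carrier (flag_monoid TYPE('f) n) = Collect flag"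
  "mult (flag_monoid TYPE('f) n) = flag_mult"
  "one (flag_monoid TYPE('f) n) = []"
  by (simp_all add: flag_monoid_def flag_def vec_subspace_iff flag_mult_def top_def fun_eq_iff set_eq_iff)

lemma top_Nil [simp]: "top [] = {0\<^sub>v n}"
  by (simp add: top_def)

lemma top_snoc [simp]: "top (A @ [U]) = U"
  by (simp add: top_def)

lemma flag_Nil [simp]: "flag []"
  by (simp add: flag_def)

text \<open>The convention \<open>top [] = {0}\<close> makes the criterion uniform: for empty
  \<open>A\<close> the strict inclusion follows from \<open>card U = q\<close> and
  \<open>q \<ge> 2\<close>.\<close>

lemma flag_snoc: "flag (A @ [U]) \<longleftrightarrow> flag A \<and> vsub U \<and> card U = q ^ Suc (length A) \<and> top A \<subset> U"
proof (cases A rule: rev_cases)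
  case Nil
  have "{0\<^sub>v n} \<subset> U" if "vsub U" "card U = q"
  proof -
    have "U \<noteq> {0\<^sub>v n}" using that q_ge_2 by auto
    then show ?thesis using vsubD(2)[OF that(1)] by blast
  qed
  then show ?thesis by (auto simp: Nil flag_def)
next
  case (snoc B W)
  show ?thesis
    unfolding snoc flag_def
    by (auto simp: nth_append less_Suc_eq all_conj_distrib)
qed

lemma flag_top: "flag A \<Longrightarrow> vsub (top A)" "flag A \<Longrightarrow> card (top A) = q ^ length A"
  by (cases A rule: rev_cases; simp add: flag_snoc vsub_zero)+

lemma flag_snoc_adjoin:
  assumes "flag A" "v \<in> carrier_vec n" "v \<notin> top A"
  shows "flag (A @ [adjoin (top A) v])"
  using assms flag_top[OF assms(1)] adjoin_mem[of "top A" v] adjoin_vsub[of "top A" v] card_adjoin[of "top A" v]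
  by (auto simp: flag_snoc)

text \<open>Consecutive cardinalities differ by the factor \<open>q\<close>, so any vector of
  \<open>U\<close> outside \<open>top A\<close> generates \<open>U\<close> over it. Flags can thus
  be built vector by vector, as in \<open>flag_induct\<close>.\<close>

lemma flag_snocE:
  assumes "flag (A @ [U])"
  obtains v where "flag A" "v \<in> carrier_vec n" "v \<notin> top A" "U = adjoin (top A) v"
proof -
  have A: "flag A" and U: "vsub U" "card U = q ^ Suc (length A)" "top A \<subset> U" using assms by (auto simp: flag_snoc)
  obtain v where v: "v \<in> U" "v \<notin> top A" using U(3) by blast
  have "v \<in> carrier_vec n" using v(1) vsubD(1)[OF U(1)] by blast
  moreover have "U = adjoin (top A) v"
    using U v flag_top[OF A] by (intro eq_adjoin) auto
  ultimately show ?thesis using that A v by blast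
qed

lemma flag_induct [consumes 1, case_names Nil snoc]:
  assumes "flag A" and "P []"
    and "\<And>A v. \<lbrakk>flag A; v \<in> carrier_vec n; v \<notin> top A; P A\<rbrakk> \<Longrightarrow> P (A @ [adjoin (top A) v])"
  shows "P A"
  using assms(1)
proof (induction A rule: rev_induct)
  case Nil
  then show ?case using assms(2) by simp
next
  case (snoc U A)
  from snoc.prems obtain v where "flag A" "v \<in> carrier_vec n" "v \<notin> top A" "U = adjoin (top A) v"
    by (rule flag_snocE)
  then show ?case using snoc.IH assms(3) by simp
qed

lemma flag_member_subset: "flag A \<Longrightarrow> U \<in> set A \<Longrightarrow> U \<subseteq> top A"
proof (induction A arbitrary: U rule: flag_induct)
  case (snoc A v)
  then show ?case using adjoin_mem(2)[OF flag_top(1)[OF snoc(1)] snoc(2)] by auto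
qed simp

lemma flag_member_vsub: "flag A \<Longrightarrow> U \<in> set A \<Longrightarrow> vsub U"
  by (auto simp: flag_def in_set_conv_nth)

lemma flag_distinct: "flag A \<Longrightarrow> distinct A"
proof (induction A rule: flag_induct)
  case (snoc A v)
  have "adjoin (top A) v \<notin> set A"
    using flag_member_subset[OF snoc(1)] adjoin_mem(1)[OF flag_top(1)[OF snoc(1)] snoc(2)] snoc(3) by blast
  then show ?case using snoc by simp
qed simp

lemma flag_length_le: "flag A \<Longrightarrow> length A \<le> n"
proof -
  assume A: "flag A"
  have "q ^ length A \<le> q ^ n"
    using card_mono[OF finite_carrier_vec vsubD(1)[OF flag_top(1)[OF A]]] flag_top(2)[OF A] card_carrier_vec by simp
  then show ?thesis using q_ge_2 by simp
qed

section \<open>The product of flags\<close>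

lemma flag_mult_Nil: "flag A \<Longrightarrow> flag_mult A [] = A"
  by (simp add: flag_mult_def dedup_distinct flag_distinct)

lemma Nil_flag_mult: "flag A \<Longrightarrow> flag_mult [] A = A"
proof -
  assume A: "flag A"
  have "map (ssum {0\<^sub>v n}) A = A"
    using flag_member_vsub[OF A] vsubD(1) by (intro map_idI ssum_zero(2)) blast
  then show ?thesis using flag_distinct[OF A] by (simp add: flag_mult_def dedup_distinct)
qed

text \<open>The new entry of the product is its top subspace with \<open>v\<close> adjoined. If
  \<open>v\<close> already lies in the top, this repeats the top and is deleted; otherwise it is
  new, because all earlier entries lie in the top and hence miss \<open>v\<close>.\<close>

lemma flag_mult_snoc_aux:
  assumes A: "flag A" and B: "flag B" and P: "flag (flag_mult A B)" "top (flag_mult A B) = ssum (top A) (top B)"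
    and v: "v \<in> carrier_vec n" "v \<notin> top B"
  shows "flag_mult A (B @ [adjoin (top B) v]) =
    (if v \<in> top (flag_mult A B) then flag_mult A B else flag_mult A B @ [adjoin (top (flag_mult A B)) v])"
proof -
  let ?P = "flag_mult A B"
  have set: "set (A @ map (ssum (top A)) B) = set ?P" by (simp add: flag_mult_def)
  have "ssum (top A) (adjoin (top B) v) = adjoin (top ?P) v"
    unfolding P(2) by (rule ssum_adjoin) (use flag_top A B v in auto)
  then have eq: "flag_mult A (B @ [adjoin (top B) v]) = (if adjoin (top ?P) v \<in> set ?P then ?P else ?P @ [adjoin (top ?P) v])"
    unfolding set[symmetric] by (simp add: flag_mult_def dedup_snoc flip: append_assoc)
  show ?thesis
  proof (cases "v \<in> top ?P")
    case True
    \<comment> \<open>This excludes an empty product, so that \<open>top ?P\<close> is a genuine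
      entry and not the default zero subspace.\<close>
    have "v \<noteq> 0\<^sub>v n" using v(2) vsubD(2)[OF flag_top(1)[OF B]] by auto
    then have "?P \<noteq> []" using True by auto
    then have "top ?P \<in> set ?P" by (simp add: top_def)
    then show ?thesis using eq adjoin_absorb[OF flag_top(1)[OF P(1)] True] True by simp
  next
    case False
    then have "adjoin (top ?P) v \<notin> set ?P"
      using flag_member_subset[OF P(1)] adjoin_mem(1)[OF flag_top(1)[OF P(1)] v(1)] by blast
    then show ?thesis using eq False by simp
  qed
qed

text \<open>The formula for the top is carried through the induction because
  \<open>flag_mult_snoc_aux\<close> needs it for the next step.\<close>

lemma flag_mult_flag:
  assumes A: "flag A" and B: "flag B"
  shows "flag (flag_mult A B) \<and> top (flag_mult A B) = ssum (top A) (top B)"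
  using B
proof (induction B rule: flag_induct)
  case Nil
  then show ?case using A flag_mult_Nil[OF A] ssum_zero(1)[OF vsubD(1)[OF flag_top(1)[OF A]]] by simp
next
  case (snoc B v)
  let ?P = "flag_mult A B"
  have P: "flag ?P" "top ?P = ssum (top A) (top B)" using snoc by auto
  have "ssum (top A) (adjoin (top B) v) = adjoin (top ?P) v"
    unfolding P(2) by (rule ssum_adjoin) (use flag_top A snoc in auto)
  then show ?case
    using flag_mult_snoc_aux[OF A snoc(1) P snoc(2,3)] P flag_snoc_adjoin[OF P(1) snoc(2)]
      adjoin_absorb[OF flag_top(1)[OF P(1)]]
    by (cases "v \<in> top ?P") simp_all
qed

text \<open>Both sides reduce to one deletion applied to \<open>A\<close>, the translates of
  \<open>B\<close> by \<open>top A\<close>, and the translates of \<open>C\<close> by the sum of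
  \<open>top A\<close> and \<open>top B\<close>.\<close>

lemma flag_mult_assoc:
  assumes A: "flag A" and B: "flag B" and C: "flag C"
  shows "flag_mult (flag_mult A B) C = flag_mult A (flag_mult B C)"
proof -
  have c: "U \<subseteq> carrier_vec n" if "flag A'" "U = top A' \<or> U \<in> set A'" for A' U
    using that flag_top(1)[of A'] flag_member_vsub[of A' U] vsubD(1) by blast
  have "flag_mult A (flag_mult B C) = dedup (A @ map (ssum (top A)) B @ map (ssum (top A) \<circ> ssum (top B)) C)"
    by (simp add: flag_mult_def dedup_append_map)
  also have "map (ssum (top A) \<circ> ssum (top B)) C = map (ssum (top (flag_mult A B))) C"
    using flag_mult_flag[OF A B] c[OF A] c[OF B] c[OF C] by (auto simp: ssum_assoc)
  also have "dedup (A @ map (ssum (top A)) B @ map (ssum (top (flag_mult A B))) C) = flag_mult (flag_mult A B) C"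
    unfolding flag_mult_def[of "flag_mult A B" C]
    by (simp add: flag_mult_def[of A B] dedup_append_left)
  finally show ?thesis ..
qed

lemma flag_monoid_monoid: "monoid (flag_monoid TYPE('f) n)"
  by (rule monoidI)
    (auto simp: flag_monoid_simps flag_mult_flag flag_mult_assoc flag_mult_Nil Nil_flag_mult)

lemma flag_monoid_finite: "finite (Collect flag)"
proof (rule finite_subset)
  show "Collect flag \<subseteq> {A. set A \<subseteq> Pow (carrier_vec n) \<and> length A \<le> n}"
    using flag_length_le flag_member_vsub vsubD(1) by blast
qed (intro finite_lists_length_le, simp)

section \<open>Lines as letters, and factorizations of flags\<close>

lemma letter_flag_iff: "flag A \<and> length A = 1 \<longleftrightarrow> (\<exists>L. vec_subspace TYPE('f) n 1 L \<and> A = [L])"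
  by (auto simp: flag_def vec_subspace_iff length_Suc_conv)

text \<open>With \<open>L\<close> spanned by \<open>v\<close>, this is
  \<open>flag_mult_snoc_aux\<close> for the empty flag: \<open>L\<close> lies in the top exactly
  when \<open>v\<close> does. For the second part, \<open>U\<close> is only one dimension larger
  than \<open>top A\<close>, so any line of \<open>U\<close> outside \<open>top A\<close> fills it
  up.\<close>

lemma flag_mult_letter:
  assumes A: "flag A" and L: "vec_subspace TYPE('f) n 1 L"
  shows "flag_mult A [L] = (if L \<subseteq> top A then A else A @ [ssum (top A) L])"
    and "\<not> L \<subseteq> top A \<Longrightarrow> L \<subseteq> U \<Longrightarrow> flag (A @ [U]) \<Longrightarrow> ssum (top A) L = U"
proof -
  have fL: "flag ([] @ [L])" using L letter_flag_iff by auto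
  then obtain v where v: "v \<in> carrier_vec n" "v \<notin> top []" "L = adjoin (top []) v" by (rule flag_snocE)
  have A': "flag (flag_mult A [])" "flag_mult A [] = A" using A flag_mult_Nil by simp_all
  have z: "ssum (top A) (top []) = top A" using ssum_zero(1) vsubD(1)[OF flag_top(1)[OF A]] by simp
  have eq: "flag_mult A [L] = (if v \<in> top A then A else A @ [adjoin (top A) v])"
    using flag_mult_snoc_aux[OF A flag_Nil _ _ v(1,2)] A' z v(3) by simp
  have sum: "ssum (top A) L = adjoin (top A) v"
    unfolding v(3) using ssum_adjoin[OF flag_top(1)[OF A] vsub_zero v(1)] z by simp
  have vL: "v \<in> L" using v adjoin_mem(1)[OF vsub_zero v(1)] by simp
  have iff: "L \<subseteq> top A \<longleftrightarrow> v \<in> top A"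
    using vL v(3) adjoin_least[OF flag_top(1)[OF A], of "{0\<^sub>v n}" v] vsubD(2)[OF flag_top(1)[OF A]] by auto
  show "flag_mult A [L] = (if L \<subseteq> top A then A else A @ [ssum (top A) L])"
    using eq sum iff by simp
  show "ssum (top A) L = U" if "\<not> L \<subseteq> top A" "L \<subseteq> U" "flag (A @ [U])"
  proof -
    have "vsub U" "card U = card (top A) * q" "top A \<subseteq> U"
      using that(3) flag_top(2)[OF A] by (auto simp: flag_snoc)
    then show ?thesis using eq_adjoin[OF flag_top(1)[OF A], of U v] that vL iff sum by auto
  qed
qed

text \<open>While \<open>length A < n\<close>, the top has fewer than \<open>q ^ n\<close> vectors,
  so one can be adjoined. This supplies flags of every length and reduces transitivity to complete
  flags.\<close>

lemma flag_extend:
  assumes "flag A"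
  shows "\<exists>B. flag B \<and> length B = n \<and> take (length A) B = A"
  using assms
proof (induction "n - length A" arbitrary: A)
  case 0
  then show ?case using flag_length_le[of A] by (intro exI[of _ A]) auto
next
  case (Suc d)
  have "card (top A) < card (carrier_vec n :: 'f vec set)"
    using flag_top(2)[OF Suc.prems] card_carrier_vec Suc.hyps(2) q_ge_2 by simp
  then have "\<not> carrier_vec n \<subseteq> top A"
    using card_mono[OF vsubD(5)[OF flag_top(1)[OF Suc.prems]]] by (meson not_le)
  then obtain v where v: "v \<in> carrier_vec n" "v \<notin> top A" by blast
  let ?A = "A @ [adjoin (top A) v]"
  have "d = n - length ?A" using Suc.hyps(2) by simp
  from Suc.hyps(1)[OF this flag_snoc_adjoin[OF Suc.prems v]]
  obtain B where B: "flag B" "length B = n" "take (length ?A) B = ?A" by blast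
  have "take (length A) B = take (length A) (take (length ?A) B)" by (simp add: min_def)
  also have "\<dots> = A" unfolding B(3) by simp
  finally show ?case using B by blast
qed

lemma flag_take: "flag A \<Longrightarrow> flag (take k A)"
  by (auto simp: flag_def)

lemma flag_ex_length: "k \<le> n \<Longrightarrow> \<exists>A. flag A \<and> length A = k"
  using flag_extend[OF flag_Nil] flag_take by (metis length_take min.absorb2)

text \<open>Both counts reduce to \<open>card_lines\<close>. In a factorization of
  \<open>C @ [U]\<close>, comparing all entries but the last forces the left factor to be
  \<open>C\<close>, so only the line varies.\<close>

lemma flag_level_monoid: "level_monoid (flag_monoid TYPE('f) n) length n q"
proof (intro level_monoid.intro level_monoid_axioms.intro flag_monoid_monoid; (simp only: flag_monoid_simps mem_Collect_eq)?)
  show "finite (Collect flag)" by (rule flag_monoid_finite)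
  show "0 < q" using q_ge_2 by simp
  show "length A \<le> n" if "flag A" for A using flag_length_le[OF that] .
  show "\<exists>A\<in>Collect flag. length A = k" if "k \<le> n" for k using flag_ex_length[OF that] by blast
  show "length A = 0 \<longleftrightarrow> A = []" for A :: "'f vec set list" by simp
  show "length (flag_mult A l) = Suc (length A)"
    if "flag A" "flag l" "length l = 1" "flag_mult A l \<noteq> A" for A l
    using that letter_flag_iff[of l] flag_mult_letter(1)[OF that(1)] by (auto split: if_splits)
  have lines_upto: "card {l. (flag l \<and> length l = 1) \<and> Q l} = card {L. vec_subspace TYPE('f) n 1 L \<and> Q [L]}" for Q
  proof -
    have "{l. (flag l \<and> length l = 1) \<and> Q l} = (\<lambda>L. [L]) ` {L. vec_subspace TYPE('f) n 1 L \<and> Q [L]}"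
      unfolding letter_flag_iff by auto
    then show ?thesis by (simp add: card_image inj_on_def)
  qed
  show "card {l. flag l \<and> length l = 1 \<and> flag_mult A l = A} = q_int q (length A)" if A: "flag A" for A
  proof -
    have "card {l. flag l \<and> length l = 1 \<and> flag_mult A l = A} =
        card {L. vec_subspace TYPE('f) n 1 L \<and> flag_mult A [L] = A}"
      using lines_upto[of "\<lambda>l. flag_mult A l = A"] by (simp add: conj_assoc)
    also have "{L. vec_subspace TYPE('f) n 1 L \<and> flag_mult A [L] = A} = {L. vec_subspace TYPE('f) n 1 L \<and> L \<subseteq> top A}"
      using flag_mult_letter(1)[OF A] by (auto split: if_splits)
    finally show ?thesis using card_lines[OF flag_top[OF A]] by simp
  qed
  show "card {(A, l) \<in> Collect flag \<times> Collect flag. length A = k \<and> length l = 1 \<and> flag_mult A l = B} = q ^ k"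
    if B: "flag B" "length B = Suc k" for B k
  proof -
    obtain C U where BC: "B = C @ [U]" "length C = k" using B(2) by (metis length_Suc_conv_rev)
    have C: "flag C" and U: "vsub U" "card U = q ^ Suc k" "top C \<subset> U" using B(1) BC by (auto simp: flag_snoc)
    let ?in = "\<lambda>W. {L. vec_subspace TYPE('f) n 1 L \<and> L \<subseteq> W}"
    have "{(A, l) \<in> Collect flag \<times> Collect flag. length A = k \<and> length l = 1 \<and> flag_mult A l = B}
        = (\<lambda>L. (C, [L])) ` (?in U - ?in (top C))"
    proof (intro equalityI subsetI)
      fix p assume "p \<in> {(A, l) \<in> Collect flag \<times> Collect flag. length A = k \<and> length l = 1 \<and> flag_mult A l = B}"
      then obtain A l where Al: "p = (A, l)" "flag A" "length A = k" "flag l" "length l = 1" "flag_mult A l = B"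
        by auto
      obtain L where "vec_subspace TYPE('f) n 1 L" "l = [L]" using letter_flag_iff[of l] Al(4,5) by auto
      with Al have p: "p = (A, [L])" "flag A" "length A = k" "vec_subspace TYPE('f) n 1 L" "flag_mult A [L] = B"
        by simp_all
      have nL: "\<not> L \<subseteq> top A" using p(3,5) B(2) flag_mult_letter(1)[OF p(2,4)] by auto
      then have "flag_mult A [L] = A @ [ssum (top A) L]" using flag_mult_letter(1)[OF p(2,4)] by simp
      then have "A @ [ssum (top A) L] = C @ [U]" using p(5) BC(1) by metis
      then have AC: "A = C" "ssum (top A) L = U" by auto
      have "L \<subseteq> ssum (top A) L"
      proof
        fix u assume u: "u \<in> L"
        have "u \<in> carrier_vec n" using u p(4) vsubD(1) by (auto simp: vec_subspace_iff)
        then have "u = 0\<^sub>v n + u" by simp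
        then show "u \<in> ssum (top A) L" using vsubD(2)[OF flag_top(1)[OF p(2)]] u unfolding ssum_eq by blast
      qed
      then show "p \<in> (\<lambda>L. (C, [L])) ` (?in U - ?in (top C))" using p nL AC by blast
    next
      fix p assume "p \<in> (\<lambda>L. (C, [L])) ` (?in U - ?in (top C))"
      then obtain L where L: "p = (C, [L])" "vec_subspace TYPE('f) n 1 L" "L \<subseteq> U" "\<not> L \<subseteq> top C" by blast
      have "flag_mult C [L] = B"
        using flag_mult_letter(1)[OF C L(2)] flag_mult_letter(2)[OF C L(2,4,3)] B(1) BC L(4) by simp
      moreover have "flag [L]" using letter_flag_iff L(2) by blast
      ultimately show "p \<in> {(A, l) \<in> Collect flag \<times> Collect flag. length A = k \<and> length l = 1 \<and> flag_mult A l = B}"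
        using L C BC by simp
    qed
    then have "card {(A, l) \<in> Collect flag \<times> Collect flag. length A = k \<and> length l = 1 \<and> flag_mult A l = B}
        = card (?in U - ?in (top C))"
      by (simp add: card_image inj_on_def)
    also have "\<dots> = card (?in U) - card (?in (top C))"
    proof (rule card_Diff_subset)
      show "finite (?in (top C))"
        by (rule finite_subset[of _ "Pow (top C)"]) (use vsubD(5)[OF flag_top(1)[OF C]] in auto)
      show "?in (top C) \<subseteq> ?in U" using U(3) by blast
    qed
    also have "\<dots> = q_int q (Suc k) - q_int q k"
      using card_lines[OF U(1,2)] card_lines[OF flag_top[OF C]] BC(2) by simp
    finally show ?thesis by (simp add: q_int_Suc)
  qed
qed

section \<open>The general linear group acting on flags\<close>

lemma finite_carrier_mat: "finite (carrier_mat n n :: 'f mat set)"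
proof (rule finite_subset)
  show "(carrier_mat n n :: 'f mat set) \<subseteq> mat n n ` (({..<n} \<times> {..<n}) \<rightarrow>\<^sub>E UNIV)"
  proof
    fix A :: "'f mat" assume "A \<in> carrier_mat n n"
    then have "A = mat n n (restrict (\<lambda>ij. A $$ ij) ({..<n} \<times> {..<n}))" by auto
    moreover have "restrict (\<lambda>ij. A $$ ij) ({..<n} \<times> {..<n}) \<in> ({..<n} \<times> {..<n}) \<rightarrow>\<^sub>E UNIV" by simp
    ultimately show "A \<in> mat n n ` (({..<n} \<times> {..<n}) \<rightarrow>\<^sub>E UNIV)" by (rule image_eqI)
  qed
qed (intro finite_imageI finite_PiE, auto)

lemma GL_simps:
  "carrier (general_linear_group TYPE('f) n) = Units (ring_mat TYPE('f) n ())"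
  "mult (general_linear_group TYPE('f) n) = (*)"
  "one (general_linear_group TYPE('f) n) = 1\<^sub>m n"
  by (simp_all add: general_linear_group_def units_of_def ring_mat_simps)

lemma GL_group: "group (general_linear_group TYPE('f) n)"
  unfolding general_linear_group_def
  by (rule monoid.units_group, rule ring.is_monoid, rule ring_mat)

lemma GLD:
  assumes "g \<in> Units (ring_mat TYPE('f) n ())"
  shows "g \<in> carrier_mat n n"
    and "\<exists>h\<in>Units (ring_mat TYPE('f) n ()). h * g = 1\<^sub>m n \<and> g * h = 1\<^sub>m n"
  using assms by (auto simp: Units_def ring_mat_simps)

lemma GL_inj: "g \<in> Units (ring_mat TYPE('f) n ()) \<Longrightarrow> inj_on ((*\<^sub>v) g) (carrier_vec n)"
proof (rule inj_onI)
  fix v w :: "'f vec"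
  assume g: "g \<in> Units (ring_mat TYPE('f) n ())" and vw: "v \<in> carrier_vec n" "w \<in> carrier_vec n" "g *\<^sub>v v = g *\<^sub>v w"
  obtain h where h: "h \<in> carrier_mat n n" "h * g = 1\<^sub>m n" using GLD(2)[OF g] GLD(1) by blast
  have "v = (h * g) *\<^sub>v v" "w = (h * g) *\<^sub>v w" using vw h by auto
  then show "v = w" using assoc_mult_mat_vec[OF h(1) GLD(1)[OF g]] vw by metis
qed

lemma image_vsub:
  assumes g: "(g :: 'f mat) \<in> carrier_mat n n" and W: "vsub W"
  shows "vsub ((*\<^sub>v) g ` W)"
  unfolding vsub_def
proof (intro conjI ballI allI)
  have c: "w \<in> carrier_vec n" if "w \<in> W" for w using that vsubD(1)[OF W] by blast
  show "(*\<^sub>v) g ` W \<subseteq> carrier_vec n" using g c by auto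
  have "g *\<^sub>v 0\<^sub>v n = 0\<^sub>v n" using g by auto
  then show "0\<^sub>v n \<in> (*\<^sub>v) g ` W" using vsubD(2)[OF W] by (metis imageI)
  fix x assume "x \<in> (*\<^sub>v) g ` W"
  then obtain v where v: "v \<in> W" "x = g *\<^sub>v v" by blast
  show "d \<cdot>\<^sub>v x \<in> (*\<^sub>v) g ` W" for d
    using mult_mat_vec[OF g c[OF v(1)], of d] vsubD(4)[OF W v(1), of d] v(2) by (metis imageI)
  fix y assume "y \<in> (*\<^sub>v) g ` W"
  then obtain w where w: "w \<in> W" "y = g *\<^sub>v w" by blast
  show "x + y \<in> (*\<^sub>v) g ` W"
    using mult_add_distrib_mat_vec[OF g c[OF v(1)] c[OF w(1)]] vsubD(3)[OF W v(1) w(1)] v(2) w(2) by (metis imageI)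
qed

lemma flag_action_flag:
  assumes g: "g \<in> Units (ring_mat TYPE('f) n ())" and A: "flag A"
  shows "flag (flag_action g A)"
proof -
  have sub: "A ! i \<subseteq> carrier_vec n" if "i < length A" for i
    using A that vsubD(1) by (auto simp: flag_def)
  have "card ((*\<^sub>v) g ` A ! i) = card (A ! i)" if "i < length A" for i
    using inj_on_subset[OF GL_inj[OF g] sub[OF that]] by (rule card_image)
  moreover have "(*\<^sub>v) g ` A ! i \<subset> (*\<^sub>v) g ` A ! Suc i" if "Suc i < length A" for i
    using image_strict_mono[OF inj_on_subset[OF GL_inj[OF g] sub[OF that]], of "A ! i"] A that
    by (simp add: flag_def)
  ultimately show ?thesis
    using A image_vsub[OF GLD(1)[OF g]] by (auto simp: flag_def flag_action_def)
qed

text \<open>The span of the first \<open>i\<close> unit vectors, described by vanishing coordinates.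
  These subspaces form the standard flag.\<close>

definition std_subspace :: "nat \<Rightarrow> 'f vec set" where
  "std_subspace i = {v \<in> carrier_vec n. \<forall>j<n. i \<le> j \<longrightarrow> v $ j = 0}"

lemma std_subspace_0: "std_subspace 0 = {0\<^sub>v n}"
  by (auto simp: std_subspace_def)

lemma std_subspace_n: "std_subspace n = carrier_vec n"
  by (auto simp: std_subspace_def)

lemma std_subspace_Suc:
  assumes i: "i < n"
  shows "std_subspace (Suc i) = adjoin (std_subspace i) (unit_vec n i)"
proof (intro equalityI subsetI)
  fix v assume v: "v \<in> std_subspace (Suc i)"
  let ?w = "vec n (\<lambda>j. if j = i then 0 else v $ j)"
  have "v = ?w + v $ i \<cdot>\<^sub>v unit_vec n i"
    using v i by (intro eq_vecI) (auto simp: std_subspace_def)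
  moreover have "?w \<in> std_subspace i" using v by (auto simp: std_subspace_def)
  ultimately show "v \<in> adjoin (std_subspace i) (unit_vec n i)" unfolding adjoin_def by blast
qed (use i in \<open>auto simp: std_subspace_def adjoin_def\<close>)

lemma image_adjoin:
  assumes g: "(g :: 'f mat) \<in> carrier_mat n n" and A: "A \<subseteq> carrier_vec n" and v: "v \<in> carrier_vec n"
  shows "(*\<^sub>v) g ` adjoin A v = adjoin ((*\<^sub>v) g ` A) (g *\<^sub>v v)"
proof -
  have eq: "g *\<^sub>v (a + c \<cdot>\<^sub>v v) = g *\<^sub>v a + c \<cdot>\<^sub>v (g *\<^sub>v v)" if "a \<in> A" for a c
    using mult_add_distrib_mat_vec[OF g, of a "c \<cdot>\<^sub>v v"] mult_mat_vec[OF g v] A that v by auto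
  have adj: "adjoin B w = (\<lambda>(b, c). b + c \<cdot>\<^sub>v w) ` (B \<times> UNIV)" for B and w :: "'f vec"
    by (auto simp: adjoin_def)
  have "(*\<^sub>v) g ` adjoin A v = (\<lambda>(a, c). g *\<^sub>v a + c \<cdot>\<^sub>v (g *\<^sub>v v)) ` (A \<times> UNIV)"
    unfolding adj image_image by (rule image_cong) (auto simp: eq)
  also have "\<dots> = adjoin ((*\<^sub>v) g ` A) (g *\<^sub>v v)"
    unfolding adjoin_def by auto
  finally show ?thesis .
qed

text \<open>Each step of the flag adjoins some \<open>v i\<close>, and the matrix with these columns
  carries the standard flag to \<open>A\<close>. As \<open>top A\<close> is the full space, the
  matrix is surjective, hence injective by finiteness, hence of nonzero determinant.\<close>

lemma complete_flag_matrix: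
  assumes A: "flag A" "length A = n"
  shows "\<exists>g\<in>Units (ring_mat TYPE('f) n ()). \<forall>i\<le>n. (*\<^sub>v) g ` std_subspace i = top (take i A)"
proof -
  have "\<exists>v. v \<in> carrier_vec n \<and> A ! i = adjoin (top (take i A)) v" if i: "i < n" for i
  proof -
    have "flag (take i A @ [A ! i])"
      using flag_take[OF A(1), of "Suc i"] i A(2) by (simp add: take_Suc_conv_app_nth)
    then show ?thesis by (rule flag_snocE) blast
  qed
  then obtain v where v: "\<And>i. i < n \<Longrightarrow> v i \<in> carrier_vec n" "\<And>i. i < n \<Longrightarrow> A ! i = adjoin (top (take i A)) (v i)"
    by metis
  define g where "g = mat_of_cols n (map v [0..<n])"
  have g: "g \<in> carrier_mat n n" by (simp add: g_def carrier_matI)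
  have col: "g *\<^sub>v unit_vec n i = v i" if i: "i < n" for i
  proof -
    have "g *\<^sub>v unit_vec n i = col g i"
      using g i by (intro eq_vecI) auto
    also have "\<dots> = v i" unfolding g_def using i v(1) by (subst col_mat_of_cols) auto
    finally show ?thesis .
  qed
  have im: "(*\<^sub>v) g ` std_subspace i = top (take i A)" if "i \<le> n" for i
    using that
  proof (induction i)
    case 0
    then show ?case using g by (auto simp: std_subspace_0)
  next
    case (Suc i)
    then have i: "i < n" by simp
    have "(*\<^sub>v) g ` std_subspace (Suc i) = adjoin (top (take i A)) (v i)"
      using Suc.IH i image_adjoin[OF g, of "std_subspace i" "unit_vec n i"] col[OF i]
      by (simp add: std_subspace_Suc) (auto simp: std_subspace_def)
    also have "\<dots> = top (take (Suc i) A)" using v(2)[OF i] i A(2) by (simp add: take_Suc_conv_app_nth)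
    finally show ?case .
  qed
  have "top A = carrier_vec n"
    using card_subset_eq[OF finite_carrier_vec vsubD(1)[OF flag_top(1)[OF A(1)]]] flag_top(2)[OF A(1)] A(2) card_carrier_vec
    by simp
  then have surj: "(*\<^sub>v) g ` carrier_vec n = carrier_vec n" using im[of n] A(2) by (simp add: std_subspace_n)
  then have inj: "inj_on ((*\<^sub>v) g) (carrier_vec n)" by (intro eq_card_imp_inj_on) simp_all
  have "det g \<noteq> 0"
  proof
    assume "det g = 0"
    then obtain w where w: "w \<in> carrier_vec n" "w \<noteq> 0\<^sub>v n" "g *\<^sub>v w = 0\<^sub>v n"
      using det_0_iff_vec_prod_zero_field[OF g] by blast
    have "g *\<^sub>v w = g *\<^sub>v 0\<^sub>v n" using w(3) g by auto
    then show False using inj_onD[OF inj _ w(1)] w(2) by auto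
  qed
  then have "g \<in> Units (ring_mat TYPE('f) n ())" by (rule det_non_zero_imp_unit[OF g])
  then show ?thesis by (rule bexI[rotated]) (simp add: im)
qed

text \<open>Extend to a complete flag and keep only the first \<open>length A\<close>
  members.\<close>

lemma flag_matrix:
  assumes "flag A"
  shows "\<exists>g\<in>Units (ring_mat TYPE('f) n ()). \<forall>i<length A. (*\<^sub>v) g ` std_subspace (Suc i) = A ! i"
proof -
  obtain B where B: "flag B" "length B = n" "take (length A) B = A" using flag_extend[OF assms] by blast
  obtain g where g: "g \<in> Units (ring_mat TYPE('f) n ())" "\<And>i. i \<le> n \<Longrightarrow> (*\<^sub>v) g ` std_subspace i = top (take i B)"
    using complete_flag_matrix[OF B(1,2)] by blast
  have "(*\<^sub>v) g ` std_subspace (Suc i) = A ! i" if i: "i < length A" for i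
  proof -
    have "length A \<le> n" by (rule flag_length_le[OF assms])
    moreover have "A ! i = B ! i" using B(3) i by (metis nth_take)
    ultimately show ?thesis using g(2)[of "Suc i"] i B(2) by (simp add: take_Suc_conv_app_nth)
  qed
  then show ?thesis using g(1) by blast
qed

lemma flag_action_mult:
  assumes "g \<in> carrier_mat n n" "h \<in> carrier_mat n n" "flag A"
  shows "flag_action (g * h) A = flag_action g (flag_action h A)"
proof -
  have "(*\<^sub>v) (g * h) ` U = (*\<^sub>v) g ` (*\<^sub>v) h ` U" if "U \<in> set A" for U
  proof -
    have "U \<subseteq> carrier_vec n" using flag_member_vsub[OF assms(3) that] vsubD(1) by blast
    then show ?thesis
      unfolding image_image by (intro image_cong refl assoc_mult_mat_vec[OF assms(1,2)]) blast
  qed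
  then show ?thesis by (simp add: flag_action_def)
qed

lemma flag_action_one: "flag A \<Longrightarrow> flag_action (1\<^sub>m n) A = A"
proof -
  assume A: "flag A"
  have "(*\<^sub>v) (1\<^sub>m n) ` U = U" if "U \<in> set A" for U
  proof -
    have "U \<subseteq> carrier_vec n" using flag_member_vsub[OF A that] vsubD(1) by blast
    then show ?thesis by (force simp: image_iff)
  qed
  then show ?thesis by (simp add: flag_action_def map_idI)
qed

text \<open>Move \<open>A\<close> back to the standard flag by the inverse \<open>a'\<close> of
  \<open>a\<close>, then on to \<open>B\<close> by \<open>b\<close>.\<close>

lemma flag_action_transitive:
  assumes A: "flag A" and B: "flag B" and len: "length A = length B"
  shows "\<exists>g\<in>Units (ring_mat TYPE('f) n ()). flag_action g A = B"
proof -
  let ?U = "Units (ring_mat TYPE('f) n ())"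
  interpret ring "ring_mat TYPE('f) n ()" by (rule ring_mat)
  obtain a b where a: "a \<in> ?U" "\<And>i. i < length A \<Longrightarrow> (*\<^sub>v) a ` std_subspace (Suc i) = A ! i"
    and b: "b \<in> ?U" "\<And>i. i < length B \<Longrightarrow> (*\<^sub>v) b ` std_subspace (Suc i) = B ! i"
    using flag_matrix[OF A] flag_matrix[OF B] by metis
  obtain a' where a': "a' \<in> ?U" "a' * a = 1\<^sub>m n" using GLD(2)[OF a(1)] by blast
  note carr = GLD(1)[OF a(1)] GLD(1)[OF b(1)] GLD(1)[OF a'(1)]
  have "flag_action (b * a') A = B"
  proof (rule nth_equalityI)
    show "length (flag_action (b * a') A) = length B" by (simp add: flag_action_def len)
    fix i assume "i < length (flag_action (b * a') A)"
    then have i: "i < length A" "i < length B" by (simp_all add: flag_action_def len)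
    have "(*\<^sub>v) (b * a') ` (*\<^sub>v) a ` std_subspace (Suc i) = (*\<^sub>v) b ` std_subspace (Suc i)"
      unfolding image_image
    proof (rule image_cong[OF refl])
      fix v assume "v \<in> std_subspace (Suc i)"
      then have v: "v \<in> carrier_vec n" by (simp add: std_subspace_def)
      have "(b * a') *\<^sub>v (a *\<^sub>v v) = b *\<^sub>v ((a' * a) *\<^sub>v v)"
        using carr v by (simp add: assoc_mult_mat_vec[of _ n n _ n])
      then show "(b * a') *\<^sub>v (a *\<^sub>v v) = b *\<^sub>v v" using a'(2) v by simp
    qed
    then show "flag_action (b * a') A ! i = B ! i"
      using a(2)[OF i(1)] b(2)[OF i(2)] i by (simp add: flag_action_def)
  qed
  moreover have "b * a' \<in> ?U" using Units_m_closed[OF b(1) a'(1)] by (simp add: ring_mat_simps)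
  ultimately show ?thesis by blast
qed

lemma flag_level_action:
  assumes "cring K" "nat_in K q \<in> Units K"
  shows "level_action K (flag_monoid TYPE('f) n) length n q (general_linear_group TYPE('f) n) flag_action"
proof (intro level_action.intro level_algebra.intro level_algebra_axioms.intro level_action_axioms.intro
    flag_level_monoid GL_group assms; (simp only: flag_monoid_simps GL_simps mem_Collect_eq)?)
  show "finite (Units (ring_mat TYPE('f) n ()))"
    by (rule finite_subset[OF _ finite_carrier_mat]) (use GLD(1) in blast)
  show "flag (flag_action g A)" if "g \<in> Units (ring_mat TYPE('f) n ())" "flag A" for g A
    using flag_action_flag that .
  show "flag_action (1\<^sub>m n) A = A" if "flag A" for A using flag_action_one that .
  show "flag_action (g * h) A = flag_action g (flag_action h A)"
    if "g \<in> Units (ring_mat TYPE('f) n ())" "h \<in> Units (ring_mat TYPE('f) n ())" "flag A" for g h A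
    using flag_action_mult GLD(1) that by blast
  show "length (flag_action g A) = length A" for g :: "'f mat" and A by (simp add: flag_action_def)
  show "\<exists>g\<in>Units (ring_mat TYPE('f) n ()). flag_action g A = B"
    if "flag A" "flag B" "length A = length B" for A B using flag_action_transitive that .
qed

end

section \<open>Words without repetition\<close>

lemma q_int_1: "q_int 1 = (\<lambda>i. i)"
  by (simp add: q_int_def fun_eq_iff)

lemma free_lrb_simps:
  "carrier (free_lrb n) = {a. distinct a \<and> set a \<subseteq> {1..n}}"
  "mult (free_lrb n) = (\<lambda>a b. dedup (a @ b))" "one (free_lrb n) = []"
  by (simp_all add: free_lrb_def)

lemma dedup_append_right: "dedup (xs @ dedup ys) = dedup (xs @ ys)"
  using dedup_append_map[of xs id ys] by simp

lemma word_length_le: "distinct a \<Longrightarrow> set a \<subseteq> {1..n} \<Longrightarrow> length a \<le> n"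
  using card_mono[of "{1..n}" "set a"] by (simp add: distinct_card)

text \<open>With \<open>q = 1\<close> the required counts are \<open>length a\<close> and
  \<open>1\<close>: the absorbed letters are the entries of \<open>a\<close>, and only the last
  letter of \<open>b\<close> can be split off.\<close>

lemma free_lrb_level_monoid: "level_monoid (free_lrb n) length n 1"
proof (intro level_monoid.intro level_monoid_axioms.intro; (simp only: free_lrb_simps mem_Collect_eq)?)
  show "monoid (free_lrb n)"
    by (rule monoidI)
      (auto simp: free_lrb_simps distinct_dedup dedup_distinct dedup_append_left dedup_append_right)
  show "finite {a. distinct a \<and> set a \<subseteq> {1..n}}"
    by (rule finite_subset[OF _ finite_lists_length_le[of "{1..n}" n]]) (auto simp: word_length_le)
  show "length a \<le> n" if "distinct a \<and> set a \<subseteq> {1..n}" for a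
    using word_length_le that by blast
  show "\<exists>a\<in>{a. distinct a \<and> set a \<subseteq> {1..n}}. length a = k" if "k \<le> n" for k
    using that by (intro bexI[of _ "[1..<Suc k]"]) auto
  show "length a = 0 \<longleftrightarrow> a = []" for a :: "nat list" by simp
  show "length (dedup (a @ l)) = Suc (length a)"
    if "distinct a \<and> set a \<subseteq> {1..n}" "length l = 1" "dedup (a @ l) \<noteq> a" for a l
  proof -
    obtain i where l: "l = [i]" using \<open>length l = 1\<close> by (auto simp: length_Suc_conv)
    show ?thesis using that dedup_snoc[of a i] dedup_distinct[of a] by (auto simp: l split: if_splits)
  qed
  show "card {l. (distinct l \<and> set l \<subseteq> {1..n}) \<and> length l = 1 \<and> dedup (a @ l) = a} = q_int 1 (length a)"
    if a: "distinct a \<and> set a \<subseteq> {1..n}" for a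
  proof -
    have "{l. (distinct l \<and> set l \<subseteq> {1..n}) \<and> length l = 1 \<and> dedup (a @ l) = a} = (\<lambda>i. [i]) ` set a"
      using a by (auto simp: length_Suc_conv dedup_snoc dedup_distinct split: if_splits)
    then show ?thesis using a by (simp add: card_image inj_on_def distinct_card q_int_1[unfolded One_nat_def])
  qed
  show "card {(a, l) \<in> {a. distinct a \<and> set a \<subseteq> {1..n}} \<times> {a. distinct a \<and> set a \<subseteq> {1..n}}.
      length a = k \<and> length l = 1 \<and> dedup (a @ l) = b} = 1 ^ k"
    if b: "distinct b \<and> set b \<subseteq> {1..n}" "length b = Suc k" for b k
  proof -
    obtain c i where c: "b = c @ [i]" "length c = k" using b(2) by (metis length_Suc_conv_rev)
    have "{(a, l) \<in> {a. distinct a \<and> set a \<subseteq> {1..n}} \<times> {a. distinct a \<and> set a \<subseteq> {1..n}}.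
      length a = k \<and> length l = 1 \<and> dedup (a @ l) = b} = {(c, [i])}"
      using b c by (auto simp: length_Suc_conv dedup_snoc dedup_distinct split: if_splits)
    then show ?thesis by simp
  qed
qed

text \<open>The map from the entries of \<open>a\<close> to those of \<open>b\<close> is a bijection
  between subsets of \<open>X\<close> of equal size, so their complements in \<open>X\<close> are
  equinumerous as well.\<close>

lemma ex_permutes_map_eq:
  assumes a: "distinct a" "set a \<subseteq> X" and b: "distinct b" "set b \<subseteq> X" and X: "finite X"
    and len: "length a = length b"
  shows "\<exists>p. p permutes X \<and> map p a = b"
proof -
  define f where "f = (\<lambda>x. b ! inv_into {..<length a} ((!) a) x)"
  have na: "bij_betw ((!) a) {..<length a} (set a)" and nb: "bij_betw ((!) b) {..<length a} (set b)"
    using bij_betw_nth[OF a(1) refl refl] bij_betw_nth[OF b(1) refl refl] len by simp_all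
  have f: "bij_betw f (set a) (set b)"
    using bij_betw_trans[OF bij_betw_inv_into[OF na] nb] by (simp add: f_def o_def)
  have fa: "f (a ! i) = b ! i" if "i < length a" for i
    using bij_betw_inv_into_left[OF na] that by (simp add: f_def)
  have "card (X - set a) = card (X - set b)"
    using a b len X by (simp add: card_Diff_subset distinct_card)
  then obtain g where g: "bij_betw g (X - set a) (X - set b)"
    using finite_same_card_bij[of "X - set a" "X - set b"] X by auto
  \<comment> \<open>The prescribed map on \<open>set a\<close>, an arbitrary bijection of the
    complements on the rest of \<open>X\<close>, and the identity outside \<open>X\<close>, as
    \<open>permutes\<close> demands.\<close>
  define p where "p = (\<lambda>x. if x \<in> set a then f x else if x \<in> X then g x else x)"
  have "bij_betw p (set a) (set b)" using f by (rule bij_betw_cong[THEN iffD1, rotated]) (simp add: p_def)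
  moreover have "bij_betw p (X - set a) (X - set b)" using g by (rule bij_betw_cong[THEN iffD1, rotated]) (simp add: p_def)
  ultimately have "bij_betw p (set a \<union> (X - set a)) (set b \<union> (X - set b))"
    by (rule bij_betw_combine) auto
  then have "bij_betw p X X" using a b by (simp add: Un_absorb1)
  then have "p permutes X" by (rule bij_imp_permutes) (use a in \<open>auto simp: p_def\<close>)
  moreover have "map p a = b"
    by (rule nth_equalityI) (use fa len in \<open>auto simp: p_def\<close>)
  ultimately show ?thesis by blast
qed

lemma free_lrb_level_action:
  assumes "cring K"
  shows "level_action K (free_lrb n) length n 1 (sym_group n) word_action"
proof (intro level_action.intro level_algebra.intro level_algebra_axioms.intro level_action_axioms.intro
    free_lrb_level_monoid assms sym_group_is_group;
    (simp only: free_lrb_simps mem_Collect_eq sym_group_carrier sym_group_mult sym_group_one)?)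
  interpret cring K by fact
  show "nat_in K 1 \<in> Units K" by (simp add: nat_in_def)
  show "finite (carrier (sym_group n))" by (simp add: sym_group_def finite_permutations)
  show "distinct (word_action p a) \<and> set (word_action p a) \<subseteq> {1..n}"
    if "p permutes {1..n}" "distinct a \<and> set a \<subseteq> {1..n}" for p a
    using that permutes_inj_on[OF that(1), of "set a"] permutes_image[OF that(1)]
    by (auto simp: word_action_def distinct_map)
  show "word_action id a = a" for a by (simp add: word_action_def)
  show "word_action (p \<circ> r) a = word_action p (word_action r a)" for p r a by (simp add: word_action_def)
  show "length (word_action p a) = length a" for p a by (simp add: word_action_def)
  show "\<exists>p\<in>carrier (sym_group n). word_action p a = b"
    if "distinct a \<and> set a \<subseteq> {1..n}" "distinct b \<and> set b \<subseteq> {1..n}" "length a = length b" for a b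
    using ex_permutes_map_eq[of a "{1..n}" b] that by (auto simp: sym_group_carrier word_action_def)
qed

theorem theorem2p9:
  fixes K :: "('k, 'c) ring_scheme" and n :: nat and q :: nat
  assumes "cring K" and "q = card (UNIV :: 'f::{field,finite} set)"
  shows
    "(let M = free_lrb n; G = sym_group n;
          R = monoid_algebra K M; S = invariant_subalgebra K M G word_action;
          x = letter_sum K n; \<gamma> = poly_map K R x;
          I = PIdl\<^bsub>UP K\<^esub> (root_poly K (\<lambda>i. i) n)
      in \<gamma> \<in> alg_hom K (UP K) R \<and> \<gamma> (poly_X K) = x \<and>
         (\<exists>\<Gamma>\<in>alg_iso K (alg_quot (UP K) I) S. \<forall>p\<in>carrier (UP K). \<Gamma> (I +>\<^bsub>UP K\<^esub> p) = \<gamma> p) \<and>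
         cring S \<and> generated_subalgebra K R {x} = carrier S \<and>
         (field K \<and> nat_in K (Coset.order G) \<in> Units K \<longrightarrow>
           (\<forall>V :: (nat list \<Rightarrow> 'k, 'v) module.
             Module.module S V \<and> vectorspace.fin_dim K (restrict_scalars S V) \<longrightarrow>
             acts_semisimply_with_eigenvalues_in K (restrict_scalars S V) (\<lambda>v. x \<odot>\<^bsub>V\<^esub> v)
               {nat_in K i | i. i \<in> {0..n}}))) \<and>
     (nat_in K q \<in> Units K \<longrightarrow>
      (let M = flag_monoid TYPE('f) n; G = general_linear_group TYPE('f) n;
           R = monoid_algebra K M; S = invariant_subalgebra K M G flag_action;
           x = line_sum K TYPE('f) n; \<gamma> = poly_map K R x;
           I = PIdl\<^bsub>UP K\<^esub> (root_poly K (q_int q) n)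
       in \<gamma> \<in> alg_hom K (UP K) R \<and> \<gamma> (poly_X K) = x \<and>
          (\<exists>\<Gamma>\<in>alg_iso K (alg_quot (UP K) I) S. \<forall>p\<in>carrier (UP K). \<Gamma> (I +>\<^bsub>UP K\<^esub> p) = \<gamma> p) \<and>
          cring S \<and> generated_subalgebra K R {x} = carrier S \<and>
          (field K \<and> nat_in K (Coset.order G) \<in> Units K \<longrightarrow>
            (\<forall>V :: ('f vec set list \<Rightarrow> 'k, 'w) module.
              Module.module S V \<and> vectorspace.fin_dim K (restrict_scalars S V) \<longrightarrow>
              acts_semisimply_with_eigenvalues_in K (restrict_scalars S V) (\<lambda>v. x \<odot>\<^bsub>V\<^esub> v)
                {nat_in K (q_int q i) | i. i \<in> {0..n}}))))"
proof (intro conjI impI)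
  interpret W: level_action K "free_lrb n" length n 1 "sym_group n" word_action
    by (rule free_lrb_level_action[OF assms(1)])
  have x: "letter_sum K n = W.x"
    unfolding letter_sum_def
    by (rule W.finsum_letters_eq_x) (auto simp: W.level_def free_lrb_simps inj_on_def length_Suc_conv image_iff)
  \<comment> \<open>At \<open>q = 1\<close> the numbers \<open>[i]\<close> become \<open>i\<close>,
    which gives the roots and eigenvalues \<open>0, ..., n\<close> of the word case.\<close>
  note pres = W.invariants_presentation[folded x, unfolded q_int_1]
  note semi = W.invariants_act_semisimply[folded x, unfolded q_int_1]
  show "let M = free_lrb n; G = sym_group n;
          R = monoid_algebra K M; S = invariant_subalgebra K M G word_action;
          x = letter_sum K n; \<gamma> = poly_map K R x;
          I = PIdl\<^bsub>UP K\<^esub> (root_poly K (\<lambda>i. i) n)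
      in \<gamma> \<in> alg_hom K (UP K) R \<and> \<gamma> (poly_X K) = x \<and>
         (\<exists>\<Gamma>\<in>alg_iso K (alg_quot (UP K) I) S. \<forall>p\<in>carrier (UP K). \<Gamma> (I +>\<^bsub>UP K\<^esub> p) = \<gamma> p) \<and>
         cring S \<and> generated_subalgebra K R {x} = carrier S \<and>
         (field K \<and> nat_in K (Coset.order G) \<in> Units K \<longrightarrow>
           (\<forall>V :: (nat list \<Rightarrow> 'k, 'v) module.
             Module.module S V \<and> vectorspace.fin_dim K (restrict_scalars S V) \<longrightarrow>
             acts_semisimply_with_eigenvalues_in K (restrict_scalars S V) (\<lambda>v. x \<odot>\<^bsub>V\<^esub> v)
               {nat_in K i | i. i \<in> {0..n}}))"
    unfolding Let_def using pres by (intro conjI impI allI semi) ((elim conjE)?, assumption)+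
next
  assume q: "nat_in K q \<in> Units K"
  interpret V: finite_field_flags n q "TYPE('f)" by unfold_locales (rule assms(2))
  interpret W: level_action K "flag_monoid TYPE('f) n" length n q "general_linear_group TYPE('f) n" flag_action
    by (rule V.flag_level_action[OF assms(1) q])
  have x: "line_sum K TYPE('f) n = W.x"
    unfolding line_sum_def
  proof (rule W.finsum_letters_eq_x)
    show "(\<lambda>L. [L]) ` {L. vec_subspace TYPE('f) n 1 L} = W.level 1"
      using V.letter_flag_iff by (auto simp: W.level_def V.flag_monoid_simps)
  qed (simp add: inj_on_def)
  note pres = W.invariants_presentation[folded x]
  note semi = W.invariants_act_semisimply[folded x]
  show "let M = flag_monoid TYPE('f) n; G = general_linear_group TYPE('f) n;
           R = monoid_algebra K M; S = invariant_subalgebra K M G flag_action;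
           x = line_sum K TYPE('f) n; \<gamma> = poly_map K R x;
           I = PIdl\<^bsub>UP K\<^esub> (root_poly K (q_int q) n)
       in \<gamma> \<in> alg_hom K (UP K) R \<and> \<gamma> (poly_X K) = x \<and>
          (\<exists>\<Gamma>\<in>alg_iso K (alg_quot (UP K) I) S. \<forall>p\<in>carrier (UP K). \<Gamma> (I +>\<^bsub>UP K\<^esub> p) = \<gamma> p) \<and>
          cring S \<and> generated_subalgebra K R {x} = carrier S \<and>
          (field K \<and> nat_in K (Coset.order G) \<in> Units K \<longrightarrow>
            (\<forall>V :: ('f vec set list \<Rightarrow> 'k, 'w) module.
              Module.module S V \<and> vectorspace.fin_dim K (restrict_scalars S V) \<longrightarrow>
              acts_semisimply_with_eigenvalues_in K (restrict_scalars S V) (\<lambda>v. x \<odot>\<^bsub>V\<^esub> v)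
                {nat_in K (q_int q i) | i. i \<in> {0..n}}))"
    unfolding Let_def using pres by (intro conjI impI allI semi) ((elim conjE)?, assumption)+
qed

end
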